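(* Let $T\sim S^n(\mathbf d,\mathcal T)$ be an $n$-dimensional subordinator and $X\sim L^n(\boldsymbol\mu,\Sigma,\mathcal X)$ an $n$-dimensional Lévy process. If $Z=(Z_1,Z_2)$ is a Lévy process with $n$-dimensional components $Z_1$ and $Z_2$ such that $Z\overset{D}{=}(T,X\odot T)$ in the weak sense, then $Z_1\overset{D}{=}T$ and $Z_2\sim L^n(\mathbf m_2,\Theta_2,\mathcal Z_2)$ with $$\mathbf m_2=\mathbf c(\mathbf d,\mathcal X)+\mathbf d\diamond\boldsymbol\mu+\int_{[0,\infty)^n_*}\mathbb E[X(\mathbf t)\mathbf 1_{\mathbb D}(X(\mathbf t))]\,\mathcal T(d\mathbf t),\qquad\Theta_2=\mathbf d\diamond\Sigma,$$ $$\mathcal Z_2(d\mathbf x)=\mathbf d\diamond\mathcal X(d\mathbf x)+\int_{[0,\infty)^n_*}\mathbb P(X(\mathbf t)\in d\mathbf x)\,\mathcal T(d\mathbf t)\quad\text{on }\mathbb R^n_*.$$ In addition, if $J\subseteq\{1,\dots,n\}$, then $(T\boldsymbol\pi_J,(X\odot T)\boldsymbol\pi_J)\overset{D}{=}(T\boldsymbol\pi_J,(X\boldsymbol\pi_J)\odot(T\boldsymbol\pi_J))$ and, particularly, $(T_k,(X\odot T)_k)\overset{D}{=}(T_k,X_k\odot T_k)$ for $1\le k\le n$.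
   Context: Basic notation. Elements of $\mathbb R^n$ are row vectors, $\langle\mathbf x,\mathbf y\rangle=\mathbf x\mathbf y'$, $\|\cdot\|$ is the Euclidean norm, $\|\mathbf x\|_\Sigma^2=\mathbf x\Sigma\mathbf x'$. $\mathbb D=\{\|\mathbf x\|\le 1\}$ is the closed Euclidean unit ball (in $\mathbb R^n$ or $\mathbb R^{2n}$ according to context), $\mathbb D^C$ its complement, $A_*=A\setminus\{\mathbf 0\}$, $\boldsymbol\delta_{\mathbf 0}$ is the Dirac measure at $\mathbf 0$. $\mathbf e_1,\dots,\mathbf e_n$ is the canonical basis. For $J\subseteq\{1,\dots,n\}$, $\boldsymbol\pi_J(\mathbf x)=\mathbf x\boldsymbol\pi_J=\sum_{j\in J}x_j\mathbf e_j$ ($\boldsymbol\pi_\emptyset\equiv\mathbf 0$). For a Borel measure $\mathcal X$ on $\mathbb R^n_*$, $\mathcal X_J$ is the restriction to $\mathbb R^n_*$ of the image under $\boldsymbol\pi_J$ of $\mathcal X$ (extended by $\mathcal X(\{\mathbf 0\})=0$). $\overset{D}{=}$ between processes denotes equality in law. Lévy processes. $X\sim L^n(\boldsymbol\mu,\Sigma,\mathcal X)$ means that $X$ is an $n$-dimensional Lévy process with $\mathbb E e^{i\langle\boldsymbol\theta,X(t)\rangle}=e^{t\Psi_X(\boldsymbol\theta)}$, $\Psi_X(\boldsymbol\theta)=i\langle\boldsymbol\mu,\boldsymbol\theta\rangle-\frac12\|\boldsymbol\theta\|^2_\Sigma+\int_{\mathbb R^n_*}(e^{i\langle\boldsymbol\theta,\mathbf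 x\rangle}-1-i\langle\boldsymbol\theta,\mathbf x\rangle\mathbf 1_{\mathbb D}(\mathbf x))\mathcal X(d\mathbf x)$. $T\sim S^n(\mathbf d,\mathcal T)$ means that $T$ is an $n$-dimensional subordinator (a Lévy process with nondecreasing components) with drift $\mathbf d\in[0,\infty)^n$ and Lévy measure $\mathcal T$ on $[0,\infty)^n_*$. Multivariate time. For $\mathbf t=(t_1,\dots,t_n)\in[0,\infty)^n$: $X(\mathbf t)=(X_1(t_1),\dots,X_n(t_n))$. Order the components $t_{(1)}\le\dots\le t_{(n)}$ with associated permutation $\langle(1),\dots,(n)\rangle$, $t_{(0)}=0$, $\Delta t_{(k)}=t_{(k)}-t_{(k-1)}$. Put $\mathbf t\diamond\boldsymbol\mu=(t_1\mu_1,\dots,t_n\mu_n)$, $(\mathbf t\diamond\Sigma)_{kl}=\Sigma_{kl}(t_k\wedge t_l)$, $\mathbf t\diamond\mathcal X=\sum_{k=1}^n\Delta t_{(k)}\mathcal X_{\{(k),\dots,(n)\}}$, and $\mathbf c(\mathbf t,\mathcal X)=\sum_{k=2}^n\Delta t_{(k)}\int_{\mathbb D^C}\boldsymbol\pi_{\{(k),\dots,(n)\}}(\mathbf x)\mathbf 1_{\mathbb D}(\boldsymbol\pi_{\{(k),\dots,(n)\}}(\mathbf x))\,\mathcal X(d\mathbf x)$. Weak subordination. For a subordinator $T\sim S^n(\mathbf d,\mathcal T)$ and $X\sim L^n(\boldsymbol\mu,\Sigma,\mathcal X)$ (any dimension $n\ge1$), a process $Z=(Z_1,Z_2)$ is called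 $T$ subordinating $X$ in the weak sense, written $Z\overset{D}{=}(T,X\odot T)$, if $Z$ is a Lévy process with $Z\sim L^{2n}(\mathbf m,\Theta,\mathcal Z)$, $\mathbf m=(\mathbf m_1,\mathbf m_2)$, where $\mathbf m_1=\mathbf d+\int_{[0,\infty)^n_*}\mathbf t\,\mathbb P((\mathbf t,X(\mathbf t))\in\mathbb D)\,\mathcal T(d\mathbf t)$, $\mathbf m_2=\mathbf c(\mathbf d,\mathcal X)+\mathbf d\diamond\boldsymbol\mu+\int_{[0,\infty)^n_*}\mathbb E[X(\mathbf t)\mathbf 1_{\mathbb D}(\mathbf t,X(\mathbf t))]\,\mathcal T(d\mathbf t)$, $\Theta=\begin{pmatrix}0&0\\0&\mathbf d\diamond\Sigma\end{pmatrix}$, $\mathcal Z(d\mathbf t,d\mathbf x)=(\boldsymbol\delta_{\mathbf 0}\otimes(\mathbf d\diamond\mathcal X))(d\mathbf t,d\mathbf x)+\mathbf 1_{[0,\infty)^n_*\times\mathbb R^n}(\mathbf t,\mathbf x)\mathbb P(X(\mathbf t)\in d\mathbf x)\mathcal T(d\mathbf t)$. (The vector $\mathbf m_2$ of this definition uses truncation in $\mathbb R^{2n}$; the vector $\mathbf m_2$ in the claim is the one displayed there, with truncation in $\mathbb R^n$.) The symbol $(T,X\odot T)$ stands for any process with this law, and $X\odot T$ for its second $n$-dimensional component. *)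

theory Defs
  imports "HOL-Probability.Probability"
begin

section \<open>Levy processes\<close>

(* Processes are functions of a real time parameter; only their values at times t >= 0 matter.
   Stochastic continuity need not be listed: it follows from the cadlag paths together with
   the stationarity of the increments. *)
definition levy_process :: "'w measure \<Rightarrow> (real \<Rightarrow> 'w \<Rightarrow> real ^ 'n) \<Rightarrow> bool" where
  "levy_process M X \<longleftrightarrow>
     prob_space M \<and>
     (\<forall>t\<ge>0. X t \<in> borel_measurable M) \<and>
     (AE \<omega> in M. X 0 \<omega> = 0) \<and>
     (\<forall>(s :: nat \<Rightarrow> real) m. 0 \<le> s 0 \<longrightarrow> mono s \<longrightarrow>
        prob_space.indep_vars M (\<lambda>_. borel) (\<lambda>i \<omega>. X (s (Suc i)) \<omega> - X (s i) \<omega>) {..<m}) \<and>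
     (\<forall>s\<ge>0. \<forall>h\<ge>0. distr M borel (\<lambda>\<omega>. X (s + h) \<omega> - X s \<omega>) = distr M borel (X h)) \<and>
     (AE \<omega> in M. \<forall>t\<ge>0. ((\<lambda>s. X s \<omega>) \<longlongrightarrow> X t \<omega>) (at_right t) \<and>
        (0 < t \<longrightarrow> (\<exists>l. ((\<lambda>s. X s \<omega>) \<longlongrightarrow> l) (at_left t))))"

(* Measures on the punctured space are represented by their extension to the
   whole space with no mass at 0. *)
definition levy_measure :: "(real ^ 'n) measure \<Rightarrow> bool" where
  "levy_measure \<X> \<longleftrightarrow> sets \<X> = sets borel \<and> emeasure \<X> {0} = 0 \<and>
     (\<integral>\<^sup>+ x. ennreal (min 1 ((norm x)\<^sup>2)) \<partial>\<X>) < \<infinity>"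

definition levy_exponent ::
    "real ^ 'n \<Rightarrow> real ^ 'n ^ 'n \<Rightarrow> (real ^ 'n) measure \<Rightarrow> real ^ 'n \<Rightarrow> complex" where
  "levy_exponent \<mu> \<Sigma> \<X> \<theta> =
     \<i> * of_real (\<mu> \<bullet> \<theta>) - of_real (\<theta> \<bullet> (\<Sigma> *v \<theta>)) / 2
     + (CLINT x|\<X>. iexp (\<theta> \<bullet> x) - 1 - \<i> * of_real ((\<theta> \<bullet> x) * indicator (cball 0 1) x))"

definition levy_law ::
    "'w measure \<Rightarrow> (real \<Rightarrow> 'w \<Rightarrow> real ^ 'n) \<Rightarrow>
     real ^ 'n \<Rightarrow> real ^ 'n ^ 'n \<Rightarrow> (real ^ 'n) measure \<Rightarrow> bool" where
  "levy_law M X \<mu> \<Sigma> \<X> \<longleftrightarrow>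
     levy_process M X \<and>
     transpose \<Sigma> = \<Sigma> \<and> (\<forall>\<theta>. 0 \<le> \<theta> \<bullet> (\<Sigma> *v \<theta>)) \<and>
     levy_measure \<X> \<and>
     (\<forall>t\<ge>0. \<forall>\<theta>. (CLINT \<omega>|M. iexp (\<theta> \<bullet> X t \<omega>)) = exp (of_real t * levy_exponent \<mu> \<Sigma> \<X> \<theta>))"

definition orthant :: "(real ^ 'n) set" where
  "orthant = {t. \<forall>i. 0 \<le> t $ i}"

definition orthant0 :: "(real ^ 'n) set" where
  "orthant0 = orthant - {0}"

(* The drift of a process of finite variation without Gaussian part is the location parameter
   belonging to the truncation by the unit ball, minus the truncated first moment of the
   Levy measure. *)
definition subordinator_law ::
    "'w measure \<Rightarrow> (real \<Rightarrow> 'w \<Rightarrow> real ^ 'n) \<Rightarrow> real ^ 'n \<Rightarrow> (real ^ 'n) measure \<Rightarrow> bool" where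
  "subordinator_law M T d \<T> \<longleftrightarrow>
     (AE \<omega> in M. \<forall>s t i. 0 \<le> s \<longrightarrow> s \<le> t \<longrightarrow> T s \<omega> $ i \<le> T t \<omega> $ i) \<and>
     d \<in> orthant \<and>
     emeasure \<T> (- orthant0) = 0 \<and>
     (\<integral>\<^sup>+ t. ennreal (min 1 (norm t)) \<partial>\<T>) < \<infinity> \<and>
     levy_law M T (d + (LINT t:cball 0 1|\<T>. t)) 0 \<T>"

(* Equality in law on the path space with the product sigma-algebra. *)
definition eq_in_law ::
    "'v measure \<Rightarrow> (real \<Rightarrow> 'v \<Rightarrow> real ^ 'n) \<Rightarrow> 'w measure \<Rightarrow> (real \<Rightarrow> 'w \<Rightarrow> real ^ 'n) \<Rightarrow> bool" where
  "eq_in_law M X N Y \<longleftrightarrow>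
     distr M (PiM {0..} (\<lambda>_. borel)) (\<lambda>\<omega>. \<lambda>t\<in>{0..}. X t \<omega>) =
     distr N (PiM {0..} (\<lambda>_. borel)) (\<lambda>\<omega>. \<lambda>t\<in>{0..}. Y t \<omega>)"


section \<open>Multivariate time\<close>

definition coord_proj :: "'n set \<Rightarrow> real ^ 'n \<Rightarrow> real ^ 'n" where
  "coord_proj J x = (\<chi> j. if j \<in> J then x $ j else 0)"

definition proj_measure :: "'n set \<Rightarrow> (real ^ 'n) measure \<Rightarrow> (real ^ 'n) measure" where
  "proj_measure J \<X> = density (distr \<X> borel (coord_proj J)) (indicator (- {0}))"

definition multitime :: "(real \<Rightarrow> 'w \<Rightarrow> real ^ 'n) \<Rightarrow> real ^ 'n \<Rightarrow> 'w \<Rightarrow> real ^ 'n" where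
  "multitime X t \<omega> = (\<chi> i. X (t $ i) \<omega> $ i)"

(* A permutation k |-> (k), k = 1..n, with t_(1) <= ... <= t_(n).  If t has ties, it is not
   unique, but the quantities defined below do not depend on the choice. *)
definition time_perm :: "real ^ 'n \<Rightarrow> nat \<Rightarrow> 'n" where
  "time_perm t = (SOME p. bij_betw p {1..CARD('n)} UNIV \<and>
     (\<forall>i\<in>{1..CARD('n)}. \<forall>j\<in>{1..CARD('n)}. i \<le> j \<longrightarrow> t $ p i \<le> t $ p j))"

lemma time_perm:
  fixes t :: "real ^ 'n"
  shows "bij_betw (time_perm t) {1..CARD('n)} UNIV"
    and "\<lbrakk>1 \<le> i; i \<le> j; j \<le> CARD('n)\<rbrakk> \<Longrightarrow> t $ time_perm t i \<le> t $ time_perm t j"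
proof -
  obtain xs0 :: "'n list" where xs0: "set xs0 = UNIV" "distinct xs0"
    using finite_distinct_list[of "UNIV :: 'n set"] by (metis finite)
  define xs where "xs = sort_key (($) t) xs0"
  have xs: "set xs = UNIV" "distinct xs" "length xs = CARD('n)"
    using xs0 distinct_card[of xs0] by (simp_all add: xs_def)
  have srt: "sorted (map (($) t) xs)"
    by (simp add: xs_def)
  define p where "p k = xs ! (k - 1)" for k
  have "bij_betw ((!) xs) {..<CARD('n)} UNIV"
    using xs by (intro bij_betw_nth) auto
  moreover have "bij_betw (\<lambda>k. k - 1) {1..CARD('n)} {..<CARD('n)}"
    by (rule bij_betw_byWitness[where f' = Suc]) auto
  ultimately have "bij_betw ((!) xs \<circ> (\<lambda>k. k - 1)) {1..CARD('n)} UNIV"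
    using bij_betw_trans by blast
  then have 1: "bij_betw p {1..CARD('n)} UNIV"
    by (simp add: p_def[abs_def] comp_def)
  have 2: "t $ p i \<le> t $ p j" if "i \<in> {1..CARD('n)}" "j \<in> {1..CARD('n)}" "i \<le> j" for i j
  proof -
    have "map (($) t) xs ! (i - 1) \<le> map (($) t) xs ! (j - 1)"
      using that xs(3) by (intro sorted_nth_mono[OF srt]) auto
    then show ?thesis
      using that xs(3) by (simp add: p_def)
  qed
  have ex: "\<exists>p. bij_betw p {1..CARD('n)} (UNIV :: 'n set) \<and>
     (\<forall>i\<in>{1..CARD('n)}. \<forall>j\<in>{1..CARD('n)}. i \<le> j \<longrightarrow> t $ p i \<le> t $ p j)"
    using 1 2 by blast
  note * = someI_ex[OF ex, folded time_perm_def]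
  show "bij_betw (time_perm t) {1..CARD('n)} UNIV"
    using * by blast
  show "t $ time_perm t i \<le> t $ time_perm t j" if "1 \<le> i" "i \<le> j" "j \<le> CARD('n)"
    using * that by auto
qed

definition time_ord :: "real ^ 'n \<Rightarrow> nat \<Rightarrow> real" where
  "time_ord t k = (if k = 0 then 0 else t $ time_perm t k)"

definition time_gap :: "real ^ 'n \<Rightarrow> nat \<Rightarrow> real" where
  "time_gap t k = time_ord t k - time_ord t (k - 1)"

definition time_tail :: "real ^ 'n \<Rightarrow> nat \<Rightarrow> 'n set" where
  "time_tail t k = time_perm t ` {k..CARD('n)}"

definition diamond_vec :: "real ^ 'n \<Rightarrow> real ^ 'n \<Rightarrow> real ^ 'n" where
  "diamond_vec t \<mu> = (\<chi> i. t $ i * \<mu> $ i)"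

definition diamond_mat :: "real ^ 'n \<Rightarrow> real ^ 'n ^ 'n \<Rightarrow> real ^ 'n ^ 'n" where
  "diamond_mat t \<Sigma> = (\<chi> k l. \<Sigma> $ k $ l * min (t $ k) (t $ l))"

(* For t in the orthant the gaps are nonnegative, so ennreal does not cut them off. *)
definition diamond_measure :: "real ^ 'n \<Rightarrow> (real ^ 'n) measure \<Rightarrow> (real ^ 'n) measure" where
  "diamond_measure t \<X> = measure_of UNIV (sets borel)
     (\<lambda>B. \<Sum>k = 1..CARD('n).
        ennreal (time_gap t k) * emeasure (proj_measure (time_tail t k) \<X>) B)"

definition compensation :: "real ^ 'n \<Rightarrow> (real ^ 'n) measure \<Rightarrow> real ^ 'n" where
  "compensation t \<X> = (\<Sum>k = 2..CARD('n). time_gap t k *\<^sub>R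
     (LINT x:- cball 0 1|\<X>.
        indicator (cball 0 1) (coord_proj (time_tail t k) x) *\<^sub>R coord_proj (time_tail t k) x))"


section \<open>Weak subordination\<close>

(* R^(2n) is real ^ ('n + 'n), the first n coordinates being the Inl ones. *)
definition vjoin :: "real ^ 'n \<Rightarrow> real ^ 'n \<Rightarrow> real ^ ('n + 'n)" where
  "vjoin x y = (\<chi> k. case k of Inl i \<Rightarrow> x $ i | Inr i \<Rightarrow> y $ i)"

definition vfst :: "real ^ ('n + 'n) \<Rightarrow> real ^ 'n" where
  "vfst z = (\<chi> i. z $ Inl i)"

definition vsnd :: "real ^ ('n + 'n) \<Rightarrow> real ^ 'n" where
  "vsnd z = (\<chi> i. z $ Inr i)"

definition weak_location1 ::
    "real ^ 'n \<Rightarrow> (real ^ 'n) measure \<Rightarrow> 'w measure \<Rightarrow> (real \<Rightarrow> 'w \<Rightarrow> real ^ 'n) \<Rightarrow> real ^ 'n" where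
  "weak_location1 d \<T> M X = d +
     (LINT t:orthant0|\<T>. \<P>(\<omega> in M. vjoin t (multitime X t \<omega>) \<in> cball 0 1) *\<^sub>R t)"

definition weak_location2 ::
    "real ^ 'n \<Rightarrow> (real ^ 'n) measure \<Rightarrow> 'w measure \<Rightarrow> (real \<Rightarrow> 'w \<Rightarrow> real ^ 'n) \<Rightarrow>
     real ^ 'n \<Rightarrow> (real ^ 'n) measure \<Rightarrow> real ^ 'n" where
  "weak_location2 d \<T> M X \<mu> \<X> = compensation d \<X> + diamond_vec d \<mu> +
     (LINT t:orthant0|\<T>. (LINT \<omega>|M.
        indicator (cball 0 1) (vjoin t (multitime X t \<omega>)) *\<^sub>R multitime X t \<omega>))"

definition weak_covariance :: "real ^ 'n \<Rightarrow> real ^ 'n ^ 'n \<Rightarrow> real ^ ('n + 'n) ^ ('n + 'n)" where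
  "weak_covariance d \<Sigma> = (\<chi> k l. case (k, l) of
     (Inr i, Inr j) \<Rightarrow> diamond_mat d \<Sigma> $ i $ j | _ \<Rightarrow> 0)"

definition weak_levy_measure ::
    "real ^ 'n \<Rightarrow> (real ^ 'n) measure \<Rightarrow> 'w measure \<Rightarrow> (real \<Rightarrow> 'w \<Rightarrow> real ^ 'n) \<Rightarrow>
     (real ^ 'n) measure \<Rightarrow> (real ^ ('n + 'n)) measure" where
  "weak_levy_measure d \<T> M X \<X> = measure_of UNIV (sets borel)
     (\<lambda>A. emeasure (distr (return borel 0 \<Otimes>\<^sub>M diamond_measure d \<X>) borel (\<lambda>(t, x). vjoin t x)) A +
       (\<integral>\<^sup>+ t\<in>orthant0. emeasure M {\<omega> \<in> space M. vjoin t (multitime X t \<omega>) \<in> A} \<partial>\<T>))"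

(* Z is T subordinating X in the weak sense, for T with law S(d, \<T>) and X with law L(\<mu>, \<Sigma>, \<X>).
   All ingredients depend on T and X through their laws only; nothing is assumed about a
   joint distribution of T, X and Z, which may live on different probability spaces. *)
definition weak_subordination ::
    "'u measure \<Rightarrow> (real \<Rightarrow> 'u \<Rightarrow> real ^ 'n) \<Rightarrow> real ^ 'n \<Rightarrow> (real ^ 'n) measure \<Rightarrow>
     'v measure \<Rightarrow> (real \<Rightarrow> 'v \<Rightarrow> real ^ 'n) \<Rightarrow> real ^ 'n \<Rightarrow> real ^ 'n ^ 'n \<Rightarrow> (real ^ 'n) measure \<Rightarrow>
     'w measure \<Rightarrow> (real \<Rightarrow> 'w \<Rightarrow> real ^ ('n + 'n)) \<Rightarrow> bool" where
  "weak_subordination MT T d \<T> MX X \<mu> \<Sigma> \<X> MZ Z \<longleftrightarrow>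
     subordinator_law MT T d \<T> \<and> levy_law MX X \<mu> \<Sigma> \<X> \<and>
     levy_law MZ Z
       (vjoin (weak_location1 d \<T> MX X) (weak_location2 d \<T> MX X \<mu> \<X>))
       (weak_covariance d \<Sigma>)
       (weak_levy_measure d \<T> MX X \<X>)"

(* The characteristics are determined by the laws of T and X, so this is a relation between
   processes only. *)
definition weakly_subordinates ::
    "'u measure \<Rightarrow> (real \<Rightarrow> 'u \<Rightarrow> real ^ 'n) \<Rightarrow> 'v measure \<Rightarrow> (real \<Rightarrow> 'v \<Rightarrow> real ^ 'n) \<Rightarrow>
     'w measure \<Rightarrow> (real \<Rightarrow> 'w \<Rightarrow> real ^ ('n + 'n)) \<Rightarrow> bool" where
  "weakly_subordinates MT T MX X MZ Z \<longleftrightarrow>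
     (\<exists>d \<T> \<mu> \<Sigma> \<X>. weak_subordination MT T d \<T> MX X \<mu> \<Sigma> \<X> MZ Z)"


section \<open>Characteristics of the second component\<close>

(* In contrast to weak_location2, the truncation is by the unit ball of R^n. *)
definition marginal_location ::
    "real ^ 'n \<Rightarrow> (real ^ 'n) measure \<Rightarrow> 'w measure \<Rightarrow> (real \<Rightarrow> 'w \<Rightarrow> real ^ 'n) \<Rightarrow>
     real ^ 'n \<Rightarrow> (real ^ 'n) measure \<Rightarrow> real ^ 'n" where
  "marginal_location d \<T> M X \<mu> \<X> = compensation d \<X> + diamond_vec d \<mu> +
     (LINT t:orthant0|\<T>. (LINT \<omega>|M.
        indicator (cball 0 1) (multitime X t \<omega>) *\<^sub>R multitime X t \<omega>))"

(* X(t) may vanish with positive probability; the mass at 0 has to be removed. *)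
definition marginal_levy_measure ::
    "real ^ 'n \<Rightarrow> (real ^ 'n) measure \<Rightarrow> 'w measure \<Rightarrow> (real \<Rightarrow> 'w \<Rightarrow> real ^ 'n) \<Rightarrow>
     (real ^ 'n) measure \<Rightarrow> (real ^ 'n) measure" where
  "marginal_levy_measure d \<T> M X \<X> = measure_of UNIV (sets borel)
     (\<lambda>B. emeasure (diamond_measure d \<X>) (B - {0}) +
       (\<integral>\<^sup>+ t\<in>orthant0. emeasure M {\<omega> \<in> space M. multitime X t \<omega> \<in> B - {0}} \<partial>\<T>))"

end

theory Submission
  imports Defs
begin

text \<open>
  Everything follows from one computation. Let A be a linear contraction and let Z be a Levy process
  with triplet (m, \<Theta>, N). Moving A to the other side of the inner product in the Levy-Khintchine
  formula shows that A Z is a Levy process with covariance A \<Theta> A', with the image of N under A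
  (stripped of its mass at 0) as Levy measure, and with location A m + r. The correction r is the
  N-integral of (1(A z) - 1(z)) A z, where 1 is the indicator of the unit ball; it converges absolutely
  because its integrand vanishes on the unit ball and is bounded by 1 elsewhere
  (\<open>levy_law_linear_image\<close>). The two components, the projections and the single coordinates are all
  images of this kind, under maps that select coordinates, so it remains to recognise the transformed
  triplets.

  For the first component the transformed triplet is that of T. Equality in law on path space then
  follows since the triplet gives the characteristic functions of the one-dimensional marginals, these
  give the marginals themselves (\<open>measure_eqI_characteristic_function\<close>), and independent
  stationary increments give all finite-dimensional distributions (\<open>levy_process_eq_in_law\<close>).

  For the second component and for the projections the integrals over t of the truncated means
  E(X(t) 1(t, X(t))) have to be shifted to another truncation. In general these integrals converge only in iterated
  form: the mean of \<bar>X(t)\<bar> 1(t, X(t)) may be of the order of the square root of \<bar>t\<bar>, and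
  this need not be integrable.
  What saves them is that E(sin X_i(t_i)) is the imaginary part of exp(t_i \<Psi>(e_i)), hence
  O(\<bar>t\<bar>), while the truncated X_i(t_i) differs from sin X_i(t_i) by at most min(1, \<bar>(t, X(t))\<bar>^2),
  which is integrable because the Levy measure of Z is one (\<open>integrable_truncated_mean\<close>).
  Once the truncated mean is known to be integrable, all changes of truncation are absolutely
  convergent integrals over the product of the Levy measure of T and the law of X.

  The quantities built from the ordering of d need a description that survives the deletion of
  coordinates. For every set function F with F({}) = 0,
  the sum of \<Delta>d_(k) F({(k), ..., (n)}) over k is the integral of F({i. s < d_i}) over s \<ge> 0
  (\<open>has_integral_layers\<close>), where no ordering appears. Thus a coordinate map acts on the diamond
  operation and on the compensation by taking preimages of index sets; this yields
  \<open>diamond_measure_coord_map\<close> and \<open>compensation_coord_map\<close>.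

  Finally, the definition of the Levy measure of Z involves t-integrals of probabilities of events for
  X(t). Right continuity of the paths provides a version of X(t) that is jointly measurable in t and in
  the sample point (\<open>rc_multitime\<close>), so that these integrals are values of an image of a product
  measure.
\<close>

section \<open>Finite measures on Euclidean space and their characteristic functions\<close>

text \<open>
  Normalising the total mass reduces this to probability measures. The mass itself is the value of the
  transform at 0; if it is 0, there is nothing to normalise and both measures vanish.
\<close>
lemma finite_measure_eqI_char:
  fixes M N :: "real measure"
  assumes M: "finite_measure M" "sets M = sets borel" and N: "finite_measure N" "sets N = sets borel"
    and eq: "\<And>u. (CLINT x|M. iexp (u * x)) = (CLINT x|N. iexp (u * x))"
  shows "M = N"
proof -
  interpret M: finite_measure M by fact
  interpret N: finite_measure N by fact
  have sp: "space M = UNIV" "space N = UNIV"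
    using M(2) N(2) by (auto dest: sets_eq_imp_space_eq)
  have mass: "measure M UNIV = measure N UNIV"
    using eq[of 0] sp by simp
  define c where "c = measure M UNIV"
  have cM: "emeasure M UNIV = ennreal c" and cN: "emeasure N UNIV = ennreal c"
    using mass by (simp_all add: c_def M.emeasure_eq_measure N.emeasure_eq_measure)
  show ?thesis
  proof (cases "c = 0")
    case True
    have "emeasure M A = 0" "emeasure N A = 0" for A
      using emeasure_space[of M A] emeasure_space[of N A] cM cN True sp by auto
    then show ?thesis
      using M(2) N(2) by (intro measure_eqI) auto
  next
    case False
    then have c: "c > 0"
      by (simp add: c_def less_le)
    have distr: "real_distribution (density K (\<lambda>_. ennreal (1 / c)))"
      if "sets K = sets borel" "emeasure K UNIV = ennreal c" for K :: "real measure"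
    proof -
      have "space K = UNIV"
        using that(1) by (auto dest: sets_eq_imp_space_eq)
      then have "prob_space (density K (\<lambda>_. ennreal (1 / c)))"
        using that c by (intro prob_spaceI) (simp add: emeasure_density ennreal_mult[symmetric])
      then show ?thesis
        using that by (simp add: real_distribution_def real_distribution_axioms_def)
    qed
    have char: "char (density K (\<lambda>_. ennreal (1 / c))) u = (CLINT x|K. iexp (u * x)) / c"
      if "sets K = sets borel" for K :: "real measure" and u
    proof -
      have [measurable_cong]: "sets K = sets borel" by fact
      show ?thesis
        unfolding char_def using c
        by (subst integral_density) (auto simp: scaleR_conv_of_real)
    qed
    have "density M (\<lambda>_. ennreal (1 / c)) = density N (\<lambda>_. ennreal (1 / c))"
      using M(2) N(2) cM cN eq
      by (intro Levy_uniqueness distr) (auto simp: char fun_eq_iff)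
    moreover have "emeasure (density K (\<lambda>_. ennreal (1 / c))) A = ennreal (1 / c) * emeasure K A"
      if "A \<in> sets borel" "sets K = sets borel" for K :: "real measure" and A
      using that by (simp add: emeasure_density nn_integral_cmult)
    ultimately have "ennreal (1 / c) * emeasure M A = ennreal (1 / c) * emeasure N A" if "A \<in> sets borel" for A
      using that M(2) N(2) by metis
    then have "emeasure M A = emeasure N A" if "A \<in> sets borel" for A
      using that c by (simp add: ennreal_mult_cancel_left)
    then show ?thesis
      using M(2) N(2) by (intro measure_eqI) auto
  qed
qed

text \<open>
  Lets the one-dimensional uniqueness theorem act on the k-th coordinate alone, while the rest of the
  integrand is carried along as a density.
\<close>
lemma weighted_marginal_eq:
  fixes M N :: "(real ^ 'n) measure" and f :: "real ^ 'n \<Rightarrow> real"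
  assumes M: "finite_measure M" "sets M = sets borel" and N: "finite_measure N" "sets N = sets borel"
    and f[measurable]: "f \<in> borel_measurable borel" and bound: "\<And>x. 0 \<le> f x" "\<And>x. f x \<le> C"
    and eq: "\<And>u. (CLINT x|M. of_real (f x) * iexp (u * x $ k)) = (CLINT x|N. of_real (f x) * iexp (u * x $ k))"
    and B: "B \<in> sets borel"
  shows "(LINT x|M. f x * indicator B (x $ k)) = (LINT x|N. f x * indicator B (x $ k))"
proof -
  note [measurable_cong] = M(2) N(2)
  define R where "R K = distr (density K (\<lambda>x. ennreal (f x))) borel (\<lambda>x. x $ k)" for K :: "(real^'n) measure"
  have int: "integrable K (\<lambda>x. f x)" if "finite_measure K" "sets K = sets borel" for K
  proof -
    interpret finite_measure K by fact
    have [measurable_cong]: "sets K = sets borel" by fact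
    show ?thesis
      using bound by (intro integrable_const_bound[of _ C]) auto
  qed
  have fin: "finite_measure (R K)" if "finite_measure K" "sets K = sets borel" for K
  proof -
    have [measurable_cong]: "sets K = sets borel" by fact
    have "(\<integral>\<^sup>+ x. ennreal (f x) \<partial>K) < \<infinity>"
      using int[OF that] bound by (simp add: nn_integral_eq_integral)
    then show ?thesis
      unfolding R_def by (intro finite_measure.finite_measure_distr finite_measureI)
        (auto simp: emeasure_density cong: nn_integral_cong)
  qed
  have ch: "(CLINT y|R K. iexp (u * y)) = (CLINT x|K. of_real (f x) * iexp (u * x $ k))"
    if "sets K = sets borel" for K u
  proof -
    have [measurable_cong]: "sets K = sets borel" by fact
    show ?thesis
      unfolding R_def using bound by (simp add: integral_distr integral_density scaleR_conv_of_real)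
  qed
  have "R M = R N"
    using fin[OF M] fin[OF N] by (intro finite_measure_eqI_char) (simp_all only: ch[OF M(2)] ch[OF N(2)] eq, simp_all add: R_def)
  moreover have "(LINT y|R K. indicator B y :: real) = (LINT x|K. f x * indicator B (x $ k))"
    if "sets K = sets borel" for K
  proof -
    have [measurable_cong]: "sets K = sets borel" by fact
    show ?thesis
      unfolding R_def using bound B
      by (subst integral_distr; simp del: Bochner_Integration.integral_indicator integral_indicator)
         (subst integral_density; simp)
  qed
  ultimately show ?thesis
    using M N by metis
qed

text \<open>
  Indicators of Borel sets are introduced for one coordinate at a time. In the step for coordinate k,
  the exponential of the remaining coordinates has to be kept as a density, which must be nonnegative;
  it is therefore replaced by 1 + cos and 1 + sin of the same argument. With these densities the
  Fourier transform in the k-th coordinate is still a combination of integrals that agree by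
  the induction hypothesis, at frequencies \<theta> shifted by multiples of the k-th unit vector.
\<close>
lemma measure_eqI_characteristic_function:
  fixes M N :: "(real ^ 'n) measure"
  assumes M: "finite_measure M" "sets M = sets borel" and N: "finite_measure N" "sets N = sets borel"
    and eq: "\<And>\<theta>. (CLINT x|M. iexp (\<theta> \<bullet> x)) = (CLINT x|N. iexp (\<theta> \<bullet> x))"
  shows "M = N"
proof -
  interpret M: finite_measure M by fact
  interpret N: finite_measure N by fact
  note [measurable_cong] = M(2) N(2)
  define w :: "'n set \<Rightarrow> ('n \<Rightarrow> real set) \<Rightarrow> real ^ 'n \<Rightarrow> real"
    where "w S A x = (\<Prod>i\<in>S. indicator (A i) (x $ i))"
    for S A x
  have w01: "0 \<le> w S A x" "w S A x \<le> 1" for S A x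
    by (auto simp: w_def intro!: prod_nonneg prod_le_1)
  have wm: "w S A \<in> borel_measurable borel" if "\<And>i. A i \<in> sets borel" for S A
    unfolding w_def using that by measurable
  have key: "(CLINT x|M. of_real (w S A x) * iexp (\<theta> \<bullet> x)) = (CLINT x|N. of_real (w S A x) * iexp (\<theta> \<bullet> x))"
    if "finite S" "\<And>i. A i \<in> sets borel" for S A \<theta>
    using that(1)
  proof (induction S arbitrary: \<theta>)
    case empty
    then show ?case using eq by (simp add: w_def)
  next
    case (insert k S)
    note [measurable] = wm[OF that(2)]
    have inte: "integrable K (\<lambda>x. of_real (w S A x) * iexp (\<eta> \<bullet> x))" if "K = M \<or> K = N" for \<eta> K
    proof -
      interpret finite_measure K using that M N by auto
      have [measurable_cong]: "sets K = sets borel" using that M N by auto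
      show ?thesis
        using w01[of S A] by (intro integrable_const_bound[of _ 1]) (auto simp: norm_mult)
    qed
    define e where "e u = u *\<^sub>R (axis k 1 :: real ^ 'n)" for u
    have e: "e u \<bullet> x = u * x $ k" for u x
      by (simp add: e_def inner_axis' )
    \<comment> \<open>Euler's formulas for cos and sin, multiplied by the exponential in the k-th coordinate.\<close>
    have comb: "(CLINT x|K. of_real (w S A x * (1 + cos (\<theta> \<bullet> x))) * iexp (u * x $ k)) =
       (CLINT x|K. of_real (w S A x) * iexp (e u \<bullet> x))
       + (CLINT x|K. of_real (w S A x) * iexp ((e u + \<theta>) \<bullet> x)) / 2
       + (CLINT x|K. of_real (w S A x) * iexp ((e u - \<theta>) \<bullet> x)) / 2"
      if K: "K = M \<or> K = N" for \<theta> u K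
    proof -
      have "(of_real (w S A x * (1 + cos (\<theta> \<bullet> x))) * iexp (u * x $ k)) =
         of_real (w S A x) * iexp (e u \<bullet> x)
       + (of_real (w S A x) * iexp ((e u + \<theta>) \<bullet> x)) / 2
       + (of_real (w S A x) * iexp ((e u - \<theta>) \<bullet> x)) / 2" for x
        by (simp add: e inner_add_left inner_diff_left cos_exp_eq cos_of_real[symmetric]
            algebra_simps exp_add exp_diff exp_minus field_simps flip: cos_of_real)
      then show ?thesis
        using inte[OF K] by (simp add: integrable_divide)
    qed
    have coms: "(CLINT x|K. of_real (w S A x * (1 + sin (\<theta> \<bullet> x))) * iexp (u * x $ k)) =
       (CLINT x|K. of_real (w S A x) * iexp (e u \<bullet> x))
       + (CLINT x|K. of_real (w S A x) * iexp ((e u + \<theta>) \<bullet> x)) / (2 * \<i>)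
       - (CLINT x|K. of_real (w S A x) * iexp ((e u - \<theta>) \<bullet> x)) / (2 * \<i>)"
      if K: "K = M \<or> K = N" for \<theta> u K
    proof -
      have "(of_real (w S A x * (1 + sin (\<theta> \<bullet> x))) * iexp (u * x $ k)) =
         of_real (w S A x) * iexp (e u \<bullet> x)
       + (of_real (w S A x) * iexp ((e u + \<theta>) \<bullet> x)) / (2 * \<i>)
       - (of_real (w S A x) * iexp ((e u - \<theta>) \<bullet> x)) / (2 * \<i>)" for x
        by (simp add: e inner_add_left inner_diff_left sin_exp_eq
            algebra_simps exp_add exp_diff exp_minus field_simps flip: sin_of_real)
      then show ?thesis
        using inte[OF K] by (simp add: integrable_divide)
    qed
    define g where "g x = indicator (A k) (x $ k) * w S A x" for x
    have [measurable]: "A k \<in> sets borel" using that(2) .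
    have gm[measurable]: "g \<in> borel_measurable borel" unfolding g_def by measurable
    have g01: "0 \<le> g x" "g x \<le> 1" for x
      using w01[of S A x] by (auto simp: g_def indicator_def)
    \<comment> \<open>The weights are now nonnegative, so the k-th coordinate can be restricted to A k.\<close>
    have c: "(LINT x|M. w S A x * (1 + cos (\<theta> \<bullet> x)) * indicator (A k) (x $ k)) =
        (LINT x|N. w S A x * (1 + cos (\<theta> \<bullet> x)) * indicator (A k) (x $ k))" for \<theta>
    proof (rule weighted_marginal_eq[OF M N])
      have range: "0 \<le> 1 + cos (\<theta> \<bullet> x)" "1 + cos (\<theta> \<bullet> x) \<le> 2" for x
        using cos_ge_minus_one[of "\<theta> \<bullet> x"] cos_le_one[of "\<theta> \<bullet> x"] by linarith+
      have "w S A x * (1 + cos (\<theta> \<bullet> x)) \<le> 1 * 2" for x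
        by (intro mult_mono w01 range) simp
      then show "w S A x * (1 + cos (\<theta> \<bullet> x)) \<le> 2" for x by simp
      show "0 \<le> w S A x * (1 + cos (\<theta> \<bullet> x))" for x
        by (intro mult_nonneg_nonneg w01 range)
    qed (use insert.IH in \<open>auto simp: comb simp del: of_real_mult\<close>)
    have s: "(LINT x|M. w S A x * (1 + sin (\<theta> \<bullet> x)) * indicator (A k) (x $ k)) =
        (LINT x|N. w S A x * (1 + sin (\<theta> \<bullet> x)) * indicator (A k) (x $ k))" for \<theta>
    proof (rule weighted_marginal_eq[OF M N])
      have range: "0 \<le> 1 + sin (\<theta> \<bullet> x)" "1 + sin (\<theta> \<bullet> x) \<le> 2" for x
        using sin_ge_minus_one[of "\<theta> \<bullet> x"] sin_le_one[of "\<theta> \<bullet> x"] by linarith+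
      have "w S A x * (1 + sin (\<theta> \<bullet> x)) \<le> 1 * 2" for x
        by (intro mult_mono w01 range) simp
      then show "w S A x * (1 + sin (\<theta> \<bullet> x)) \<le> 2" for x by simp
      show "0 \<le> w S A x * (1 + sin (\<theta> \<bullet> x))" for x
        by (intro mult_nonneg_nonneg w01 range)
    qed (use insert.IH in \<open>auto simp: coms simp del: of_real_mult\<close>)
    have gi: "integrable K g" "integrable K (\<lambda>x. g x * cos (\<theta> \<bullet> x))" "integrable K (\<lambda>x. g x * sin (\<theta> \<bullet> x))"
      if "K = M \<or> K = N" for K \<theta>
    proof -
      interpret finite_measure K using that M N by auto
      have [measurable_cong]: "sets K = sets borel" using that M N by auto
      show "integrable K g" "integrable K (\<lambda>x. g x * cos (\<theta> \<bullet> x))" "integrable K (\<lambda>x. g x * sin (\<theta> \<bullet> x))"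
        using g01 by (auto intro!: integrable_const_bound[of _ 1] simp: abs_mult mult_le_one)
    qed
    have split: "(LINT x|K. w S A x * (1 + cos (\<theta> \<bullet> x)) * indicator (A k) (x $ k)) = (LINT x|K. g x) + (LINT x|K. g x * cos (\<theta> \<bullet> x))"
      "(LINT x|K. w S A x * (1 + sin (\<theta> \<bullet> x)) * indicator (A k) (x $ k)) = (LINT x|K. g x) + (LINT x|K. g x * sin (\<theta> \<bullet> x))"
      if "K = M \<or> K = N" for K \<theta>
    proof -
      have "w S A x * (1 + cos (\<theta> \<bullet> x)) * indicator (A k) (x $ k) = g x + g x * cos (\<theta> \<bullet> x)"
        "w S A x * (1 + sin (\<theta> \<bullet> x)) * indicator (A k) (x $ k) = g x + g x * sin (\<theta> \<bullet> x)" for x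
        by (simp_all add: g_def algebra_simps)
      then show "(LINT x|K. w S A x * (1 + cos (\<theta> \<bullet> x)) * indicator (A k) (x $ k)) = (LINT x|K. g x) + (LINT x|K. g x * cos (\<theta> \<bullet> x))"
        "(LINT x|K. w S A x * (1 + sin (\<theta> \<bullet> x)) * indicator (A k) (x $ k)) = (LINT x|K. g x) + (LINT x|K. g x * sin (\<theta> \<bullet> x))"
        using gi(1)[OF that] gi(2,3)[OF that, of \<theta>] by simp_all
    qed
    \<comment> \<open>The added constant 1 is removed again by means of the case \<theta> = 0.\<close>
    have g0: "(LINT x|M. g x) = (LINT x|N. g x)"
      using c[of 0] split(1)[of M 0] split(1)[of N 0] by simp
    have C: "(LINT x|M. g x * cos (\<theta> \<bullet> x)) = (LINT x|N. g x * cos (\<theta> \<bullet> x))"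
      using c[of \<theta>] split(1)[of M \<theta>] split(1)[of N \<theta>] g0 by simp
    have S: "(LINT x|M. g x * sin (\<theta> \<bullet> x)) = (LINT x|N. g x * sin (\<theta> \<bullet> x))"
      using s[of \<theta>] split(2)[of M \<theta>] split(2)[of N \<theta>] g0 by simp
    have "(CLINT x|K. of_real (w (insert k S) A x) * iexp (\<theta> \<bullet> x)) =
       of_real (LINT x|K. g x * cos (\<theta> \<bullet> x)) + \<i> * of_real (LINT x|K. g x * sin (\<theta> \<bullet> x))"
      if K: "K = M \<or> K = N" for K
    proof -
      have 1: "of_real (w (insert k S) A x) * iexp (\<theta> \<bullet> x) =
          of_real (g x * cos (\<theta> \<bullet> x)) + \<i> * of_real (g x * sin (\<theta> \<bullet> x))" for x
        using insert.hyps by (simp add: w_def g_def exp_Euler cos_of_real sin_of_real algebra_simps)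
      show ?thesis
        unfolding 1 using gi(2,3)[OF K, of \<theta>]
        by (subst Bochner_Integration.integral_add) (auto intro!: integrable_mult_right integrable_of_real simp del: of_real_mult)
    qed
    then show ?case
      using C S by simp
  qed
  have box: "emeasure M {..a} = emeasure N {..a}" for a :: "real ^ 'n"
  proof -
    have "w UNIV (\<lambda>i. {..a $ i}) x = indicator {..a} x" for x
      by (auto simp: w_def indicator_def less_eq_vec_def)
    then have "complex_of_real (measure M {..a}) = of_real (measure N {..a})"
      using key[of UNIV "\<lambda>i. {..a $ i}" 0] by simp
    then show ?thesis
      by (simp add: M.emeasure_eq_measure N.emeasure_eq_measure)
  qed
  show ?thesis
  proof (rule measure_eqI_generator_eq[where E = "range (\<lambda>a. {..a})" and \<Omega> = UNIV and
        A = "\<lambda>n. {.. (\<chi> i. real n)}"])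
    have "{..a} \<inter> {..b} = {.. inf a b}" for a b :: "real ^ 'n"
      by auto
    then show "Int_stable (range (\<lambda>a :: real ^ 'n. {..a}))"
      by (auto simp: Int_stable_def)
    show "sets M = sigma_sets UNIV (range (\<lambda>a. {..a}))" "sets N = sigma_sets UNIV (range (\<lambda>a. {..a}))"
      using M(2) N(2) by (simp_all add: borel_eq_atMost)
    have "\<exists>n. x \<le> (\<chi> i. real n)" for x :: "real ^ 'n"
    proof -
      obtain n where "norm x \<le> real n" using real_arch_simple by blast
      then have "x $ i \<le> real n" for i
        using component_le_norm_cart[of x i] by linarith
      then show ?thesis by (auto simp: less_eq_vec_def)
    qed
    then show "(\<Union>n. {.. (\<chi> i. real n) :: real ^ 'n}) = UNIV" by auto
  qed (auto simp: box)
qed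

section \<open>The law of a Levy process is determined by its characteristics\<close>

text \<open>
  The values at the grid points are partial sums of the increments, since X(0) = 0 almost surely, and the
  increments are independent with laws given by the one-dimensional marginals. The index idx t is the
  position of t in the grid; with Suc m increments the index set is nonempty even if m = 0.
\<close>
lemma levy_process_finite_dimensional:
  fixes X :: "real \<Rightarrow> 'w \<Rightarrow> real ^ 'n" and A :: "real \<Rightarrow> (real ^ 'n) set"
  assumes X: "levy_process M X"
    and s: "s 0 = 0" "mono s" and J: "finite J" "\<And>t. t \<in> J \<Longrightarrow> idx t \<le> Suc m \<and> s (idx t) = t"
    and A: "\<And>t. t \<in> J \<Longrightarrow> A t \<in> sets borel"
  shows "emeasure M {\<omega> \<in> space M. \<forall>t\<in>J. X t \<omega> \<in> A t} =
    emeasure (PiM {..<Suc m} (\<lambda>i. distr M borel (X (s (Suc i) - s i))))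
      {d \<in> space (PiM {..<Suc m} (\<lambda>_. borel)). \<forall>t\<in>J. (\<Sum>j<idx t. d j) \<in> A t}"
proof -
  interpret prob_space M using X by (simp add: levy_process_def)
  let ?I = "{..<Suc m}"
  let ?P = "PiM ?I (\<lambda>_. borel :: (real ^ 'n) measure)"
  have s0: "0 \<le> s i" for i
    using monoD[OF s(2), of 0 i] s(1) by simp
  have Xm[measurable]: "X (s i) \<in> borel_measurable M" for i
    using X s0 by (auto simp: levy_process_def)
  define D where "D i \<omega> = X (s (Suc i)) \<omega> - X (s i) \<omega>" for i \<omega>
  have Dm[measurable]: "D i \<in> borel_measurable M" for i
    unfolding D_def by measurable
  have indep: "indep_vars (\<lambda>_. borel) D ?I"
    using X s s0 unfolding levy_process_def D_def by blast
  have joint: "distr M ?P (\<lambda>\<omega>. \<lambda>i\<in>?I. D i \<omega>) = PiM ?I (\<lambda>i. distr M borel (D i))"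
    using indep by (subst (asm) indep_vars_iff_distr_eq_PiM) auto
  have Dlaw: "distr M borel (D i) = distr M borel (X (s (Suc i) - s i))" for i
  proof -
    have "\<forall>u\<ge>0. \<forall>h\<ge>0. distr M borel (\<lambda>\<omega>. X (u + h) \<omega> - X u \<omega>) = distr M borel (X h)"
      using X by (simp add: levy_process_def)
    from this[rule_format, of "s i" "s (Suc i) - s i"]
    have "distr M borel (\<lambda>\<omega>. X (s (Suc i)) \<omega> - X (s i) \<omega>) = distr M borel (X (s (Suc i) - s i))"
      using s0[of i] monoD[OF s(2), of i "Suc i"] by simp
    then show ?thesis by (simp add: D_def[abs_def])
  qed
  have tel: "X (s k) \<omega> = (\<Sum>j<k. D j \<omega>)" if "X 0 \<omega> = 0" for k \<omega>
    using sum_lessThan_telescope[of "\<lambda>j. X (s j) \<omega>" k] that s(1) by (simp add: D_def)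
  define G where "G = {d \<in> space ?P. \<forall>t\<in>J. (\<Sum>j<idx t. d j) \<in> A t}"
  have Gm: "G \<in> sets ?P"
  proof -
    have "(\<lambda>d. \<Sum>j<idx t. d j) \<in> borel_measurable ?P" if "t \<in> J" for t
      using J(2)[OF that] by (intro borel_measurable_sum measurable_component_singleton) auto
    then have "{d \<in> space ?P. (\<Sum>j<idx t. d j) \<in> A t} \<in> sets ?P" if "t \<in> J" for t
      using measurable_sets[OF _ A[OF that], of "\<lambda>d. \<Sum>j<idx t. d j" ?P] that
      by (auto simp: vimage_def Int_def conj_commute)
    then show ?thesis
      unfolding G_def using J(1) by (intro sets.sets_Collect_finite_All) auto
  qed
  have "emeasure M {\<omega> \<in> space M. \<forall>t\<in>J. X t \<omega> \<in> A t} =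
      emeasure M ((\<lambda>\<omega>. \<lambda>i\<in>?I. D i \<omega>) -` G \<inter> space M)"
  proof (rule emeasure_eq_AE)
    have "AE \<omega> in M. X 0 \<omega> = 0"
      using X by (simp add: levy_process_def)
    then show "AE \<omega> in M. \<omega> \<in> {\<omega> \<in> space M. \<forall>t\<in>J. X t \<omega> \<in> A t} \<longleftrightarrow>
        \<omega> \<in> (\<lambda>\<omega>. \<lambda>i\<in>?I. D i \<omega>) -` G \<inter> space M"
    proof eventually_elim
      case (elim \<omega>)
      have "X t \<omega> = (\<Sum>j<idx t. (\<lambda>i\<in>?I. D i \<omega>) j)" if "t \<in> J" for t
        using tel[OF elim, of "idx t"] J(2)[OF that] by (auto intro!: sum.cong)
      then show ?case
        by (auto simp: G_def space_PiM)
    qed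
    have "{\<omega> \<in> space M. X t \<omega> \<in> A t} \<in> sets M" if "t \<in> J" for t
      using Xm[of "idx t"] J(2)[OF that] A[OF that] by (auto intro!: measurable_sets_Collect)
    then show "{\<omega> \<in> space M. \<forall>t\<in>J. X t \<omega> \<in> A t} \<in> sets M"
      using J(1) by (intro sets.sets_Collect_finite_All) auto
    show "(\<lambda>\<omega>. \<lambda>i\<in>?I. D i \<omega>) -` G \<inter> space M \<in> sets M"
      by (intro measurable_sets[OF _ Gm] measurable_restrict Dm)
  qed
  also have "\<dots> = emeasure (distr M ?P (\<lambda>\<omega>. \<lambda>i\<in>?I. D i \<omega>)) G"
    by (intro emeasure_distr[symmetric] Gm measurable_restrict Dm)
  also have "\<dots> = emeasure (PiM ?I (\<lambda>i. distr M borel (X (s (Suc i) - s i)))) G"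
    by (simp add: joint Dlaw)
  finally show ?thesis
    by (simp add: G_def)
qed

lemma levy_process_eq_in_law:
  fixes X :: "real \<Rightarrow> 'v \<Rightarrow> real ^ 'n" and Y :: "real \<Rightarrow> 'w \<Rightarrow> real ^ 'n"
  assumes X: "levy_process M X" and Y: "levy_process N Y"
    and eq: "\<And>t. 0 \<le> t \<Longrightarrow> distr M borel (X t) = distr N borel (Y t)"
  shows "eq_in_law M X N Y"
  unfolding eq_in_law_def
proof (rule measure_eqI_PiM_infinite[where I = "{0..}" and M = "\<lambda>_. borel"])
  interpret M: prob_space M using X by (simp add: levy_process_def)
  interpret N: prob_space N using Y by (simp add: levy_process_def)
  let ?P = "PiM {0..} (\<lambda>_. borel :: (real ^ 'n) measure)"
  have Xm: "(\<lambda>\<omega>. \<lambda>t\<in>{0..}. X t \<omega>) \<in> measurable M ?P"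
    using X by (intro measurable_restrict) (auto simp: levy_process_def)
  have Ym: "(\<lambda>\<omega>. \<lambda>t\<in>{0..}. Y t \<omega>) \<in> measurable N ?P"
    using Y by (intro measurable_restrict) (auto simp: levy_process_def)
  show "finite_measure (distr M ?P (\<lambda>\<omega>. \<lambda>t\<in>{0..}. X t \<omega>))"
    using Xm by (rule M.finite_measure_distr)
  fix A :: "real \<Rightarrow> (real ^ 'n) set" and J
  assume J: "finite J" "J \<subseteq> {0..}" and A: "\<And>i. i \<in> J \<Longrightarrow> A i \<in> sets borel"
  let ?E = "prod_emb {0..} (\<lambda>_. borel) J (Pi\<^sub>E J A)"
  have E: "?E \<in> sets ?P"
    using J A by (intro sets_PiM_I) auto
  \<comment> \<open>The grid starts at 0 and becomes constant after the largest element of J.\<close>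
  define xs where "xs = 0 # sorted_list_of_set J"
  define s where "s i = xs ! min i (length xs - 1)" for i
  define m where "m = length xs"
  have srt: "sorted xs"
    using J by (auto simp: xs_def)
  have "mono s"
    unfolding s_def by (intro monoI sorted_nth_mono[OF srt]) (auto simp: xs_def)
  moreover have "s 0 = 0"
    by (simp add: s_def xs_def)
  moreover have "\<exists>idx. \<forall>t\<in>J. idx t \<le> Suc m \<and> s (idx t) = t"
  proof (intro bchoice ballI)
    fix t assume "t \<in> J"
    then have "t \<in> set xs"
      using J by (simp add: xs_def)
    then obtain i where "i < length xs" "xs ! i = t"
      by (auto simp: in_set_conv_nth)
    then show "\<exists>i. i \<le> Suc m \<and> s i = t"
      by (intro exI[of _ i]) (auto simp: s_def m_def min_def)
  qed
  then obtain idx where idx: "\<And>t. t \<in> J \<Longrightarrow> idx t \<le> Suc m \<and> s (idx t) = t"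
    by blast
  ultimately have fd:
    "emeasure M {\<omega> \<in> space M. \<forall>t\<in>J. X t \<omega> \<in> A t} =
      emeasure (PiM {..<Suc m} (\<lambda>i. distr M borel (X (s (Suc i) - s i))))
        {d \<in> space (PiM {..<Suc m} (\<lambda>_. borel)). \<forall>t\<in>J. (\<Sum>j<idx t. d j) \<in> A t}"
    "emeasure N {\<omega> \<in> space N. \<forall>t\<in>J. Y t \<omega> \<in> A t} =
      emeasure (PiM {..<Suc m} (\<lambda>i. distr N borel (Y (s (Suc i) - s i))))
        {d \<in> space (PiM {..<Suc m} (\<lambda>_. borel)). \<forall>t\<in>J. (\<Sum>j<idx t. d j) \<in> A t}"
    using J A by (intro levy_process_finite_dimensional X Y; simp)+
  have "distr M borel (X (s (Suc i) - s i)) = distr N borel (Y (s (Suc i) - s i))" for i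
    using monoD[OF \<open>mono s\<close>, of i "Suc i"] by (intro eq) simp
  then have fdeq: "emeasure M {\<omega> \<in> space M. \<forall>t\<in>J. X t \<omega> \<in> A t} = emeasure N {\<omega> \<in> space N. \<forall>t\<in>J. Y t \<omega> \<in> A t}"
    unfolding fd by simp
  have "(\<lambda>\<omega>. \<lambda>t\<in>{0..}. X t \<omega>) -` ?E \<inter> space M = {\<omega> \<in> space M. \<forall>t\<in>J. X t \<omega> \<in> A t}"
    "(\<lambda>\<omega>. \<lambda>t\<in>{0..}. Y t \<omega>) -` ?E \<inter> space N = {\<omega> \<in> space N. \<forall>t\<in>J. Y t \<omega> \<in> A t}"
    using J by (auto simp: prod_emb_def PiE_def Pi_def subset_eq)
  then show "emeasure (distr M ?P (\<lambda>\<omega>. \<lambda>t\<in>{0..}. X t \<omega>)) ?E =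
      emeasure (distr N ?P (\<lambda>\<omega>. \<lambda>t\<in>{0..}. Y t \<omega>)) ?E"
    using fdeq by (simp add: emeasure_distr[OF Xm E] emeasure_distr[OF Ym E])
qed simp_all

lemma levy_law_eq_in_law:
  fixes X :: "real \<Rightarrow> 'v \<Rightarrow> real ^ 'n" and Y :: "real \<Rightarrow> 'w \<Rightarrow> real ^ 'n"
  assumes X: "levy_law M X \<mu> \<Sigma> \<X>" and Y: "levy_law N Y \<mu> \<Sigma> \<X>"
  shows "eq_in_law M X N Y"
proof (rule levy_process_eq_in_law)
  show "levy_process M X" "levy_process N Y"
    using X Y by (auto simp: levy_law_def)
  fix t :: real assume t: "0 \<le> t"
  have [measurable]: "X t \<in> borel_measurable M" "Y t \<in> borel_measurable N"
    using X Y t by (auto simp: levy_law_def levy_process_def)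
  interpret M: prob_space M using X by (simp add: levy_law_def levy_process_def)
  interpret N: prob_space N using Y by (simp add: levy_law_def levy_process_def)
  show "distr M borel (X t) = distr N borel (Y t)"
  proof (rule measure_eqI_characteristic_function)
    show "(CLINT x|distr M borel (X t). iexp (\<theta> \<bullet> x)) = (CLINT x|distr N borel (Y t). iexp (\<theta> \<bullet> x))" for \<theta>
      using X Y t by (simp add: integral_distr levy_law_def)
  qed (simp_all add: M.finite_measure_distr N.finite_measure_distr)
qed

section \<open>Linear images of Levy processes\<close>

lemma sets_cball [measurable]: "cball a r \<in> sets (borel :: 'a::metric_space measure)"
  by simp

text \<open>
  Jumps of a process that a map sends to 0 are not jumps of the image process, so the image of a Levy
  measure loses its mass at 0. The measure \<open>proj_measure\<close> is the case of a coordinate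
  projection.
\<close>
definition punctured_distr :: "'a measure \<Rightarrow> ('a \<Rightarrow> real ^ 'n) \<Rightarrow> (real ^ 'n) measure" where
  "punctured_distr \<X> f = density (distr \<X> borel f) (indicator (- {0}))"

lemma sets_punctured_distr [simp, measurable_cong]: "sets (punctured_distr \<X> f) = sets borel"
  by (simp add: punctured_distr_def)

lemma emeasure_punctured_distr:
  assumes [measurable]: "f \<in> borel_measurable \<X>" "B \<in> sets borel"
  shows "emeasure (punctured_distr \<X> f) B = emeasure \<X> {x \<in> space \<X>. f x \<in> B - {0}}"
proof -
  have "emeasure (punctured_distr \<X> f) B = (\<integral>\<^sup>+ x. indicator (- {0}) x * indicator B x \<partial>distr \<X> borel f)"
    unfolding punctured_distr_def by (subst emeasure_density) auto
  also have "\<dots> = (\<integral>\<^sup>+ x. indicator (B - {0}) x \<partial>distr \<X> borel f)"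
    by (intro nn_integral_cong) (auto simp: indicator_def)
  also have "\<dots> = emeasure (distr \<X> borel f) (B - {0})"
    by simp
  also have "\<dots> = emeasure \<X> (f -` (B - {0}) \<inter> space \<X>)"
    by (subst emeasure_distr) auto
  also have "f -` (B - {0}) \<inter> space \<X> = {x \<in> space \<X>. f x \<in> B - {0}}"
    by auto
  finally show ?thesis .
qed

lemma nn_integral_punctured_distr:
  assumes [measurable]: "f \<in> borel_measurable \<X>" "g \<in> borel_measurable borel" and "g 0 = 0"
  shows "(\<integral>\<^sup>+ x. g x \<partial>punctured_distr \<X> f) = (\<integral>\<^sup>+ x. g (f x) \<partial>\<X>)"
proof -
  have "indicator (- {0}) x * g x = g x" for x
    using assms(3) by (cases "x = 0") (auto simp: indicator_def)
  then show ?thesis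
    by (simp add: punctured_distr_def nn_integral_density nn_integral_distr)
qed

lemma
  fixes g :: "real ^ 'n \<Rightarrow> 'b::{banach, second_countable_topology}"
  assumes [measurable]: "f \<in> borel_measurable \<X>" "g \<in> borel_measurable borel" and "g 0 = 0"
  shows integral_punctured_distr: "(LINT x|punctured_distr \<X> f. g x) = (LINT x|\<X>. g (f x))"
    and integrable_punctured_distr: "integrable (punctured_distr \<X> f) g \<longleftrightarrow> integrable \<X> (\<lambda>x. g (f x))"
proof -
  have "indicator (- {0}) x *\<^sub>R g x = g x" for x
    using assms(3) by (cases "x = 0") (auto simp: indicator_def)
  moreover have "punctured_distr \<X> f = density (distr \<X> borel f) (\<lambda>x. ennreal (indicator (- {0}) x))"
    unfolding punctured_distr_def ennreal_indicator ..
  ultimately show "(LINT x|punctured_distr \<X> f. g x) = (LINT x|\<X>. g (f x))"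
    "integrable (punctured_distr \<X> f) g \<longleftrightarrow> integrable \<X> (\<lambda>x. g (f x))"
    by (simp_all add: integral_density integrable_density integral_distr integrable_distr_eq)
qed

text \<open>
  The integrability criterion for all integrals with respect to Levy measures below.
\<close>
lemma integrable_levy_measure:
  fixes f :: "real ^ 'n \<Rightarrow> 'b::{banach, second_countable_topology}"
  assumes X: "levy_measure \<X>" and f: "f \<in> borel_measurable borel"
    and bound: "\<And>x. norm (f x) \<le> C * min 1 ((norm x)\<^sup>2)"
  shows "integrable \<X> f"
proof -
  have [measurable_cong]: "sets \<X> = sets borel"
    using X by (simp add: levy_measure_def)
  note f[measurable]
  have "integrable \<X> (\<lambda>x. min 1 ((norm x)\<^sup>2))"
    using X by (intro integrableI_nonneg) (auto simp: levy_measure_def)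
  then have "integrable \<X> (\<lambda>x. C * min 1 ((norm x)\<^sup>2))"
    by simp
  then show ?thesis
    by (rule Bochner_Integration.integrable_bound) (use bound in \<open>auto intro: order_trans[OF _ abs_ge_self]\<close>)
qed

lemma levy_measure_punctured_distr:
  assumes X: "levy_measure \<X>" and f[measurable]: "f \<in> borel_measurable borel"
    and contr: "\<And>x. norm (f x) \<le> norm x"
  shows "levy_measure (punctured_distr \<X> f)"
proof -
  have [measurable_cong]: "sets \<X> = sets borel"
    using X by (simp add: levy_measure_def)
  have "(\<integral>\<^sup>+ x. ennreal (min 1 ((norm x)\<^sup>2)) \<partial>punctured_distr \<X> f) = (\<integral>\<^sup>+ x. ennreal (min 1 ((norm (f x))\<^sup>2)) \<partial>\<X>)"
    by (intro nn_integral_punctured_distr) auto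
  also have "\<dots> \<le> (\<integral>\<^sup>+ x. ennreal (min 1 ((norm x)\<^sup>2)) \<partial>\<X>)"
  proof (intro nn_integral_mono ennreal_leI min.mono)
    show "(norm (f x))\<^sup>2 \<le> (norm x)\<^sup>2" for x
      using contr[of x] by (intro power_mono) auto
  qed simp
  also have "\<dots> < \<infinity>"
    using X by (simp add: levy_measure_def)
  finally show ?thesis
    by (simp add: levy_measure_def emeasure_punctured_distr)
qed

lemma integrable_levy_exponent:
  fixes \<theta> :: "real ^ 'n"
  assumes "levy_measure \<X>"
  shows "integrable \<X> (\<lambda>x. iexp (\<theta> \<bullet> x) - 1 - \<i> * of_real ((\<theta> \<bullet> x) * indicator (cball 0 1) x))"
proof (rule integrable_levy_measure[OF assms, where C = "2 + (norm \<theta>)\<^sup>2"])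
  fix x :: "real ^ 'n"
  show "cmod (iexp (\<theta> \<bullet> x) - 1 - \<i> * of_real ((\<theta> \<bullet> x) * indicator (cball 0 1) x))
      \<le> (2 + (norm \<theta>)\<^sup>2) * min 1 ((norm x)\<^sup>2)"
  proof (cases "norm x \<le> 1")
    case True
    have "cmod (iexp (\<theta> \<bullet> x) - (\<Sum>k \<le> 1. (\<i> * of_real (\<theta> \<bullet> x)) ^ k / fact k)) \<le> \<bar>\<theta> \<bullet> x\<bar> ^ Suc 1 / fact (Suc 1)"
      by (rule iexp_approx1)
    then have "cmod (iexp (\<theta> \<bullet> x) - 1 - \<i> * of_real (\<theta> \<bullet> x)) \<le> (\<theta> \<bullet> x)\<^sup>2 / 2"
      by (simp add: algebra_simps numeral_2_eq_2)
    also have "\<dots> \<le> (\<theta> \<bullet> x)\<^sup>2"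
      by simp
    also have "\<dots> \<le> (norm \<theta> * norm x)\<^sup>2"
      using Cauchy_Schwarz_ineq2[of \<theta> x] by (metis abs_ge_zero power2_abs power_mono)
    also have "\<dots> \<le> (2 + (norm \<theta>)\<^sup>2) * (norm x)\<^sup>2"
      by (simp add: power_mult_distrib algebra_simps)
    finally show ?thesis
      using True by (simp add: min_absorb2 power_le_one)
  next
    case False
    have "cmod (iexp (\<theta> \<bullet> x) - 1) \<le> 1 + 1"
      by (intro order_trans[OF norm_triangle_ineq4]) simp
    moreover have "min 1 ((norm x)\<^sup>2) = 1"
      using False by (simp add: min_def power_le_one_iff)
    ultimately show ?thesis
      using False by (simp add: add_increasing2 add.commute)
  qed
qed measurable

text \<open>
  The change of the location parameter that is due to truncating by the norm of f x instead of the
  norm of x.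
\<close>
definition recentering :: "(real ^ 'm \<Rightarrow> real ^ 'n) \<Rightarrow> (real ^ 'm) measure \<Rightarrow> real ^ 'n" where
  "recentering f \<X> = (LINT x|\<X>. (indicator (cball 0 1) (f x) - indicator (cball 0 1) x) *\<^sub>R f x)"

lemma integrable_recentering:
  fixes f :: "real ^ 'm \<Rightarrow> real ^ 'n"
  assumes X: "levy_measure \<X>" and f[measurable]: "f \<in> borel_measurable borel"
    and contr: "\<And>x. norm (f x) \<le> norm x"
  shows "integrable \<X> (\<lambda>x. (indicator (cball 0 1) (f x) - indicator (cball 0 1) x) *\<^sub>R f x)"
proof (rule integrable_levy_measure[OF X, where C = 1])
  show "(\<lambda>x. (indicator (cball 0 1) (f x) - indicator (cball 0 1) x) *\<^sub>R f x) \<in> borel_measurable borel"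
    by measurable
  fix x
  show "norm ((indicator (cball 0 1) (f x) - indicator (cball 0 1) x) *\<^sub>R f x) \<le> 1 * min 1 ((norm x)\<^sup>2)"
    using contr[of x] by (auto simp: indicator_def min_def power_le_one_iff)
qed

lemma levy_process_linear_image:
  fixes A :: "real ^ 'm ^ 'n"
  assumes Z: "levy_process M Z"
  shows "levy_process M (\<lambda>t \<omega>. A *v Z t \<omega>)"
proof -
  interpret prob_space M using Z by (simp add: levy_process_def)
  have lin: "bounded_linear ((*v) A)"
    by (rule matrix_vector_mul_bounded_linear)
  have A[measurable]: "(*v) A \<in> borel_measurable borel"
    by (intro borel_measurable_continuous_onI linear_continuous_on lin)
  show ?thesis
    unfolding levy_process_def
  proof (intro conjI allI impI)
    show "prob_space M" by unfold_locales
    show Zm: "(\<lambda>\<omega>. A *v Z t \<omega>) \<in> borel_measurable M" if "0 \<le> t" for t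
      using Z that by (intro measurable_compose[OF _ A]) (auto simp: levy_process_def)
    have "AE \<omega> in M. Z 0 \<omega> = 0"
      using Z by (simp add: levy_process_def)
    then show "AE \<omega> in M. A *v Z 0 \<omega> = 0"
      by eventually_elim simp
    fix s :: "nat \<Rightarrow> real" and m :: nat
    assume "0 \<le> s 0" "mono s"
    then have "indep_vars (\<lambda>_. borel) (\<lambda>i \<omega>. Z (s (Suc i)) \<omega> - Z (s i) \<omega>) {..<m}"
      using Z by (simp add: levy_process_def)
    from indep_vars_compose2[OF this, of "\<lambda>_. (*v) A" "\<lambda>_. borel"]
    show "indep_vars (\<lambda>_. borel) (\<lambda>i \<omega>. A *v Z (s (Suc i)) \<omega> - A *v Z (s i) \<omega>) {..<m}"
      by (simp add: matrix_vector_mult_diff_distrib)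
  next
    fix s h :: real assume sh: "0 \<le> s" "0 \<le> h"
    have [measurable]: "Z s \<in> borel_measurable M" "Z h \<in> borel_measurable M" "Z (s + h) \<in> borel_measurable M"
      using Z sh by (auto simp: levy_process_def)
    have "distr M borel (\<lambda>\<omega>. A *v Z (s + h) \<omega> - A *v Z s \<omega>) =
        distr (distr M borel (\<lambda>\<omega>. Z (s + h) \<omega> - Z s \<omega>)) borel ((*v) A)"
      by (subst distr_distr) (auto simp: comp_def matrix_vector_mult_diff_distrib)
    also have "distr M borel (\<lambda>\<omega>. Z (s + h) \<omega> - Z s \<omega>) = distr M borel (Z h)"
      using Z sh by (auto simp: levy_process_def)
    also have "distr (distr M borel (Z h)) borel ((*v) A) = distr M borel (\<lambda>\<omega>. A *v Z h \<omega>)"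
      by (subst distr_distr) (auto simp: comp_def)
    finally show "distr M borel (\<lambda>\<omega>. A *v Z (s + h) \<omega> - A *v Z s \<omega>) = distr M borel (\<lambda>\<omega>. A *v Z h \<omega>)" .
  next
    have "AE \<omega> in M. \<forall>t\<ge>0. ((\<lambda>s. Z s \<omega>) \<longlongrightarrow> Z t \<omega>) (at_right t) \<and>
        (0 < t \<longrightarrow> (\<exists>l. ((\<lambda>s. Z s \<omega>) \<longlongrightarrow> l) (at_left t)))"
      using Z by (simp add: levy_process_def)
    then show "AE \<omega> in M. \<forall>t\<ge>0. ((\<lambda>s. A *v Z s \<omega>) \<longlongrightarrow> A *v Z t \<omega>) (at_right t) \<and>
        (0 < t \<longrightarrow> (\<exists>l. ((\<lambda>s. A *v Z s \<omega>) \<longlongrightarrow> l) (at_left t)))"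
    proof eventually_elim
      case (elim \<omega>)
      show ?case
      proof (intro allI impI conjI)
        fix t :: real assume t: "0 \<le> t"
        show "((\<lambda>s. A *v Z s \<omega>) \<longlongrightarrow> A *v Z t \<omega>) (at_right t)"
          using elim t by (intro bounded_linear.tendsto[OF lin]) simp
        assume "0 < t"
        then obtain l where "((\<lambda>s. Z s \<omega>) \<longlongrightarrow> l) (at_left t)"
          using elim t by blast
        from bounded_linear.tendsto[OF lin this]
        show "\<exists>l. ((\<lambda>s. A *v Z s \<omega>) \<longlongrightarrow> l) (at_left t)"
          by blast
      qed
    qed
  qed
qed

text \<open>
  The exponent of the image at \<theta> is the exponent of Z at the adjoint image of \<theta>. The Gaussian
  and the drift parts transform accordingly, and the two compensated integrals differ only in the
  truncation, that is by the inner product of \<theta> with the recentering vector. For a contraction this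
  vector is an absolutely convergent integral.
\<close>
lemma levy_law_linear_image:
  fixes A :: "real ^ 'm ^ 'n"
  assumes Z: "levy_law M Z m \<Theta> \<Z>" and contr: "\<And>x. norm (A *v x) \<le> norm x"
  shows "levy_law M (\<lambda>t \<omega>. A *v Z t \<omega>)
    (A *v m + recentering ((*v) A) \<Z>) (A ** \<Theta> ** transpose A) (punctured_distr \<Z> ((*v) A))"
proof -
  have lin: "bounded_linear ((*v) A)"
    by (rule matrix_vector_mul_bounded_linear)
  have A[measurable]: "(*v) A \<in> borel_measurable borel"
    by (intro borel_measurable_continuous_onI linear_continuous_on lin)
  have ZM: "levy_measure \<Z>"
    using Z by (simp add: levy_law_def)
  then have [measurable_cong]: "sets \<Z> = sets borel"
    by (simp add: levy_measure_def)
  have adj: "\<theta> \<bullet> (A *v x) = (\<theta> v* A) \<bullet> x" for \<theta> x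
    by (simp add: dot_lmul_matrix)
  have quad: "\<theta> \<bullet> ((A ** \<Theta> ** transpose A) *v \<theta>) = (\<theta> v* A) \<bullet> (\<Theta> *v (\<theta> v* A))" for \<theta>
    by (simp add: adj flip: matrix_vector_mul_assoc)
  have expo: "levy_exponent (A *v m + recentering ((*v) A) \<Z>) (A ** \<Theta> ** transpose A) (punctured_distr \<Z> ((*v) A)) \<theta>
      = levy_exponent m \<Theta> \<Z> (\<theta> v* A)" for \<theta>
  proof -
    let ?D = "cball 0 1 :: (real ^ 'n) set" and ?E = "cball 0 1 :: (real ^ 'm) set"
    have gm: "(\<lambda>x. iexp (\<theta> \<bullet> x) - 1 - \<i> * of_real ((\<theta> \<bullet> x) * indicator ?D x)) \<in> borel_measurable borel"
      by measurable
    have A': "(*v) A \<in> borel_measurable \<Z>"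
      by measurable
    have i1: "(CLINT x|punctured_distr \<Z> ((*v) A). iexp (\<theta> \<bullet> x) - 1 - \<i> * of_real ((\<theta> \<bullet> x) * indicator ?D x))
        = (CLINT x|\<Z>. iexp (\<theta> \<bullet> (A *v x)) - 1 - \<i> * of_real ((\<theta> \<bullet> (A *v x)) * indicator ?D (A *v x)))"
      by (rule integral_punctured_distr[OF A' gm]) simp
    have rint: "integrable \<Z> (\<lambda>x. (indicator ?D (A *v x) - indicator ?E x) *\<^sub>R (A *v x))"
      using contr by (intro integrable_recentering ZM A)
    have rint': "integrable \<Z> (\<lambda>x. \<i> * of_real (\<theta> \<bullet> ((indicator ?D (A *v x) - indicator ?E x) *\<^sub>R (A *v x))))"
      by (intro integrable_mult_right integrable_of_real integrable_inner_right rint)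
    have i2: "(CLINT x|\<Z>. \<i> * of_real (\<theta> \<bullet> ((indicator ?D (A *v x) - indicator ?E x) *\<^sub>R (A *v x))))
       = \<i> * of_real (\<theta> \<bullet> recentering ((*v) A) \<Z>)"
      unfolding recentering_def using rint
      by (simp only: integral_mult_right_zero integral_complex_of_real integral_inner_right)
    have int1: "integrable \<Z> (\<lambda>x. iexp (\<theta> \<bullet> (A *v x)) - 1 - \<i> * of_real ((\<theta> \<bullet> (A *v x)) * indicator ?D (A *v x)))"
      using integrable_levy_exponent[OF levy_measure_punctured_distr[OF ZM A contr], of \<theta>]
      by (subst (asm) integrable_punctured_distr[OF A' gm]) simp_all
    have "(CLINT x|\<Z>. iexp ((\<theta> v* A) \<bullet> x) - 1 - \<i> * of_real (((\<theta> v* A) \<bullet> x) * indicator ?E x))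
        = (CLINT x|\<Z>. (iexp (\<theta> \<bullet> (A *v x)) - 1 - \<i> * of_real ((\<theta> \<bullet> (A *v x)) * indicator ?D (A *v x)))
           + \<i> * of_real (\<theta> \<bullet> ((indicator ?D (A *v x) - indicator ?E x) *\<^sub>R (A *v x))))"
      by (intro Bochner_Integration.integral_cong) (auto simp: adj algebra_simps)
    also have "\<dots> = (CLINT x|\<Z>. iexp (\<theta> \<bullet> (A *v x)) - 1 - \<i> * of_real ((\<theta> \<bullet> (A *v x)) * indicator ?D (A *v x)))
        + \<i> * of_real (\<theta> \<bullet> recentering ((*v) A) \<Z>)"
      using int1 rint' by (subst Bochner_Integration.integral_add) (simp_all only: i2)
    moreover have "(A *v m + recentering ((*v) A) \<Z>) \<bullet> \<theta> = m \<bullet> (\<theta> v* A) + \<theta> \<bullet> recentering ((*v) A) \<Z>"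
      by (metis inner_commute adj inner_add_right)
    ultimately show ?thesis
      unfolding levy_exponent_def i1 quad by (simp add: algebra_simps)
  qed
  show ?thesis
    unfolding levy_law_def
  proof (intro conjI allI impI)
    show "levy_process M (\<lambda>t \<omega>. A *v Z t \<omega>)"
      using Z by (intro levy_process_linear_image) (simp add: levy_law_def)
    show "transpose (A ** \<Theta> ** transpose A) = A ** \<Theta> ** transpose A"
      using Z by (simp add: levy_law_def matrix_transpose_mul matrix_mul_assoc)
    show "0 \<le> \<theta> \<bullet> ((A ** \<Theta> ** transpose A) *v \<theta>)" for \<theta>
      using Z by (simp add: quad levy_law_def)
    show "levy_measure (punctured_distr \<Z> ((*v) A))"
      by (intro levy_measure_punctured_distr ZM A contr)
    show "(CLINT \<omega>|M. iexp (\<theta> \<bullet> (A *v Z t \<omega>))) = exp (of_real t *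
       levy_exponent (A *v m + recentering ((*v) A) \<Z>) (A ** \<Theta> ** transpose A) (punctured_distr \<Z> ((*v) A)) \<theta>)"
      if "0 \<le> t" for t \<theta>
      using Z that by (simp add: expo adj levy_law_def)
  qed
qed

section \<open>Vector-valued measurability and weighted sums of measures\<close>

lemma borel_measurable_vec_component [measurable (raw)]:
  fixes f :: "'a \<Rightarrow> real ^ 'n"
  assumes "f \<in> borel_measurable M"
  shows "(\<lambda>x. f x $ i) \<in> borel_measurable M"
  using assms by (rule measurable_compose) (intro borel_measurable_continuous_onI continuous_intros)

lemma borel_measurable_vec_lambda:
  fixes f :: "'n::finite \<Rightarrow> 'a \<Rightarrow> real"
  assumes [measurable]: "\<And>i. f i \<in> borel_measurable M"
  shows "(\<lambda>x. \<chi> i. f i x) \<in> borel_measurable M"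
proof -
  have "(\<lambda>x. \<chi> i. f i x) = (\<lambda>x. \<Sum>i\<in>UNIV. f i x *\<^sub>R axis i (1 :: real))"
    by (auto simp: fun_eq_iff vec_eq_iff axis_def if_distrib cong: if_cong)
  then show ?thesis by simp
qed

lemma integrable_vec_lambda:
  fixes f :: "'n::finite \<Rightarrow> 'a \<Rightarrow> real"
  assumes "\<And>i. integrable M (f i)"
  shows "integrable M (\<lambda>x. \<chi> i. f i x)"
proof -
  have "(\<lambda>x. \<chi> i. f i x) = (\<lambda>x. \<Sum>i\<in>UNIV. f i x *\<^sub>R axis i (1 :: real))"
    by (auto simp: fun_eq_iff vec_eq_iff axis_def if_distrib cong: if_cong)
  then show ?thesis
    using assms by simp
qed

lemma integral_vec_nth:
  fixes f :: "'a \<Rightarrow> real ^ 'n"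
  assumes "integrable M f"
  shows "(LINT x|M. f x) $ i = (LINT x|M. f x $ i)"
proof -
  have "bounded_linear (\<lambda>v :: real ^ 'n. v $ i)"
    by (rule bounded_linear_vec_nth)
  from integral_bounded_linear[OF this assms] show ?thesis by simp
qed

lemma measure_of_borel_eqI:
  assumes "sets N = sets borel" and "\<And>B. B \<in> sets borel \<Longrightarrow> \<mu> B = emeasure N B"
  shows "measure_of UNIV (sets borel) \<mu> = N"
proof -
  have "space N = UNIV"
    using sets_eq_imp_space_eq[OF assms(1)] by simp
  moreover have "measure_of UNIV (sets borel) \<mu> = measure_of UNIV (sets borel) (emeasure N)"
    using assms(2) sets.sigma_sets_eq[of "borel :: 'a measure"] by (intro measure_of_eq) auto
  ultimately show ?thesis
    using measure_of_of_measure[of N] assms(1) by metis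
qed

lemma nn_integral_weighted_sum:
  assumes sets: "\<And>i. i \<in> I \<Longrightarrow> sets (K i) = sets N"
    and em: "\<And>B. B \<in> sets N \<Longrightarrow> emeasure N B = (\<Sum>i\<in>I. c i * emeasure (K i) B)"
    and f: "f \<in> borel_measurable N"
  shows "(\<integral>\<^sup>+ x. f x \<partial>N) = (\<Sum>i\<in>I. c i * (\<integral>\<^sup>+ x. f x \<partial>K i))"
  using f
proof (induction rule: borel_measurable_induct)
  case (cong f g)
  have "(\<integral>\<^sup>+ x. f x \<partial>K i) = (\<integral>\<^sup>+ x. g x \<partial>K i)" if "i \<in> I" for i
    using cong(3) sets_eq_imp_space_eq[OF sets[OF that]] by (intro nn_integral_cong) auto
  then show ?case
    using cong by (simp cong: nn_integral_cong)
next
  case (set A)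
  then show ?case
    using em[of A] sets by simp
next
  case (mult u a)
  have "(\<integral>\<^sup>+ x. a * u x \<partial>K i) = a * (\<integral>\<^sup>+ x. u x \<partial>K i)" if "i \<in> I" for i
    using mult(2) sets[OF that] by (intro nn_integral_cmult) (simp cong: measurable_cong_sets)
  then show ?case
    using mult by (simp add: nn_integral_cmult sum_distrib_left mult_ac)
next
  case (add u v)
  have "(\<integral>\<^sup>+ x. v x + u x \<partial>K i) = (\<integral>\<^sup>+ x. v x \<partial>K i) + (\<integral>\<^sup>+ x. u x \<partial>K i)" if "i \<in> I" for i
    using add sets[OF that] by (intro nn_integral_add) (simp_all cong: measurable_cong_sets)
  then show ?case
    using add by (simp add: nn_integral_add sum.distrib distrib_left)
next
  case (seq U)
  have SUP: "(\<integral>\<^sup>+ x. (SUP n. U n) x \<partial>K i) = (SUP n. \<integral>\<^sup>+ x. U n x \<partial>K i)" if "i \<in> I" for i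
    using seq sets[OF that] nn_integral_monotone_convergence_SUP[of U "K i"]
    by (simp add: image_comp cong: measurable_cong_sets)
  have "(\<integral>\<^sup>+ x. (SUP n. U n) x \<partial>N) = (SUP n. \<integral>\<^sup>+ x. U n x \<partial>N)"
    using seq nn_integral_monotone_convergence_SUP[of U N] by (simp add: image_comp)
  also have "\<dots> = (SUP n. \<Sum>i\<in>I. c i * (\<integral>\<^sup>+ x. U n x \<partial>K i))"
    using seq by simp
  also have "\<dots> = (\<Sum>i\<in>I. SUP n. c i * (\<integral>\<^sup>+ x. U n x \<partial>K i))"
    using incseq_SucD[OF seq(3)] by (intro ennreal_SUP_sum incseq_SucI mult_left_mono nn_integral_mono)
      (auto simp: le_fun_def)
  also have "\<dots> = (\<Sum>i\<in>I. c i * (\<integral>\<^sup>+ x. (SUP n. U n) x \<partial>K i))"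
  proof (rule sum.cong[OF refl])
    fix i assume i: "i \<in> I"
    show "(SUP n. c i * (\<integral>\<^sup>+ x. U n x \<partial>K i)) = c i * (\<integral>\<^sup>+ x. (SUP n. U n) x \<partial>K i)"
      unfolding SUP[OF i] by (rule SUP_mult_left_ennreal[symmetric])
  qed
  finally show ?case .
qed

lemma integrable_weighted_sum:
  fixes f :: "'a \<Rightarrow> 'b::{banach, second_countable_topology}"
  assumes I: "finite I" and sets: "\<And>i. i \<in> I \<Longrightarrow> sets (K i) = sets N"
    and em: "\<And>B. B \<in> sets N \<Longrightarrow> emeasure N B = (\<Sum>i\<in>I. ennreal (c i) * emeasure (K i) B)"
    and f: "f \<in> borel_measurable N"
  shows "integrable N f \<longleftrightarrow> (\<forall>i\<in>I. 0 < c i \<longrightarrow> integrable (K i) f)"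
proof -
  note f[measurable]
  have fK: "f \<in> borel_measurable (K i)" if "i \<in> I" for i
    using f sets[OF that] by (simp cong: measurable_cong_sets)
  have "integrable N f \<longleftrightarrow> (\<integral>\<^sup>+ x. norm (f x) \<partial>N) < \<infinity>"
    using f by (simp add: integrable_iff_bounded)
  also have "(\<integral>\<^sup>+ x. norm (f x) \<partial>N) = (\<Sum>i\<in>I. ennreal (c i) * (\<integral>\<^sup>+ x. norm (f x) \<partial>K i))"
    by (intro nn_integral_weighted_sum sets em) simp_all
  also have "\<dots> < \<infinity> \<longleftrightarrow> (\<forall>i\<in>I. ennreal (c i) * (\<integral>\<^sup>+ x. norm (f x) \<partial>K i) < \<infinity>)"
    using I by simp
  also have "\<dots> \<longleftrightarrow> (\<forall>i\<in>I. 0 < c i \<longrightarrow> (\<integral>\<^sup>+ x. norm (f x) \<partial>K i) < \<infinity>)"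
    by (intro ball_cong refl) (auto simp: ennreal_mult_less_top ennreal_eq_0_iff not_less)
  also have "\<dots> \<longleftrightarrow> (\<forall>i\<in>I. 0 < c i \<longrightarrow> integrable (K i) f)"
    using fK by (simp add: integrable_iff_bounded)
  finally show ?thesis .
qed

text \<open>
  If c i = 0, then f need not be integrable with respect to K i; the value 0 that the integral then takes
  by convention is multiplied by 0.
\<close>
lemma integral_weighted_sum:
  fixes f :: "'a \<Rightarrow> 'b::{banach, second_countable_topology}"
  assumes I: "finite I" and sets: "\<And>i. i \<in> I \<Longrightarrow> sets (K i) = sets N"
    and em: "\<And>B. B \<in> sets N \<Longrightarrow> emeasure N B = (\<Sum>i\<in>I. ennreal (c i) * emeasure (K i) B)"
    and c: "\<And>i. i \<in> I \<Longrightarrow> 0 \<le> c i" and f: "integrable N f"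
  shows "(LINT x|N. f x) = (\<Sum>i\<in>I. c i *\<^sub>R (LINT x|K i. f x))"
  using f
proof (induction rule: integrable_induct)
  case (base A v)
  have fin: "ennreal (c i) * emeasure (K i) A < \<infinity>" if "i \<in> I" for i
    using base that I by (auto simp: em)
  have "measure N A = (\<Sum>i\<in>I. c i * measure (K i) A)"
  proof -
    have "measure N A = enn2real (\<Sum>i\<in>I. ennreal (c i) * emeasure (K i) A)"
      using base by (simp add: measure_def em)
    also have "\<dots> = (\<Sum>i\<in>I. enn2real (ennreal (c i) * emeasure (K i) A))"
      using fin by (subst enn2real_sum) (auto simp: comp_def)
    also have "\<dots> = (\<Sum>i\<in>I. c i * measure (K i) A)"
      using c by (intro sum.cong) (auto simp: enn2real_mult measure_def)
    finally show ?thesis .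
  qed
  moreover have "c i *\<^sub>R (LINT x|K i. indicator A x *\<^sub>R v) = (c i * measure (K i) A) *\<^sub>R v" if "i \<in> I" for i
  proof (cases "c i = 0")
    case False
    then have "emeasure (K i) A < \<infinity>"
      using fin[OF that] c[OF that] by (auto simp: ennreal_mult_less_top)
    then show ?thesis
      using base sets[OF that] sets.sets_into_space[of A "K i"] by (simp add: Int_absorb2)
  qed simp
  ultimately show ?case
    using base sets.sets_into_space[OF base(1)] by (simp add: scaleR_sum_left Int_absorb2)
next
  case (add f g)
  have "c i *\<^sub>R (LINT x|K i. f x + g x) = c i *\<^sub>R (LINT x|K i. f x) + c i *\<^sub>R (LINT x|K i. g x)" if "i \<in> I" for i
  proof (cases "c i = 0")
    case False
    then have "integrable (K i) f" "integrable (K i) g"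
      using add c[OF that] that integrable_weighted_sum[OF I sets em, of f]
        integrable_weighted_sum[OF I sets em, of g] by (auto simp: less_le)
    then show ?thesis by (simp add: scaleR_add_right)
  qed simp
  then show ?case
    using add by (simp add: sum.distrib)
next
  case (lim f s)
  have "(\<lambda>n. c i *\<^sub>R (LINT x|K i. s n x)) \<longlonglongrightarrow> c i *\<^sub>R (LINT x|K i. f x)" if "i \<in> I" for i
  proof (cases "c i = 0")
    case False
    note sp = sets_eq_imp_space_eq[OF sets[OF that]]
    have int: "integrable (K i) f" "\<And>n. integrable (K i) (s n)"
      using False lim c[OF that] that integrable_weighted_sum[OF I sets em, of f]
        integrable_weighted_sum[OF I sets em, of "s _"] by (auto simp: less_le)
    have "(\<lambda>n. LINT x|K i. s n x) \<longlonglongrightarrow> (LINT x|K i. f x)"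
      using int lim sp
      by (intro integral_dominated_convergence[where w = "\<lambda>x. 2 * norm (f x)"]) auto
    then show ?thesis
      by (intro tendsto_scaleR tendsto_const)
  qed simp
  then have "(\<lambda>n. \<Sum>i\<in>I. c i *\<^sub>R (LINT x|K i. s n x)) \<longlonglongrightarrow> (\<Sum>i\<in>I. c i *\<^sub>R (LINT x|K i. f x))"
    by (intro tendsto_sum)
  moreover have "(\<lambda>n. LINT x|N. s n x) \<longlonglongrightarrow> (LINT x|N. f x)"
    using lim by (intro integral_dominated_convergence[where w = "\<lambda>x. 2 * norm (f x)"]) auto
  ultimately show ?case
    unfolding lim.IH using LIMSEQ_unique by blast
qed

lemma
  fixes K :: "'i \<Rightarrow> 'a::topological_space measure"
  assumes I: "finite I" and sets: "\<And>i. i \<in> I \<Longrightarrow> sets (K i) = sets borel"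
  shows sets_weighted_sum: "sets (measure_of UNIV (sets borel) (\<lambda>B. \<Sum>i\<in>I. c i * emeasure (K i) B)) = sets borel"
    and emeasure_weighted_sum: "B \<in> sets borel \<Longrightarrow>
      emeasure (measure_of UNIV (sets borel) (\<lambda>B. \<Sum>i\<in>I. c i * emeasure (K i) B)) B = (\<Sum>i\<in>I. c i * emeasure (K i) B)"
proof -
  let ?\<mu> = "\<lambda>B :: 'a set. \<Sum>i\<in>I. c i * emeasure (K i) B"
  have alg: "sigma_sets UNIV (sets borel) = (sets borel :: 'a set set)"
    by (metis sets.sigma_sets_eq space_borel)
  then show "sets (measure_of UNIV (sets borel) ?\<mu>) = sets borel"
    by (simp add: sets_measure_of_conv)
  show "emeasure (measure_of UNIV (sets borel) ?\<mu>) B = ?\<mu> B" if "B \<in> sets borel"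
  proof (rule emeasure_measure_of_sigma)
    show "sigma_algebra UNIV (sets borel :: 'a set set)"
      using sets.sigma_algebra_axioms[of "borel :: 'a measure"] by simp
    show "positive (sets borel) ?\<mu>"
      by (simp add: positive_def)
    show "countably_additive (sets borel) ?\<mu>"
    proof (rule countably_additiveI)
      fix A :: "nat \<Rightarrow> 'a set" assume A: "range A \<subseteq> (sets borel :: 'a set set)" "disjoint_family A"
      have "(\<Sum>n. ?\<mu> (A n)) = (\<Sum>i\<in>I. \<Sum>n. c i * emeasure (K i) (A n))"
        by (intro suminf_sum) simp
      also have "\<dots> = ?\<mu> (\<Union>n. A n)"
        using A sets by (intro sum.cong) (simp_all add: suminf_emeasure)
      finally show "(\<Sum>n. ?\<mu> (A n)) = ?\<mu> (\<Union>n. A n)" .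
    qed
  qed fact
qed

section \<open>Coordinate maps\<close>

text \<open>
  This family contains the projections \<open>coord_proj J\<close> (with the identity as \<iota>), the extraction of a
  single coordinate (with a constant \<iota>), the two halves of a vector of dimension 2n, and the maps that
  act on both halves in the same way, so that each fact is proved once for all of them. They are
  contractions if \<iota> is injective on D.
\<close>
definition coord_map :: "'m set \<Rightarrow> ('m \<Rightarrow> 'n) \<Rightarrow> real ^ 'n \<Rightarrow> real ^ 'm" where
  "coord_map D \<iota> x = (\<chi> j. if j \<in> D then x $ \<iota> j else 0)"

definition coord_matrix :: "'m set \<Rightarrow> ('m \<Rightarrow> 'n) \<Rightarrow> real ^ 'n ^ 'm" where
  "coord_matrix D \<iota> = (\<chi> j i. if j \<in> D \<and> i = \<iota> j then 1 else 0)"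

definition coord_submatrix :: "'m set \<Rightarrow> ('m \<Rightarrow> 'n) \<Rightarrow> real ^ 'n ^ 'n \<Rightarrow> real ^ 'm ^ 'm" where
  "coord_submatrix D \<iota> \<Sigma> = (\<chi> j l. if j \<in> D \<and> l \<in> D then \<Sigma> $ \<iota> j $ \<iota> l else 0)"

lemma coord_proj_coord_map: "coord_proj J = coord_map J id"
  by (simp add: fun_eq_iff coord_proj_def coord_map_def)

lemma coord_map_nth: "coord_map D \<iota> x $ j = (if j \<in> D then x $ \<iota> j else 0)"
  by (simp add: coord_map_def)

lemma coord_matrix_mult: "coord_matrix D \<iota> *v x = coord_map D \<iota> x"
  by (simp add: vec_eq_iff coord_matrix_def coord_map_def matrix_vector_mult_def if_distrib if_distribR
      cong: if_cong)

lemma coord_matrix_conjugate: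
  fixes \<iota> :: "'a::finite \<Rightarrow> 'b::finite"
  shows
  "coord_matrix D \<iota> ** \<Sigma> ** transpose (coord_matrix D \<iota>) = coord_submatrix D \<iota> \<Sigma>"
proof -
  have "(coord_matrix D \<iota> ** \<Sigma>) $ j $ i = (if j \<in> D then \<Sigma> $ \<iota> j $ i else 0)" for j i
    by (simp add: coord_matrix_def matrix_matrix_mult_def if_distrib if_distribR cong: if_cong)
  moreover have "(P ** transpose (coord_matrix D \<iota>)) $ j $ l = (if l \<in> D then P $ j $ \<iota> l else 0)" for P :: "real ^ 'b ^ 'a" and j l
    by (simp add: coord_matrix_def matrix_matrix_mult_def transpose_def if_distrib if_distribR cong: if_cong)
  ultimately show ?thesis
    by (simp add: vec_eq_iff coord_submatrix_def)
qed

lemma linear_coord_map: "linear (coord_map D \<iota>)"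
  using matrix_vector_mul_linear[of "coord_matrix D \<iota>"] by (simp add: coord_matrix_mult[abs_def])

lemma borel_measurable_coord_map [measurable]: "coord_map D \<iota> \<in> borel_measurable borel"
  using linear_coord_map by (intro borel_measurable_continuous_onI linear_continuous_on)
    (simp add: linear_conv_bounded_linear)

lemma borel_measurable_coord_proj [measurable]: "coord_proj J \<in> borel_measurable borel"
  by (simp add: coord_proj_coord_map)

lemma norm_coord_map_le:
  assumes "inj_on \<iota> D"
  shows "norm (coord_map D \<iota> x) \<le> norm x"
proof -
  have "(\<Sum>j\<in>UNIV. (norm (coord_map D \<iota> x $ j))\<^sup>2) = (\<Sum>j\<in>D. (x $ \<iota> j)\<^sup>2)"
    by (intro sum.mono_neutral_cong_right) (auto simp: coord_map_nth)
  also have "\<dots> = (\<Sum>i\<in>\<iota> ` D. (x $ i)\<^sup>2)"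
    using assms by (simp add: sum.reindex)
  also have "\<dots> \<le> (\<Sum>i\<in>UNIV. (norm (x $ i))\<^sup>2)"
    by (simp add: sum_mono2)
  finally show ?thesis
    by (simp add: norm_vec_def L2_set_def)
qed

lemma norm_coord_proj_le: "norm (coord_proj J x) \<le> norm x"
  by (simp add: coord_proj_coord_map norm_coord_map_le)

lemma levy_law_coord_map:
  assumes "levy_law M Z m \<Theta> \<Z>" and "inj_on \<iota> D"
  shows "levy_law M (\<lambda>t \<omega>. coord_map D \<iota> (Z t \<omega>))
    (coord_map D \<iota> m + recentering (coord_map D \<iota>) \<Z>) (coord_submatrix D \<iota> \<Theta>)
    (punctured_distr \<Z> (coord_map D \<iota>))"
  using levy_law_linear_image[OF assms(1), of "coord_matrix D \<iota>"] norm_coord_map_le[OF assms(2)]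
  by (simp add: coord_matrix_mult coord_matrix_mult[abs_def] coord_matrix_conjugate)

lemma coord_proj_0 [simp]: "coord_proj J 0 = 0"
  by (simp add: vec_eq_iff coord_proj_def)

lemma coord_map_0 [simp]: "coord_map D \<iota> 0 = 0"
  by (simp add: vec_eq_iff coord_map_def)

lemma coord_map_orthant: "d \<in> orthant \<Longrightarrow> coord_map D \<iota> d \<in> orthant"
  by (auto simp: orthant_def coord_map_def)

lemma orthant_borel [measurable]: "orthant \<in> sets borel" "orthant0 \<in> sets borel"
proof -
  have "{t :: real ^ 'n. \<forall>i. 0 \<le> t $ i} \<in> sets borel"
    by measurable
  then show *: "(orthant :: (real ^ 'n) set) \<in> sets borel"
    by (simp add: orthant_def)
  then show "(orthant0 :: (real ^ 'n) set) \<in> sets borel"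
    unfolding orthant0_def by (intro sets.Diff) simp_all
qed

text \<open>
  The location of T contains the first moment of its Levy measure on the unit ball. Recentering exactly
  turns the image of this vector into the first moment of the image measure on the unit ball, so that
  the drift is transformed by the map itself.
\<close>
lemma subordinator_law_coord_map:
  fixes \<iota> :: "'m::finite \<Rightarrow> 'n::finite"
  assumes T: "subordinator_law M T d \<T>" and inj: "inj_on \<iota> D"
  shows "subordinator_law M (\<lambda>t \<omega>. coord_map D \<iota> (T t \<omega>)) (coord_map D \<iota> d) (punctured_distr \<T> (coord_map D \<iota>))"
proof -
  let ?L = "coord_map D \<iota>"
  have mono: "AE \<omega> in M. \<forall>s t i. 0 \<le> s \<longrightarrow> s \<le> t \<longrightarrow> T s \<omega> $ i \<le> T t \<omega> $ i"
    and d: "d \<in> orthant" and null: "emeasure \<T> (- orthant0) = 0"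
    and fin: "(\<integral>\<^sup>+ t. ennreal (min 1 (norm t)) \<partial>\<T>) < \<infinity>"
    and law: "levy_law M T (d + (LINT t:cball 0 1|\<T>. t)) 0 \<T>"
    using T by (auto simp: subordinator_law_def)
  have \<T>: "levy_measure \<T>"
    using law by (simp add: levy_law_def)
  then have S[measurable_cong]: "sets \<T> = sets borel"
    by (simp add: levy_measure_def)
  have sp: "space \<T> = UNIV"
    using sets_eq_imp_space_eq[OF S] by simp
  have Ln: "norm (?L x) \<le> norm x" for x
    by (rule norm_coord_map_le[OF inj])
  have bl: "bounded_linear ?L"
    using linear_coord_map by (simp add: linear_conv_bounded_linear)
  have mono': "AE \<omega> in M. \<forall>s t i. 0 \<le> s \<longrightarrow> s \<le> t \<longrightarrow> ?L (T s \<omega>) $ i \<le> ?L (T t \<omega>) $ i"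
    using mono by eventually_elim (auto simp: coord_map_nth)
  have null': "emeasure (punctured_distr \<T> ?L) (- orthant0) = 0"
  proof -
    have "emeasure (punctured_distr \<T> ?L) (- orthant0) = emeasure \<T> {t \<in> space \<T>. ?L t \<in> - orthant0 - {0}}"
      by (intro emeasure_punctured_distr) auto
    also have "\<dots> \<le> emeasure \<T> (- orthant0)"
      by (intro emeasure_mono) (auto simp: orthant0_def coord_map_orthant S)
    finally show ?thesis using null by simp
  qed
  have fin': "(\<integral>\<^sup>+ t. ennreal (min 1 (norm t)) \<partial>punctured_distr \<T> ?L) < \<infinity>"
  proof -
    have "(\<integral>\<^sup>+ t. ennreal (min 1 (norm t)) \<partial>punctured_distr \<T> ?L) = (\<integral>\<^sup>+ t. ennreal (min 1 (norm (?L t))) \<partial>\<T>)"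
      by (intro nn_integral_punctured_distr) auto
    also have "\<dots> \<le> (\<integral>\<^sup>+ t. ennreal (min 1 (norm t)) \<partial>\<T>)"
      using Ln by (intro nn_integral_mono ennreal_leI min.mono) auto
    finally show ?thesis using fin by simp
  qed
  have int1: "integrable \<T> (\<lambda>t. min 1 (norm t))"
    using fin by (intro integrableI_nonneg) auto
  have i: "integrable \<T> (\<lambda>t. indicator (cball 0 1) t *\<^sub>R t)"
    by (rule Bochner_Integration.integrable_bound[OF int1]) (measurable, auto simp: indicator_def)
  have "?L (LINT t:cball 0 1|\<T>. t) = (LINT t|\<T>. indicator (cball 0 1) t *\<^sub>R ?L t)"
    unfolding set_lebesgue_integral_def
    by (subst integral_bounded_linear[OF bl i, symmetric]) (simp add: linear_cmul[OF linear_coord_map])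
  moreover have i': "integrable \<T> (\<lambda>t. indicator (cball 0 1) t *\<^sub>R ?L t)"
    using integrable_bounded_linear[OF bl i] by (simp add: linear_cmul[OF linear_coord_map])
  ultimately have "?L (LINT t:cball 0 1|\<T>. t) + recentering ?L \<T> = (LINT t|\<T>. indicator (cball 0 1) (?L t) *\<^sub>R ?L t)"
    using Bochner_Integration.integral_add[OF i' integrable_recentering[OF \<T> borel_measurable_coord_map Ln]]
    by (simp add: recentering_def scaleR_add_left[symmetric])
  also have "\<dots> = (LINT t:cball 0 1|punctured_distr \<T> ?L. t)"
    unfolding set_lebesgue_integral_def by (subst integral_punctured_distr) auto
  finally have loc: "?L (d + (LINT t:cball 0 1|\<T>. t)) + recentering ?L \<T> = ?L d + (LINT t:cball 0 1|punctured_distr \<T> ?L. t)"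
    by (simp add: linear_add[OF linear_coord_map])
  have "coord_submatrix D \<iota> 0 = 0"
    by (simp add: coord_submatrix_def vec_eq_iff)
  then show ?thesis
    using levy_law_coord_map[OF law inj] mono' null' fin' coord_map_orthant[OF d]
    by (simp add: subordinator_law_def loc)
qed

section \<open>Layers of a time vector\<close>

text \<open>
  For d in the orthant and s increasing from 0, these sets run through the sets \<open>time_tail d k\<close> with
  \<open>time_gap d k > 0\<close>, followed by the empty set, and no ordering of the coordinates has to be
  chosen.
\<close>
definition levels_above :: "real ^ 'n \<Rightarrow> real \<Rightarrow> 'n set" where
  "levels_above d s = {i. s < d $ i}"

text \<open>
  The common shape of the diamond operation on vectors and measures and of the compensation.
\<close>
definition layer_sum :: "real ^ 'n \<Rightarrow> ('n set \<Rightarrow> 'a::real_vector) \<Rightarrow> 'a" where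
  "layer_sum d F = (\<Sum>k = 1..CARD('n). time_gap d k *\<^sub>R F (time_tail d k))"

lemma time_ord_mono:
  fixes d :: "real ^ 'n"
  assumes d: "d \<in> orthant" and "i \<le> j" "j \<le> CARD('n)"
  shows "time_ord d i \<le> time_ord d j"
  using assms time_perm(2)[of i j d] by (auto simp: time_ord_def orthant_def)

lemma time_gap_nonneg:
  fixes d :: "real ^ 'n"
  assumes "d \<in> orthant" "k \<le> CARD('n)"
  shows "0 \<le> time_gap d k"
  using time_ord_mono[OF assms(1), of "k - 1" k] assms(2) by (simp add: time_gap_def)

lemma time_tail_1: "time_tail (d :: real ^ 'n) (Suc 0) = UNIV"
  using time_perm(1)[of d] by (simp add: time_tail_def bij_betw_def)

text \<open>
  Each s below the largest coordinate of d lies in exactly one of the intervals between consecutive order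
  statistics, and the coordinates above s are then those from that interval on. Intervals arising from
  ties are empty.
\<close>
lemma sum_layers:
  fixes d :: "real ^ 'n" and F :: "'n set \<Rightarrow> 'a::comm_monoid_add"
  assumes d: "d \<in> orthant" and F: "F {} = 0" and s: "0 \<le> s"
  shows "F (levels_above d s) =
    (\<Sum>k = 1..CARD('n). if s \<in> {time_ord d (k - 1)..<time_ord d k} then F (time_tail d k) else 0)"
proof -
  let ?n = "CARD('n)"
  have bij: "bij_betw (time_perm d) {1..?n} UNIV"
    by (rule time_perm)
  have perm: "\<exists>k\<in>{1..?n}. i = time_perm d k" for i
    using bij by (metis UNIV_I bij_betw_imp_surj_on imageE)
  show ?thesis
  proof (cases "s < time_ord d ?n")
    case False
    have "d $ i \<le> s" for i
      using perm[of i] time_ord_mono[OF d, of _ ?n] False by (force simp: time_ord_def)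
    then have "levels_above d s = {}"
      by (auto simp: levels_above_def not_less)
    moreover have "\<not> s < time_ord d k" if "k \<in> {1..?n}" for k
      using time_ord_mono[OF d, of k ?n] that False by auto
    ultimately show ?thesis
      using F by (simp cong: if_cong)
  next
    case True
    define k where "k = (LEAST k. s < time_ord d k)"
    have k: "s < time_ord d k" and kn: "k \<le> ?n"
      unfolding k_def using True by (auto intro: LeastI Least_le)
    have k0: "k \<noteq> 0"
      using k s by (intro notI) (simp add: time_ord_def)
    have less: "time_ord d j \<le> s" if "j < k" for j
      using not_less_Least[of j "\<lambda>k. s < time_ord d k"] that by (auto simp: k_def)
    have iff: "s < time_ord d j \<longleftrightarrow> k \<le> j" if "j \<le> ?n" for j
      using less[of j] time_ord_mono[OF d, of k j] that k by (cases "k \<le> j") auto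
    have "levels_above d s = time_tail d k"
    proof (intro set_eqI iffI)
      fix i assume "i \<in> levels_above d s"
      moreover obtain j where "j \<in> {1..?n}" "i = time_perm d j"
        using perm by blast
      ultimately show "i \<in> time_tail d k"
        using iff[of j] by (auto simp: levels_above_def time_tail_def time_ord_def)
    next
      fix i assume "i \<in> time_tail d k"
      then obtain j where "j \<in> {k..?n}" "i = time_perm d j"
        by (auto simp: time_tail_def)
      then show "i \<in> levels_above d s"
        using iff[of j] k0 by (auto simp: levels_above_def time_ord_def)
    qed
    moreover have "s \<in> {time_ord d (j - 1)..<time_ord d j} \<longleftrightarrow> j = k" if "j \<in> {1..?n}" for j
    proof -
      have "s < time_ord d j \<longleftrightarrow> k \<le> j" "time_ord d (j - 1) \<le> s \<longleftrightarrow> \<not> k \<le> j - 1"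
        using iff[of j] iff[of "j - 1", OF order_trans[OF diff_le_self]] that by (auto simp flip: not_less)
      then show ?thesis
        using that k0 by auto
    qed
    then have "(\<Sum>j = 1..?n. if s \<in> {time_ord d (j - 1)..<time_ord d j} then F (time_tail d j) else 0) =
        (\<Sum>j = 1..?n. if j = k then F (time_tail d j) else 0)"
      by (intro sum.cong) auto
    then have "(\<Sum>j = 1..?n. if s \<in> {time_ord d (j - 1)..<time_ord d j} then F (time_tail d j) else 0) =
        F (time_tail d k)"
      using kn k0 by simp
    ultimately show ?thesis by simp
  qed
qed

lemma has_integral_layers:
  fixes d :: "real ^ 'n" and F :: "'n set \<Rightarrow> 'a::{banach, second_countable_topology}"
  assumes d: "d \<in> orthant" and F: "F {} = 0"
  shows "has_bochner_integral lborel (\<lambda>s. indicator {0..} s *\<^sub>R F (levels_above d s)) (layer_sum d F)"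
proof -
  have ord0: "0 \<le> time_ord d k" if "k \<le> CARD('n)" for k
    using time_ord_mono[OF d, of 0 k] that by (simp add: time_ord_def)
  have eq: "indicator {0..} s *\<^sub>R F (levels_above d s) =
    (\<Sum>k = 1..CARD('n). indicator {time_ord d (k - 1)..<time_ord d k} s *\<^sub>R F (time_tail d k))" for s
  proof (cases "0 \<le> s")
    case True
    have "indicator {time_ord d (k - 1)..<time_ord d k} s *\<^sub>R F (time_tail d k) = (if s \<in> {time_ord d (k - 1)..<time_ord d k} then F (time_tail d k) else 0)" for k
      by (simp add: indicator_def)
    then show ?thesis
      using sum_layers[of d F s, OF d F True] True by simp
  next
    case False
    have "s \<notin> {time_ord d (k - 1)..<time_ord d k}" if "k \<in> {1..CARD('n)}" for k
      using ord0[of "k - 1", OF order_trans[OF diff_le_self]] that False by auto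
    then show ?thesis
      using False by (auto intro!: sum.neutral[symmetric])
  qed
  have "has_bochner_integral lborel (\<lambda>s. indicator {time_ord d (k - 1)..<time_ord d k} s *\<^sub>R F (time_tail d k))
      (time_gap d k *\<^sub>R F (time_tail d k))" if "k \<in> {1..CARD('n)}" for k
  proof (rule has_bochner_integral_scaleR_left)
    have "has_bochner_integral lborel (indicator {time_ord d (k - 1)..<time_ord d k})
        (measure lborel {time_ord d (k - 1)..<time_ord d k})"
      by (intro has_bochner_integral_real_indicator) (use time_ord_mono[OF d, of "k - 1" k] that in \<open>auto\<close>)
    then show "has_bochner_integral lborel (indicator {time_ord d (k - 1)..<time_ord d k}) (time_gap d k)"
      using time_ord_mono[OF d, of "k - 1" k] that by (simp add: time_gap_def)
  qed
  then show ?thesis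
    unfolding eq layer_sum_def by (intro has_bochner_integral_sum)
qed

lemma nn_integral_layers:
  fixes d :: "real ^ 'n" and F :: "'n set \<Rightarrow> ennreal"
  assumes d: "d \<in> orthant" and F: "F {} = 0"
  shows "(\<integral>\<^sup>+ s. indicator {0..} s * F (levels_above d s) \<partial>lborel) =
    (\<Sum>k = 1..CARD('n). ennreal (time_gap d k) * F (time_tail d k))"
proof -
  have ord0: "0 \<le> time_ord d k" if "k \<le> CARD('n)" for k
    using time_ord_mono[OF d, of 0 k] that by (simp add: time_ord_def)
  have eq: "indicator {0..} s * F (levels_above d s) =
    (\<Sum>k = 1..CARD('n). F (time_tail d k) * indicator {time_ord d (k - 1)..<time_ord d k} s)" for s
  proof (cases "0 \<le> s")
    case True
    have "F (time_tail d k) * indicator {time_ord d (k - 1)..<time_ord d k} s = (if s \<in> {time_ord d (k - 1)..<time_ord d k} then F (time_tail d k) else 0)" for k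
      by (simp add: indicator_def)
    then show ?thesis
      using sum_layers[of d F s, OF d F True] True by simp
  next
    case False
    have "s \<notin> {time_ord d (k - 1)..<time_ord d k}" if "k \<in> {1..CARD('n)}" for k
      using ord0[of "k - 1", OF order_trans[OF diff_le_self]] that False by auto
    then show ?thesis
      using False by (auto intro!: sum.neutral[symmetric])
  qed
  have "(\<integral>\<^sup>+ s. indicator {0..} s * F (levels_above d s) \<partial>lborel) =
      (\<Sum>k = 1..CARD('n). F (time_tail d k) * emeasure lborel {time_ord d (k - 1)..<time_ord d k})"
    unfolding eq by (subst nn_integral_sum) (simp_all add: nn_integral_cmult_indicator del: indicator_simps)
  also have "\<dots> = (\<Sum>k = 1..CARD('n). ennreal (time_gap d k) * F (time_tail d k))"
    using time_ord_mono[OF d] by (intro sum.cong) (auto simp: time_gap_def mult.commute)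
  finally show ?thesis .
qed

lemma layer_sum_cong:
  assumes "\<And>S. F S = G S" shows "layer_sum d F = layer_sum d G"
  using assms by (simp add: layer_sum_def)

lemma layer_sum_add: "layer_sum d (\<lambda>S. F S + G S) = layer_sum d F + layer_sum d G"
  by (simp add: layer_sum_def scaleR_add_right sum.distrib)

lemma layer_sum_linear: "linear f \<Longrightarrow> f (layer_sum d F) = layer_sum d (\<lambda>S. f (F S))"
  by (simp add: layer_sum_def linear_sum linear_cmul)

text \<open>
  In the i-th coordinate this says that the interval from 0 to d_i has length d_i.
\<close>
lemma layer_sum_coord_proj:
  fixes d :: "real ^ 'n"
  assumes d: "d \<in> orthant"
  shows "layer_sum d (\<lambda>S. coord_proj S v) = diamond_vec d v"
proof (rule vec_eq_iff[THEN iffD2], rule allI)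
  fix i :: 'n
  have "layer_sum d (\<lambda>S. coord_proj S v) $ i = layer_sum d (\<lambda>S. (if i \<in> S then 1 else 0) * v $ i)"
    by (subst layer_sum_linear[of "\<lambda>x. x $ i"])
      (auto intro!: layer_sum_cong linearI simp: coord_proj_def)
  also have "\<dots> = layer_sum d (\<lambda>S. if i \<in> S then 1 else 0) * v $ i"
    by (simp add: layer_sum_def sum_distrib_right mult.assoc)
  also have "layer_sum d (\<lambda>S. if i \<in> S then 1 else 0 :: real) = d $ i"
  proof -
    have di: "0 \<le> d $ i" using d by (simp add: orthant_def)
    have "has_bochner_integral lborel (\<lambda>s. indicator {0..} s *\<^sub>R (if i \<in> levels_above d s then 1 else 0 :: real))
        (layer_sum d (\<lambda>S. if i \<in> S then 1 else 0))"
      using d by (intro has_integral_layers) auto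
    also have "(\<lambda>s. indicator {0..} s *\<^sub>R (if i \<in> levels_above d s then 1 else 0 :: real)) = indicator {0..<d $ i}"
      by (auto simp: fun_eq_iff indicator_def levels_above_def)
    finally have "has_bochner_integral lborel (indicator {0..<d $ i} :: real \<Rightarrow> real) (layer_sum d (\<lambda>S. if i \<in> S then 1 else 0))" .
    moreover have "has_bochner_integral lborel (indicator {0..<d $ i} :: real \<Rightarrow> real) (measure lborel {0..<d $ i})"
      using di by (intro has_bochner_integral_real_indicator) auto
    ultimately show ?thesis
      using di has_bochner_integral_eq by force
  qed
  finally show "layer_sum d (\<lambda>S. coord_proj S v) $ i = diamond_vec d v $ i"
    by (simp add: diamond_vec_def)
qed

text \<open>
  The number of coordinates and the permutations on the two sides are unrelated; the integrals over
  levels nevertheless have the same integrand.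
\<close>
lemma layer_sum_transfer:
  fixes d :: "real ^ 'n" and d' :: "real ^ 'm" and F :: "'m set \<Rightarrow> 'a::{banach, second_countable_topology}"
  assumes d: "d \<in> orthant" "d' \<in> orthant" and R: "\<And>s. 0 \<le> s \<Longrightarrow> levels_above d' s = R (levels_above d s)"
    and F: "F {} = 0" "F (R {}) = 0"
  shows "layer_sum d' F = layer_sum d (\<lambda>S. F (R S))"
proof -
  have "(\<lambda>s. indicator {0..} s *\<^sub>R F (levels_above d' s)) = (\<lambda>s. indicator {0..} s *\<^sub>R F (R (levels_above d s)))"
    using R by (auto simp: fun_eq_iff indicator_def)
  then show ?thesis
    using has_integral_layers[OF d(2), of F] has_integral_layers[OF d(1), of "\<lambda>S. F (R S)"] F
    by (metis has_bochner_integral_eq)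
qed

lemma nn_layer_sum_transfer:
  fixes d :: "real ^ 'n" and d' :: "real ^ 'm" and F :: "'m set \<Rightarrow> ennreal"
  assumes d: "d \<in> orthant" "d' \<in> orthant" and R: "\<And>s. 0 \<le> s \<Longrightarrow> levels_above d' s = R (levels_above d s)"
    and F: "F {} = 0" "F (R {}) = 0"
  shows "(\<Sum>k = 1..CARD('m). ennreal (time_gap d' k) * F (time_tail d' k)) =
    (\<Sum>k = 1..CARD('n). ennreal (time_gap d k) * F (R (time_tail d k)))"
proof -
  have "(\<integral>\<^sup>+ s. indicator {0..} s * F (levels_above d' s) \<partial>lborel) =
      (\<integral>\<^sup>+ s. indicator {0..} s * F (R (levels_above d s)) \<partial>lborel)"
    using R by (intro nn_integral_cong) (auto simp: indicator_def)
  then show ?thesis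
    using nn_integral_layers[OF d(2), of F] nn_integral_layers[OF d(1), of "\<lambda>S. F (R S)"] F by simp
qed

section \<open>The diamond operation under coordinate maps\<close>

lemma norm_truncation_difference_le:
  fixes u :: "'a::real_normed_vector" and v :: "'b::real_normed_vector"
    and x :: "'c::real_normed_vector" and y :: "'d::real_normed_vector"
  assumes "norm y \<le> norm u" "norm u \<le> norm v" "norm v \<le> norm x"
  shows "norm ((indicator (cball 0 1) u - indicator (cball 0 1) v) *\<^sub>R y) \<le> 1 * min 1 ((norm x)\<^sup>2)"
  using assms by (auto simp: indicator_def min_def power_le_one_iff)

lemma proj_measure_eq: "proj_measure J \<X> = punctured_distr \<X> (coord_proj J)"
  by (simp add: proj_measure_def punctured_distr_def)

text \<open>
  Being outside the unit ball while the smaller vector f x is inside is the same as the difference of the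
  two truncations; this turns the integrals in the compensation into recentering vectors.
\<close>
lemma coord_proj_diff_eq:
  fixes x :: "real ^ 'n" and f :: "real ^ 'n \<Rightarrow> real ^ 'm"
  assumes "norm (f x) \<le> norm x"
  shows "indicator (- cball 0 1) x *\<^sub>R (indicator (cball 0 1) (f x) *\<^sub>R f x) =
    (indicator (cball 0 1) (f x) - indicator (cball 0 1) x) *\<^sub>R f x"
  using assms by (auto simp: indicator_def)

lemma diamond_vec_add: "diamond_vec d (u + v) = diamond_vec d u + diamond_vec d v"
  by (simp add: vec_eq_iff diamond_vec_def algebra_simps)

lemma
  fixes \<X> :: "(real ^ 'n) measure"
  shows sets_diamond_measure [simp, measurable_cong]: "sets (diamond_measure d \<X>) = sets borel"
    and emeasure_diamond_measure_proj: "B \<in> sets borel \<Longrightarrow> emeasure (diamond_measure d \<X>) B =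
      (\<Sum>k = 1..CARD('n). ennreal (time_gap d k) * emeasure (punctured_distr \<X> (coord_proj (time_tail d k))) B)"
  unfolding diamond_measure_def proj_measure_eq
  by (subst sets_weighted_sum emeasure_weighted_sum; simp)+

lemma emeasure_diamond_measure:
  fixes \<X> :: "(real ^ 'n) measure"
  assumes [measurable_cong]: "sets \<X> = sets borel" and [measurable]: "B \<in> sets borel"
  shows "emeasure (diamond_measure d \<X>) B =
      (\<Sum>k = 1..CARD('n). ennreal (time_gap d k) * emeasure \<X> {x. coord_proj (time_tail d k) x \<in> B - {0}})"
  using sets_eq_imp_space_eq[OF assms(1)]
  by (simp add: emeasure_diamond_measure_proj emeasure_punctured_distr)

lemma
  fixes \<X> :: "(real ^ 'n) measure" and f :: "real ^ 'n \<Rightarrow> 'b::{banach, second_countable_topology}"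
  assumes d: "d \<in> orthant" and X: "levy_measure \<X>" and f[measurable]: "f \<in> borel_measurable borel"
    and bound: "\<And>x. norm (f x) \<le> C * min 1 ((norm x)\<^sup>2)"
  shows integrable_diamond_measure: "integrable (diamond_measure d \<X>) f"
    and integral_diamond_measure:
      "(LINT x|diamond_measure d \<X>. f x) = layer_sum d (\<lambda>S. LINT x|\<X>. f (coord_proj S x))"
proof -
  have [measurable_cong]: "sets \<X> = sets borel"
    using X by (simp add: levy_measure_def)
  have f0: "f 0 = 0"
    using bound[of 0] by simp
  have int: "integrable (punctured_distr \<X> (coord_proj S)) f" for S
    by (intro integrable_levy_measure[OF levy_measure_punctured_distr[OF X] f bound] norm_coord_proj_le) measurable
  show int': "integrable (diamond_measure d \<X>) f"
    by (subst integrable_weighted_sum[OF _ _ emeasure_diamond_measure_proj]) (auto intro: int)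
  have "(LINT x|diamond_measure d \<X>. f x) =
    (\<Sum>k = 1..CARD('n). time_gap d k *\<^sub>R (LINT x|punctured_distr \<X> (coord_proj (time_tail d k)). f x))"
    by (rule integral_weighted_sum[OF _ _ emeasure_diamond_measure_proj _ int']) (auto intro: time_gap_nonneg[OF d])
  then show "(LINT x|diamond_measure d \<X>. f x) = layer_sum d (\<lambda>S. LINT x|\<X>. f (coord_proj S x))"
    by (simp add: layer_sum_def integral_punctured_distr f0)
qed

lemma levy_measure_diamond_measure:
  fixes \<X> :: "(real ^ 'n) measure"
  assumes d: "d \<in> orthant" and X: "levy_measure \<X>"
  shows "levy_measure (diamond_measure d \<X>)"
proof -
  have [measurable_cong]: "sets \<X> = sets borel"
    using X by (simp add: levy_measure_def)
  have "integrable (diamond_measure d \<X>) (\<lambda>x. min 1 ((norm x)\<^sup>2))"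
    by (rule integrable_diamond_measure[OF d X, where C = 1]) auto
  then have "(\<integral>\<^sup>+ x. ennreal (min 1 ((norm x)\<^sup>2)) \<partial>diamond_measure d \<X>) < \<infinity>"
    by (simp add: integrable_iff_bounded)
  then show ?thesis
    by (simp add: levy_measure_def emeasure_diamond_measure \<open>sets \<X> = sets borel\<close>)
qed

text \<open>
  The term for k = 1 belongs to the projection on all coordinates, for which there is nothing to
  recenter, so that the sum may start at 1 rather than at 2.
\<close>
lemma compensation_eq_layer_sum:
  fixes \<X> :: "(real ^ 'n) measure"
  shows "compensation d \<X> = layer_sum d (\<lambda>S. recentering (coord_proj S) \<X>)"
proof -
  have *: "(LINT x:- cball 0 1|\<X>. indicator (cball 0 1) (coord_proj S x) *\<^sub>R coord_proj S x) =
      recentering (coord_proj S) \<X>" for S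
    unfolding set_lebesgue_integral_def recentering_def
    by (intro Bochner_Integration.integral_cong coord_proj_diff_eq norm_coord_proj_le refl)
  have "recentering (coord_proj UNIV) \<X> = 0"
    by (simp add: recentering_def coord_proj_def)
  then have "(\<Sum>k = 1..CARD('n). time_gap d k *\<^sub>R recentering (coord_proj (time_tail d k)) \<X>) =
    (\<Sum>k = 2..CARD('n). time_gap d k *\<^sub>R recentering (coord_proj (time_tail d k)) \<X>)"
    by (intro sum.mono_neutral_right) (auto simp: time_tail_1 not_le less_Suc_eq_le numeral_2_eq_2 le_Suc_eq
        dest: le_antisym)
  then show ?thesis
    by (simp add: compensation_def * layer_sum_def)
qed

context
  fixes D :: "'m::finite set" and \<iota> :: "'m \<Rightarrow> 'n::finite"
begin

definition coord_preimage :: "'n set \<Rightarrow> 'm set" where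
  "coord_preimage S = {j \<in> D. \<iota> j \<in> S}"

lemma coord_preimage_empty: "coord_preimage {} = {}"
  by (simp add: coord_preimage_def)

lemma coord_proj_coord_map_commute:
  "coord_proj (coord_preimage S) (coord_map D \<iota> x) = coord_map D \<iota> (coord_proj S x)"
  by (auto simp: vec_eq_iff coord_map_def coord_proj_def coord_preimage_def)

lemma levels_above_coord_map: "0 \<le> s \<Longrightarrow> levels_above (coord_map D \<iota> d) s = coord_preimage (levels_above d s)"
  by (auto simp: levels_above_def coord_map_def coord_preimage_def split: if_splits)

text \<open>
  Projecting to the coordinates in the preimage of S after the coordinate map is the same as applying the
  map after projecting to S, and the levels above s are transformed by taking preimages.
\<close>
lemma diamond_measure_coord_map:
  assumes d: "d \<in> orthant" and X: "sets \<X> = sets borel"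
  shows "diamond_measure (coord_map D \<iota> d) (punctured_distr \<X> (coord_map D \<iota>)) =
    punctured_distr (diamond_measure d \<X>) (coord_map D \<iota>)" (is "?l = ?r")
proof (rule measure_eqI)
  note X[measurable_cong]
  note sp = sets_eq_imp_space_eq[OF X] sets_eq_imp_space_eq[OF sets_diamond_measure, of d \<X>]
  fix B assume "B \<in> sets ?l"
  then have B[measurable]: "B \<in> sets borel" by simp
  have "emeasure ?l B = (\<Sum>k = 1..CARD('m). ennreal (time_gap (coord_map D \<iota> d) k) *
     emeasure (punctured_distr \<X> (coord_map D \<iota>)) {y. coord_proj (time_tail (coord_map D \<iota> d) k) y \<in> B - {0}})"
    by (simp add: emeasure_diamond_measure)
  also have "\<dots> = (\<Sum>k = 1..CARD('n). ennreal (time_gap d k) *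
     emeasure (punctured_distr \<X> (coord_map D \<iota>)) {y. coord_proj (coord_preimage (time_tail d k)) y \<in> B - {0}})"
    by (intro nn_layer_sum_transfer d coord_map_orthant levels_above_coord_map)
      (auto simp: coord_preimage_empty coord_proj_def vec_eq_iff zero_vec_def)
  also have "\<dots> = (\<Sum>k = 1..CARD('n). ennreal (time_gap d k) *
     emeasure \<X> {x. coord_map D \<iota> (coord_proj (time_tail d k) x) \<in> B - {0}})"
  proof (intro sum.cong refl arg_cong2[where f = "(*)"])
    fix k
    let ?S = "time_tail d k"
    have "emeasure (punctured_distr \<X> (coord_map D \<iota>)) {y. coord_proj (coord_preimage ?S) y \<in> B - {0}} =
       emeasure \<X> {x \<in> space \<X>. coord_map D \<iota> x \<in> {y. coord_proj (coord_preimage ?S) y \<in> B - {0}} - {0}}"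
      by (intro emeasure_punctured_distr) measurable
    also have "{x \<in> space \<X>. coord_map D \<iota> x \<in> {y. coord_proj (coord_preimage ?S) y \<in> B - {0}} - {0}} =
       {x. coord_map D \<iota> (coord_proj ?S x) \<in> B - {0}}"
      using sp by (auto simp flip: coord_proj_coord_map_commute)
    finally show "emeasure (punctured_distr \<X> (coord_map D \<iota>)) {y. coord_proj (coord_preimage ?S) y \<in> B - {0}} =
       emeasure \<X> {x. coord_map D \<iota> (coord_proj ?S x) \<in> B - {0}}" .
  qed
  also have "\<dots> = (\<Sum>k = 1..CARD('n). ennreal (time_gap d k) *
     emeasure \<X> {x. coord_proj (time_tail d k) x \<in> {y. coord_map D \<iota> y \<in> B - {0}} - {0}})"
  proof -
    have "coord_map D \<iota> (coord_proj S x) \<in> B - {0} \<longleftrightarrow> coord_proj S x \<in> {y. coord_map D \<iota> y \<in> B - {0}} - {0}" for S x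
      by auto
    then show ?thesis by simp
  qed
  also have "\<dots> = emeasure (diamond_measure d \<X>) {y. coord_map D \<iota> y \<in> B - {0}}"
    by (intro emeasure_diamond_measure[symmetric] X) measurable
  also have "\<dots> = emeasure ?r B"
    using sp by (simp add: emeasure_punctured_distr)
  finally show "emeasure ?l B = emeasure ?r B" .
qed simp

text \<open>
  All four recentering terms are layer sums of integrals of the same vector, the image of the projected
  x, against differences of truncations; on both sides the differences telescope to the truncation by
  the image of the projected x minus the truncation by x itself.
\<close>
lemma compensation_coord_map:
  assumes d: "d \<in> orthant" and X: "levy_measure \<X>" and inj: "inj_on \<iota> D"
  shows "compensation (coord_map D \<iota> d) (punctured_distr \<X> (coord_map D \<iota>))
      + diamond_vec (coord_map D \<iota> d) (coord_map D \<iota> \<mu> + recentering (coord_map D \<iota>) \<X>) =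
    coord_map D \<iota> (compensation d \<X>) + coord_map D \<iota> (diamond_vec d \<mu>)
      + recentering (coord_map D \<iota>) (diamond_measure d \<X>)"
proof -
  let ?L = "coord_map D \<iota>"
  let ?P = "punctured_distr \<X> ?L"
  let ?l = "\<lambda>x :: real ^ 'm. indicator (cball 0 1) x :: real" and ?i = "\<lambda>x :: real ^ 'n. indicator (cball 0 1) x :: real"
  have [measurable_cong]: "sets \<X> = sets borel"
    using X by (simp add: levy_measure_def)
  have Ln: "norm (?L x) \<le> norm x" for x
    by (rule norm_coord_map_le[OF inj])
  have pn: "norm (?L (coord_proj S x)) \<le> norm (coord_proj S x)" "norm (?L (coord_proj S x)) \<le> norm (?L x)"
    "norm (coord_proj S x) \<le> norm x" for S x
    using Ln norm_coord_proj_le[of S x] norm_coord_proj_le[of "coord_preimage S" "?L x"]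
    by (simp_all add: coord_proj_coord_map_commute)
  have bl: "bounded_linear ?L"
    using linear_coord_map by (simp add: linear_conv_bounded_linear)
  define a where "a S = (LINT x|\<X>. (?l (?L (coord_proj S x)) - ?l (?L x)) *\<^sub>R ?L (coord_proj S x))" for S
  define b where "b S = (LINT x|\<X>. (?l (?L x) - ?i x) *\<^sub>R ?L (coord_proj S x))" for S
  define c where "c S = (LINT x|\<X>. (?i (coord_proj S x) - ?i x) *\<^sub>R ?L (coord_proj S x))" for S
  define e where "e S = (LINT x|\<X>. (?l (?L (coord_proj S x)) - ?i (coord_proj S x)) *\<^sub>R ?L (coord_proj S x))" for S
  have C1: "compensation (?L d) ?P = layer_sum d a"
  proof -
    have "compensation (?L d) ?P = layer_sum d (\<lambda>S. recentering (coord_proj (coord_preimage S)) ?P)"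
      unfolding compensation_eq_layer_sum
      by (intro layer_sum_transfer d coord_map_orthant levels_above_coord_map)
        (auto simp: coord_preimage_empty recentering_def coord_proj_def zero_vec_def[symmetric])
    also have "\<dots> = layer_sum d a"
    proof (rule layer_sum_cong)
      fix S
      show "recentering (coord_proj (coord_preimage S)) ?P = a S"
        unfolding recentering_def a_def
        by (subst integral_punctured_distr) (auto simp: coord_proj_coord_map_commute)
    qed
    finally show ?thesis .
  qed
  have C2: "diamond_vec (?L d) (recentering ?L \<X>) = layer_sum d b"
  proof -
    have "diamond_vec (?L d) (recentering ?L \<X>) = layer_sum (?L d) (\<lambda>S. coord_proj S (recentering ?L \<X>))"
      using d by (simp add: layer_sum_coord_proj coord_map_orthant)
    also have "\<dots> = layer_sum d (\<lambda>S. coord_proj (coord_preimage S) (recentering ?L \<X>))"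
      by (intro layer_sum_transfer d coord_map_orthant levels_above_coord_map)
        (auto simp: coord_preimage_empty coord_proj_def zero_vec_def[symmetric])
    also have "\<dots> = layer_sum d b"
    proof (rule layer_sum_cong)
      fix S
      have bp: "bounded_linear (coord_proj R)" for R :: "'m set"
        by (simp add: coord_proj_coord_map linear_coord_map flip: linear_conv_bounded_linear)
      have "coord_proj (coord_preimage S) (recentering ?L \<X>) =
         (LINT x|\<X>. coord_proj (coord_preimage S) ((?l (?L x) - ?i x) *\<^sub>R ?L x))"
        unfolding recentering_def
        by (rule integral_bounded_linear[OF bp integrable_recentering[OF X borel_measurable_coord_map Ln], symmetric])
      then show "coord_proj (coord_preimage S) (recentering ?L \<X>) = b S"
        by (simp add: b_def linear_cmul[OF bounded_linear.linear[OF bp]] coord_proj_coord_map_commute)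
    qed
    finally show ?thesis .
  qed
  have C3: "diamond_vec (?L d) (?L \<mu>) = ?L (diamond_vec d \<mu>)"
    by (simp add: vec_eq_iff diamond_vec_def coord_map_def)
  have C4: "?L (compensation d \<X>) = layer_sum d c"
    unfolding compensation_eq_layer_sum layer_sum_linear[OF linear_coord_map]
  proof (rule layer_sum_cong)
    fix S
    show "?L (recentering (coord_proj S) \<X>) = c S"
      unfolding recentering_def c_def
      by (subst integral_bounded_linear[OF bl, symmetric])
        (auto intro!: integrable_recentering X norm_coord_proj_le simp: linear_cmul[OF linear_coord_map])
  qed
  have C5: "recentering ?L (diamond_measure d \<X>) = layer_sum d e"
    unfolding recentering_def e_def
  proof (rule integral_diamond_measure[OF d X, where C = 1])
    show "norm ((?l (?L x) - ?i x) *\<^sub>R ?L x) \<le> 1 * min 1 ((norm x)\<^sup>2)" for x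
      by (intro norm_truncation_difference_le Ln order_refl)
  qed measurable
  have "a S + b S = c S + e S" for S
  proof -
    have i: "integrable \<X> (\<lambda>x. (?l (?L (coord_proj S x)) - ?l (?L x)) *\<^sub>R ?L (coord_proj S x))"
       "integrable \<X> (\<lambda>x. (?l (?L x) - ?i x) *\<^sub>R ?L (coord_proj S x))"
       "integrable \<X> (\<lambda>x. (?i (coord_proj S x) - ?i x) *\<^sub>R ?L (coord_proj S x))"
       "integrable \<X> (\<lambda>x. (?l (?L (coord_proj S x)) - ?i (coord_proj S x)) *\<^sub>R ?L (coord_proj S x))"
      by (rule integrable_levy_measure[OF X _ norm_truncation_difference_le]; (rule pn Ln order_refl)?; measurable)+
    have "a S + b S = (LINT x|\<X>. (?l (?L (coord_proj S x)) - ?l (?L x)) *\<^sub>R ?L (coord_proj S x)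
        + (?l (?L x) - ?i x) *\<^sub>R ?L (coord_proj S x))"
      unfolding a_def b_def by (rule Bochner_Integration.integral_add[OF i(1,2), symmetric])
    also have "\<dots> = (LINT x|\<X>. (?i (coord_proj S x) - ?i x) *\<^sub>R ?L (coord_proj S x)
        + (?l (?L (coord_proj S x)) - ?i (coord_proj S x)) *\<^sub>R ?L (coord_proj S x))"
      by (intro Bochner_Integration.integral_cong refl) (simp add: algebra_simps)
    also have "\<dots> = c S + e S"
      unfolding c_def e_def by (rule Bochner_Integration.integral_add[OF i(3,4)])
    finally show ?thesis .
  qed
  then show ?thesis
    unfolding C1 C4 C5
    by (simp add: C2 C3 diamond_vec_add layer_sum_add[symmetric])
qed

end

section \<open>Pairs of vectors\<close>

lemma vfst_vjoin [simp]: "vfst (vjoin x y) = x" and vsnd_vjoin [simp]: "vsnd (vjoin x y) = y"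
  by (simp_all add: vfst_def vsnd_def vjoin_def)

lemma vjoin_vfst_vsnd [simp]: "vjoin (vfst z) (vsnd z) = z"
  by (auto simp: vec_eq_iff vfst_def vsnd_def vjoin_def split: sum.split)

lemma vjoin_eq_iff [simp]: "vjoin x y = vjoin x' y' \<longleftrightarrow> x = x' \<and> y = y'"
  by (metis vfst_vjoin vsnd_vjoin)

lemma vjoin_0 [simp]: "vjoin 0 0 = 0"
  by (auto simp: vec_eq_iff vjoin_def split: sum.split)

lemma vjoin_eq_0_iff [simp]: "vjoin x y = 0 \<longleftrightarrow> x = 0 \<and> y = 0"
  by (metis vjoin_0 vjoin_eq_iff)

lemma vfst_coord_map: "vfst = coord_map UNIV Inl" and vsnd_coord_map: "vsnd = coord_map UNIV Inr"
  by (auto simp: fun_eq_iff vfst_def vsnd_def coord_map_def)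

lemma vjoin_add: "vjoin x y + vjoin x' y' = vjoin (x + x') (y + y')"
  and vjoin_scaleR: "c *\<^sub>R vjoin x y = vjoin (c *\<^sub>R x) (c *\<^sub>R y)"
  by (auto simp: vec_eq_iff vjoin_def split: sum.split)

lemma norm_vjoin: "(norm (vjoin x y))\<^sup>2 = (norm x)\<^sup>2 + (norm y)\<^sup>2"
proof -
  have "(norm (vjoin x y))\<^sup>2 = (\<Sum>k\<in>UNIV <+> UNIV. (vjoin x y $ k)\<^sup>2)"
    by (simp add: norm_vec_def L2_set_def sum_nonneg)
  also have "\<dots> = (norm x)\<^sup>2 + (norm y)\<^sup>2"
    by (subst sum.Plus) (simp_all add: norm_vec_def L2_set_def sum_nonneg vjoin_def)
  finally show ?thesis .
qed

lemma norm_vjoin_0 [simp]: "norm (vjoin 0 y) = norm y" "norm (vjoin x 0) = norm x"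
  by (metis add.left_neutral add.right_neutral norm_ge_zero norm_vjoin norm_zero power2_eq_imp_eq zero_power2)+

lemma norm_le_norm_vjoin: "norm x \<le> norm (vjoin x y)" "norm y \<le> norm (vjoin x y)"
  by (rule power2_le_imp_le; simp add: norm_vjoin)+

lemma borel_measurable_vjoin [measurable (raw)]:
  fixes f g :: "'a \<Rightarrow> real ^ 'n"
  assumes [measurable]: "f \<in> borel_measurable M" "g \<in> borel_measurable M"
  shows "(\<lambda>x. vjoin (f x) (g x)) \<in> borel_measurable M"
proof -
  have "(\<lambda>x. case k of Inl i \<Rightarrow> f x $ i | Inr i \<Rightarrow> g x $ i) \<in> borel_measurable M" for k :: "'n + 'n"
    by (cases k) simp_all
  then show ?thesis
    unfolding vjoin_def by (rule borel_measurable_vec_lambda)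
qed

lemma integral_vjoin:
  fixes f g :: "'a \<Rightarrow> real ^ 'n"
  assumes "integrable M f" "integrable M g"
  shows "(LINT x|M. vjoin (f x) (g x)) = vjoin (LINT x|M. f x) (LINT x|M. g x)"
proof -
  have l: "bounded_linear (\<lambda>x :: real ^ 'n. vjoin x 0)" and r: "bounded_linear (\<lambda>x :: real ^ 'n. vjoin 0 x)"
    by (simp_all add: linear_conv_bounded_linear[symmetric] linear_iff vjoin_add vjoin_scaleR)
  have "(LINT x|M. vjoin (f x) (g x)) = (LINT x|M. vjoin (f x) 0 + vjoin 0 (g x))"
    by (simp add: vjoin_add)
  also have "\<dots> = vjoin (LINT x|M. f x) 0 + vjoin 0 (LINT x|M. g x)"
    using assms by (simp add: integral_bounded_linear[OF l] integral_bounded_linear[OF r]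
        integrable_bounded_linear[OF l] integrable_bounded_linear[OF r])
  finally show ?thesis
    by (simp add: vjoin_add)
qed

lemma norm_vfst_le: "norm (vfst z) \<le> norm z" and norm_vsnd_le: "norm (vsnd z) \<le> norm z"
  using norm_coord_map_le[of Inl UNIV z] norm_coord_map_le[of Inr UNIV z]
  by (simp_all add: vfst_coord_map vsnd_coord_map)

lemma borel_measurable_vfst: "vfst \<in> borel_measurable borel" and borel_measurable_vsnd: "vsnd \<in> borel_measurable borel"
  by (simp_all add: vfst_coord_map vsnd_coord_map)

lemma coord_map_vjoin:
  "coord_map (D <+> D) (map_sum \<iota> \<iota>) (vjoin t x) = vjoin (coord_map D \<iota> t) (coord_map D \<iota> x)"
  by (auto simp: vec_eq_iff coord_map_def vjoin_def split: sum.split)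

lemma inj_on_map_sum_Plus: "inj_on \<iota> D \<Longrightarrow> inj_on (map_sum \<iota> \<iota>) (D <+> D)"
  by (rule inj_onI) (elim PlusE; auto dest: inj_onD)

lemma weak_covariance_coord_map:
  "coord_submatrix (D <+> D) (map_sum \<iota> \<iota>) (weak_covariance d \<Sigma>) =
    weak_covariance (coord_map D \<iota> d) (coord_submatrix D \<iota> \<Sigma>)"
  by (auto simp: vec_eq_iff coord_submatrix_def weak_covariance_def diamond_mat_def coord_map_def split: sum.split)

section \<open>A jointly measurable version of the process at a multivariate time\<close>

text \<open>
  For s \<ge> 0 this is a grid point strictly to the right of s, at distance at most 1 / Suc k. It takes countably many values,
  and all of them are positive, also for s < 0, where nothing is known about the process.
\<close>
definition right_grid :: "nat \<Rightarrow> real \<Rightarrow> real" where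
  "right_grid k s = (real (nat \<lfloor>real (Suc k) * s\<rfloor>) + 1) / real (Suc k)"

lemma right_grid_bounds:
  assumes "0 \<le> s"
  shows "s < right_grid k s" "right_grid k s \<le> s + 1 / real (Suc k)"
proof -
  let ?x = "real (Suc k) * s"
  have "real (nat \<lfloor>?x\<rfloor>) = real_of_int \<lfloor>?x\<rfloor>"
    using assms by simp
  then have "?x < real (nat \<lfloor>?x\<rfloor>) + 1" "real (nat \<lfloor>?x\<rfloor>) + 1 \<le> ?x + 1"
    by linarith+
  then show "s < right_grid k s" "right_grid k s \<le> s + 1 / real (Suc k)"
    by (simp_all add: right_grid_def field_simps del: of_nat_Suc)
qed

lemma right_grid_at_right:
  assumes "0 \<le> s"
  shows "filterlim (\<lambda>k. right_grid k s) (at_right s) sequentially"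
proof (rule tendsto_imp_filterlim_at_right)
  show "(\<lambda>k. right_grid k s) \<longlonglongrightarrow> s"
  proof (rule tendsto_sandwich[of "\<lambda>_. s" _ _ "\<lambda>k. s + 1 / real (Suc k)"])
    have "(\<lambda>k. s + 1 / real (Suc k)) \<longlonglongrightarrow> s + 0"
      by (intro tendsto_add tendsto_const LIMSEQ_inverse_real_of_nat[unfolded inverse_eq_divide])
    then show "(\<lambda>k. s + 1 / real (Suc k)) \<longlonglongrightarrow> s" by simp
  qed (use right_grid_bounds[OF assms] in \<open>auto intro!: always_eventually less_imp_le\<close>)
  show "\<forall>\<^sub>F k in sequentially. s < right_grid k s"
    using right_grid_bounds[OF assms] by simp
qed

text \<open>
  The random variables \<open>multitime X t\<close> need not be jointly measurable in t and \<omega>, because right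
  continuity holds only almost surely. This limit is, and it agrees with them almost surely,
  simultaneously for all t in the orthant.
\<close>
definition rc_multitime :: "(real \<Rightarrow> 'w \<Rightarrow> real ^ 'n) \<Rightarrow> real ^ 'n \<Rightarrow> 'w \<Rightarrow> real ^ 'n" where
  "rc_multitime X t \<omega> = (\<chi> i. lim (\<lambda>k. X (right_grid k (t $ i)) \<omega> $ i))"

lemma measurable_rc_multitime:
  fixes X :: "real \<Rightarrow> 'w \<Rightarrow> real ^ 'n"
  assumes "levy_process M X"
  shows "(\<lambda>p. rc_multitime X (fst p) (snd p)) \<in> borel_measurable (borel \<Otimes>\<^sub>M M)"
  unfolding rc_multitime_def
proof (intro borel_measurable_vec_lambda borel_measurable_lim_metric)
  fix i :: 'n and k
  have "(\<lambda>p. (\<lambda>n p. X ((real n + 1) / real (Suc k)) (snd p) $ i) (nat \<lfloor>real (Suc k) * (fst p $ i)\<rfloor>) p)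
      \<in> borel_measurable (borel \<Otimes>\<^sub>M M)"
  proof (rule measurable_compose_countable[where f = "\<lambda>n p. X ((real n + 1) / real (Suc k)) (snd p) $ i"
        and g = "\<lambda>p. nat \<lfloor>real (Suc k) * (fst p $ i)\<rfloor>"])
    fix n :: nat
    have [measurable]: "X ((real n + 1) / real (Suc k)) \<in> borel_measurable M"
      using assms by (simp add: levy_process_def)
    show "(\<lambda>p. X ((real n + 1) / real (Suc k)) (snd p) $ i) \<in> borel_measurable (borel \<Otimes>\<^sub>M M)"
      by measurable
  qed measurable
  then show "(\<lambda>p. X (right_grid k (fst p $ i)) (snd p) $ i) \<in> borel_measurable (borel \<Otimes>\<^sub>M M)"
    by (simp add: right_grid_def)
qed

lemma AE_rc_multitime:
  fixes X :: "real \<Rightarrow> 'w \<Rightarrow> real ^ 'n"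
  assumes "levy_process M X"
  shows "AE \<omega> in M. \<forall>t\<in>orthant. rc_multitime X t \<omega> = multitime X t \<omega>"
proof -
  have "AE \<omega> in M. \<forall>t\<ge>0. ((\<lambda>s. X s \<omega>) \<longlongrightarrow> X t \<omega>) (at_right t) \<and>
        (0 < t \<longrightarrow> (\<exists>l. ((\<lambda>s. X s \<omega>) \<longlongrightarrow> l) (at_left t)))"
    using assms by (simp add: levy_process_def)
  then show ?thesis
  proof eventually_elim
    case (elim \<omega>)
    show ?case
    proof
      fix t :: "real ^ 'n" assume "t \<in> orthant"
      then have t: "0 \<le> t $ i" for i by (simp add: orthant_def)
      have "(\<lambda>k. X (right_grid k (t $ i)) \<omega> $ i) \<longlonglongrightarrow> X (t $ i) \<omega> $ i" for i
        using elim t[of i] by (intro tendsto_vec_nth filterlim_compose[OF _ right_grid_at_right]) auto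
      then have "lim (\<lambda>k. X (right_grid k (t $ i)) \<omega> $ i) = X (t $ i) \<omega> $ i" for i
        by (rule limI)
      then show "rc_multitime X t \<omega> = multitime X t \<omega>"
        by (simp add: rc_multitime_def multitime_def)
    qed
  qed
qed

section \<open>The Levy measure of a weakly subordinated process\<close>

text \<open>
  By the Markov inequality for the integrable function min(1, \<bar>x\<bar>^2), which is positive off the origin;
  the origin itself is a null set.
\<close>
lemma levy_measure_sigma_finite:
  fixes \<X> :: "(real ^ 'n) measure"
  assumes X: "levy_measure \<X>"
  shows "sigma_finite_measure \<X>"
proof
  have S: "sets \<X> = sets borel"
    using X by (simp add: levy_measure_def)
  note S[measurable_cong] and sp = sets_eq_imp_space_eq[OF S]
  define u :: "real ^ 'n \<Rightarrow> ennreal" where "u x = ennreal (min 1 ((norm x)\<^sup>2))" for x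
  define A where "A n = {x. 1 \<le> ennreal (real n) * u x}" for n
  have um[measurable]: "u \<in> borel_measurable borel"
    unfolding u_def by measurable
  have Am[measurable]: "A n \<in> sets borel" for n
    unfolding A_def by measurable
  have fin: "emeasure \<X> (A n) \<noteq> \<infinity>" for n
  proof -
    have "emeasure \<X> {x \<in> UNIV. 1 \<le> ennreal (real n) * u x} \<le> ennreal (real n) * (\<integral>\<^sup>+ x. u x * indicator UNIV x \<partial>\<X>)"
      using sp S by (intro nn_integral_Markov_inequality) auto
    also have "\<dots> < \<infinity>"
      using X by (auto simp: levy_measure_def u_def[abs_def] ennreal_mult_less_top)
    finally show ?thesis
      by (simp add: A_def)
  qed
  have cover: "\<exists>n. x \<in> A n" if "x \<noteq> 0" for x
  proof -
    let ?m = "min 1 ((norm x)\<^sup>2)"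
    have "?m > 0"
      using that by simp
    then obtain n where "1 < real n * ?m"
      using reals_Archimedean3 by blast
    then have "ennreal 1 \<le> ennreal (real n) * ennreal ?m"
      by (subst ennreal_mult[symmetric]) (auto intro!: ennreal_leI)
    then show ?thesis
      by (auto simp: A_def u_def)
  qed
  have "\<Union> (insert {0} (range A)) = space \<X>"
    using sp cover by auto
  then show "\<exists>\<A>. countable \<A> \<and> \<A> \<subseteq> sets \<X> \<and> \<Union>\<A> = space \<X> \<and> (\<forall>a\<in>\<A>. emeasure \<X> a \<noteq> \<infinity>)"
    using S sp X fin
    by (intro exI[of _ "insert {0} (range A)"]) (auto simp: levy_measure_def)
qed

lemma norm_exp_minus_1_le:
  fixes z :: complex
  shows "norm (exp z - 1) \<le> norm z * exp (norm z)"
proof -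
  have "norm (exp z - exp 0) \<le> exp (norm z) * norm (z - 0)"
  proof (rule field_differentiable_bound[where S = "cball 0 (norm z)" and f' = exp])
    show "norm (exp w) \<le> exp (norm z)" if "w \<in> cball 0 (norm z)" for w :: complex
      using that complex_Re_le_cmod[of w] by simp
  qed (auto intro!: derivative_eq_intros)
  then show ?thesis
    by (simp add: mult.commute)
qed

lemma abs_sin_diff_le: "\<bar>x - sin x\<bar> \<le> x\<^sup>2" for x :: real
proof -
  have "\<bar>sin x - (\<Sum>m<2. sin_coeff m * x ^ m)\<bar> \<le> inverse (fact 2) * \<bar>x\<bar> ^ 2"
    by (rule Maclaurin_sin_bound)
  then have "\<bar>x - sin x\<bar> \<le> x\<^sup>2 / 2"
    by (simp add: numeral_2_eq_2 sin_coeff_def abs_minus_commute)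
  then show ?thesis
    by (rule order_trans) simp
qed

text \<open>
  M carries the process X; d and \<open>\<T>\<close> are the drift and the Levy measure of the subordinator, which
  determine its law.
\<close>
locale subordination = prob_space M
  for M :: "'w measure" +
  fixes X :: "real \<Rightarrow> 'w \<Rightarrow> real ^ 'n" and d :: "real ^ 'n" and \<T> \<X> :: "(real ^ 'n) measure"
  assumes X: "levy_process M X" and \<X>: "levy_measure \<X>"
    and d: "d \<in> orthant" and \<T>: "levy_measure \<T>"
    and null: "emeasure \<T> (- orthant0) = 0"
    and fin: "(\<integral>\<^sup>+ t. ennreal (min 1 (norm t)) \<partial>\<T>) < \<infinity>"
begin

sublocale T: sigma_finite_measure \<T>
  by (rule levy_measure_sigma_finite[OF \<T>])

sublocale P: pair_sigma_finite \<T> M ..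

text \<open>
  A point p of the product space consists of a jump time vector and a sample point; \<open>\<phi> p\<close> is the
  jump of the weakly subordinated process that it produces, and \<open>\<xi> p\<close> the second half of that jump.
\<close>
abbreviation "P \<equiv> \<T> \<Otimes>\<^sub>M M"
abbreviation "\<xi> p \<equiv> rc_multitime X (fst p) (snd p)"
abbreviation "\<phi> p \<equiv> vjoin (fst p) (\<xi> p)"
abbreviation "DX \<equiv> diamond_measure d \<X>"
abbreviation "W \<equiv> weak_levy_measure d \<T> M X \<X>"

lemma sets_T [measurable_cong]: "sets \<T> = sets borel"
  using \<T> by (simp add: levy_measure_def)

lemma measurable_T: "measurable \<T> N = measurable borel N"
  by (rule measurable_cong_sets[OF sets_T refl])

lemma space_T: "space \<T> = UNIV"
  using sets_eq_imp_space_eq[OF sets_T] by simp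

lemma measurable_\<xi> [measurable]: "\<xi> \<in> borel_measurable P"
proof -
  have "measurable P (borel :: (real ^ 'n) measure) = measurable (borel \<Otimes>\<^sub>M M) borel"
    by (rule measurable_cong_sets[OF sets_pair_measure_cong[OF sets_T refl] refl])
  then show ?thesis
    using measurable_rc_multitime[OF X] by simp
qed

lemma measurable_rc_section [measurable]: "rc_multitime X t \<in> borel_measurable M"
  using measurable_compose[OF measurable_Pair1'[of t borel M] measurable_rc_multitime[OF X]] by simp

lemma measurable_multitime: "t \<in> orthant \<Longrightarrow> multitime X t \<in> borel_measurable M"
  unfolding multitime_def orthant_def using X
  by (intro borel_measurable_vec_lambda borel_measurable_vec_component) (simp add: levy_process_def)

lemma AE_rc: "t \<in> orthant \<Longrightarrow> AE \<omega> in M. rc_multitime X t \<omega> = multitime X t \<omega>"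
  using AE_rc_multitime[OF X] by eventually_elim auto

lemma AE_orthant0: "AE t in \<T>. t \<in> orthant0"
  using null by (intro AE_I[where N = "- orthant0"]) (auto simp: sets_T)

lemma orthant0D: "t \<in> orthant0 \<Longrightarrow> t \<in> orthant"
  by (simp add: orthant0_def)

lemma expectation_rc:
  fixes g :: "real ^ 'n \<Rightarrow> 'b::{banach, second_countable_topology}"
  assumes "t \<in> orthant" and [measurable]: "g \<in> borel_measurable borel"
  shows "(LINT \<omega>|M. g (multitime X t \<omega>)) = (LINT \<omega>|M. g (rc_multitime X t \<omega>))"
proof (rule integral_cong_AE)
  note measurable_multitime[OF assms(1), measurable]
  show "(\<lambda>\<omega>. g (multitime X t \<omega>)) \<in> borel_measurable M" "(\<lambda>\<omega>. g (rc_multitime X t \<omega>)) \<in> borel_measurable M"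
    by measurable
  show "AE \<omega> in M. g (multitime X t \<omega>) = g (rc_multitime X t \<omega>)"
    using AE_rc[OF assms(1)] by eventually_elim simp
qed

lemma emeasure_rc:
  assumes "t \<in> orthant" and [measurable]: "B \<in> sets borel"
  shows "emeasure M {\<omega> \<in> space M. multitime X t \<omega> \<in> B} = emeasure M {\<omega> \<in> space M. rc_multitime X t \<omega> \<in> B}"
proof (rule emeasure_eq_AE)
  note measurable_multitime[OF assms(1), measurable]
  show "{\<omega> \<in> space M. multitime X t \<omega> \<in> B} \<in> sets M" "{\<omega> \<in> space M. rc_multitime X t \<omega> \<in> B} \<in> sets M"
    by measurable
  show "AE \<omega> in M. \<omega> \<in> {\<omega> \<in> space M. multitime X t \<omega> \<in> B} \<longleftrightarrow> \<omega> \<in> {\<omega> \<in> space M. rc_multitime X t \<omega> \<in> B}"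
    using AE_rc[OF assms(1)] by eventually_elim auto
qed

text \<open>
  The second summand in the definition of \<open>weak_levy_measure\<close> is an image of a product measure, and
  in particular countably additive.
\<close>
lemma emeasure_jumps:
  assumes B[measurable]: "B \<in> sets borel"
  shows "(\<integral>\<^sup>+ t\<in>orthant0. emeasure M {\<omega> \<in> space M. vjoin t (multitime X t \<omega>) \<in> B} \<partial>\<T>) =
    emeasure P {p \<in> space P. \<phi> p \<in> B}"
    and measurable_emeasure_jumps: "(\<lambda>t. emeasure M {\<omega> \<in> space M. vjoin t (multitime X t \<omega>) \<in> B} * indicator orthant0 t) \<in> borel_measurable borel"
proof -
  let ?A = "{p \<in> space P. \<phi> p \<in> B}"
  have A: "?A \<in> sets P" by measurable
  have sec: "Pair t -` ?A = {\<omega> \<in> space M. rc_multitime X t \<omega> \<in> {x. vjoin t x \<in> B}}" for t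
    by (auto simp: space_pair_measure space_T)
  have eq: "emeasure M {\<omega> \<in> space M. vjoin t (multitime X t \<omega>) \<in> B} * indicator orthant0 t =
      emeasure M (Pair t -` ?A) * indicator orthant0 t" for t
  proof (cases "t \<in> orthant0")
    case True
    have "{x. vjoin t x \<in> B} \<in> sets borel" by measurable
    from emeasure_rc[OF orthant0D[OF True] this] show ?thesis
      unfolding sec by simp
  qed simp
  have m: "(\<lambda>t. emeasure M (Pair t -` ?A)) \<in> borel_measurable \<T>"
    by (rule measurable_emeasure_Pair[OF A])
  have "(\<lambda>t. emeasure M (Pair t -` ?A) * indicator orthant0 t) \<in> borel_measurable \<T>"
    using m by measurable
  then show "(\<lambda>t. emeasure M {\<omega> \<in> space M. vjoin t (multitime X t \<omega>) \<in> B} * indicator orthant0 t) \<in> borel_measurable borel"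
    unfolding eq measurable_T .
  have "(\<integral>\<^sup>+ t\<in>orthant0. emeasure M (Pair t -` ?A) \<partial>\<T>) = (\<integral>\<^sup>+ t. emeasure M (Pair t -` ?A) \<partial>\<T>)"
  proof (rule nn_integral_cong_AE)
    show "AE t in \<T>. emeasure M (Pair t -` ?A) * indicator orthant0 t = emeasure M (Pair t -` ?A)"
      using AE_orthant0 by eventually_elim simp
  qed
  also have "\<dots> = emeasure P ?A"
    by (rule emeasure_pair_measure_alt[OF A, symmetric])
  finally show "(\<integral>\<^sup>+ t\<in>orthant0. emeasure M {\<omega> \<in> space M. vjoin t (multitime X t \<omega>) \<in> B} \<partial>\<T>) = emeasure P ?A"
    unfolding eq .
qed

text \<open>
  The two parts of the Levy measure: jumps of X during the drift of the subordinator, and jumps caused by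
  jumps of the subordinator.
\<close>
definition components :: "bool \<Rightarrow> (real ^ ('n + 'n)) measure" where
  "components b = (if b then distr DX borel (vjoin 0) else distr P borel \<phi>)"

lemma components:
  "sets (components b) = sets borel"
  "B \<in> sets borel \<Longrightarrow> emeasure (components True) B = emeasure DX {x. vjoin 0 x \<in> B}"
  "B \<in> sets borel \<Longrightarrow> emeasure (components False) B = emeasure P {p \<in> space P. \<phi> p \<in> B}"
proof -
  have "space DX = UNIV"
    using sets_eq_imp_space_eq[OF sets_diamond_measure] by simp
  then show "B \<in> sets borel \<Longrightarrow> emeasure (components True) B = emeasure DX {x. vjoin 0 x \<in> B}"
    unfolding components_def by (simp add: emeasure_distr vimage_def)
  show "B \<in> sets borel \<Longrightarrow> emeasure (components False) B = emeasure P {p \<in> space P. \<phi> p \<in> B}"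
    unfolding components_def by (simp add: emeasure_distr vimage_def Int_def conj_commute)
qed (simp add: components_def)

lemma emeasure_return_pair:
  assumes B[measurable]: "B \<in> sets borel"
  shows "emeasure (distr (return borel 0 \<Otimes>\<^sub>M DX) borel (\<lambda>(t, x). vjoin t x)) B = emeasure DX {x. vjoin 0 x \<in> B}"
proof -
  interpret DX: sigma_finite_measure DX
    by (rule levy_measure_sigma_finite[OF levy_measure_diamond_measure[OF d \<X>]])
  have sp: "space DX = UNIV"
    using sets_eq_imp_space_eq[OF sets_diamond_measure] by simp
  let ?R = "return borel 0 \<Otimes>\<^sub>M DX :: ((real ^ 'n) \<times> (real ^ 'n)) measure"
  let ?A = "{p \<in> space ?R. vjoin (fst p) (snd p) \<in> B}"
  have "measurable ?R (borel :: (real ^ ('n + 'n)) measure) = measurable (borel \<Otimes>\<^sub>M borel) borel"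
    by (intro measurable_cong_sets sets_pair_measure_cong sets_return sets_diamond_measure refl)
  then have vj[measurable]: "(\<lambda>p. vjoin (fst p) (snd p)) \<in> borel_measurable ?R"
    by simp
  have A: "?A \<in> sets ?R"
    using measurable_sets[OF vj B] by (simp add: vimage_def Int_def conj_commute)
  have "emeasure (distr ?R borel (\<lambda>(t, x). vjoin t x)) B = emeasure ?R ?A"
    using vj by (subst emeasure_distr) (simp_all add: case_prod_beta' vimage_def Int_def conj_commute)
  also have "\<dots> = (\<integral>\<^sup>+ t. emeasure DX (Pair t -` ?A) \<partial>return borel 0)"
    by (rule DX.emeasure_pair_measure_alt[OF A])
  also have "\<dots> = emeasure DX (Pair 0 -` ?A)"
    using DX.measurable_emeasure_Pair[OF A] by (subst nn_integral_return) auto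
  also have "Pair 0 -` ?A = {x. vjoin 0 x \<in> B}"
    by (auto simp: space_pair_measure sp)
  finally show ?thesis .
qed

lemma W_weighted_sum: "W = measure_of UNIV (sets borel) (\<lambda>B. \<Sum>b\<in>UNIV. ennreal 1 * emeasure (components b) B)"
  unfolding weak_levy_measure_def
proof (rule measure_of_borel_eqI)
  show "sets (measure_of UNIV (sets borel) (\<lambda>B. \<Sum>b\<in>UNIV. ennreal 1 * emeasure (components b) B)) = sets borel"
    by (rule sets_weighted_sum) (simp_all add: components)
  fix B :: "(real ^ ('n + 'n)) set" assume B: "B \<in> sets borel"
  have "emeasure (measure_of UNIV (sets borel) (\<lambda>B. \<Sum>b\<in>UNIV. ennreal 1 * emeasure (components b) B)) B =
      (\<Sum>b\<in>UNIV. ennreal 1 * emeasure (components b) B)"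
    using B by (intro emeasure_weighted_sum) (simp_all add: components)
  then show "emeasure (distr (return borel 0 \<Otimes>\<^sub>M DX) borel (\<lambda>(t, x). vjoin t x)) B
      + (\<integral>\<^sup>+ t\<in>orthant0. emeasure M {\<omega> \<in> space M. vjoin t (multitime X t \<omega>) \<in> B} \<partial>\<T>) =
      emeasure (measure_of UNIV (sets borel) (\<lambda>B. \<Sum>b\<in>UNIV. ennreal 1 * emeasure (components b) B)) B"
    unfolding emeasure_return_pair[OF B] emeasure_jumps[OF B]
    by (simp only: UNIV_bool components(2,3)[OF B] finite.intros sum.insert) (simp add: components(2,3)[OF B] add.commute)
qed

lemma sets_W [simp, measurable_cong]: "sets W = sets borel"
  unfolding W_weighted_sum by (rule sets_weighted_sum) (simp_all add: components)

lemma space_W [simp]: "space W = UNIV"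
  using sets_eq_imp_space_eq[OF sets_W] by simp

lemma emeasure_W_sum: "B \<in> sets borel \<Longrightarrow> emeasure W B = (\<Sum>b\<in>UNIV. ennreal 1 * emeasure (components b) B)"
  unfolding W_weighted_sum by (subst emeasure_weighted_sum) (simp_all add: components)

lemma emeasure_W:
  "B \<in> sets borel \<Longrightarrow> emeasure W B = emeasure DX {x. vjoin 0 x \<in> B} + emeasure P {p \<in> space P. \<phi> p \<in> B}"
  by (simp add: emeasure_W_sum UNIV_bool components add.commute)

lemma
  fixes f :: "real ^ ('n + 'n) \<Rightarrow> 'b::{banach, second_countable_topology}"
  assumes f[measurable]: "f \<in> borel_measurable borel"
  shows integrable_W: "integrable W f \<longleftrightarrow> integrable DX (\<lambda>x. f (vjoin 0 x)) \<and> integrable P (\<lambda>p. f (\<phi> p))"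
    and integral_W: "integrable W f \<Longrightarrow> (LINT z|W. f z) = (LINT x|DX. f (vjoin 0 x)) + (LINT p|P. f (\<phi> p))"
proof -
  have s: "sets (components b) = sets W" for b
    by (simp add: components)
  have comp: "integrable (components True) f \<longleftrightarrow> integrable DX (\<lambda>x. f (vjoin 0 x))"
    "integrable (components False) f \<longleftrightarrow> integrable P (\<lambda>p. f (\<phi> p))"
    "(LINT z|components True. f z) = (LINT x|DX. f (vjoin 0 x))"
    "(LINT z|components False. f z) = (LINT p|P. f (\<phi> p))"
    by (simp_all add: components_def integrable_distr_eq integral_distr)
  show "integrable W f \<longleftrightarrow> integrable DX (\<lambda>x. f (vjoin 0 x)) \<and> integrable P (\<lambda>p. f (\<phi> p))"
    by (subst integrable_weighted_sum[of UNIV components W "\<lambda>_. 1"])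
      (auto simp: s emeasure_W_sum comp UNIV_bool)
  show "(LINT z|W. f z) = (LINT x|DX. f (vjoin 0 x)) + (LINT p|P. f (\<phi> p))" if "integrable W f"
    using integral_weighted_sum[of UNIV components W "\<lambda>_. 1" f] that
    by (simp add: s emeasure_W_sum UNIV_bool comp add.commute)
qed

lemma
  fixes G :: "real ^ 'n \<Rightarrow> real ^ 'n \<Rightarrow> 'b::{banach, second_countable_topology}"
  assumes G[measurable]: "(\<lambda>p. G (fst p) (snd p)) \<in> borel_measurable (borel \<Otimes>\<^sub>M borel)"
  shows set_integral_orthant0:
      "(LINT t:orthant0|\<T>. LINT \<omega>|M. G t (multitime X t \<omega>)) = (LINT t|\<T>. LINT \<omega>|M. G t (rc_multitime X t \<omega>))"
    and measurable_orthant0: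
      "(\<lambda>t. indicator orthant0 t *\<^sub>R (LINT \<omega>|M. G t (multitime X t \<omega>))) \<in> borel_measurable borel"
proof -
  have sec: "G t \<in> borel_measurable borel" for t
    using measurable_compose[OF measurable_Pair1'[of t borel borel] G] by simp
  have eq: "indicator orthant0 t *\<^sub>R (LINT \<omega>|M. G t (multitime X t \<omega>)) =
      indicator orthant0 t *\<^sub>R (LINT \<omega>|M. G t (rc_multitime X t \<omega>))" for t
    using expectation_rc[OF orthant0D sec, of t] by (cases "t \<in> orthant0") simp_all
  have "(\<lambda>p. (fst p, \<xi> p)) \<in> measurable P (borel \<Otimes>\<^sub>M borel)"
    by measurable
  from measurable_compose[OF this G] have GP: "(\<lambda>p. G (fst p) (\<xi> p)) \<in> borel_measurable P"
    by simp
  have m: "(\<lambda>t. LINT \<omega>|M. G t (rc_multitime X t \<omega>)) \<in> borel_measurable \<T>"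
    by (rule borel_measurable_lebesgue_integral) (use GP in \<open>simp add: case_prod_beta'\<close>)
  then show "(\<lambda>t. indicator orthant0 t *\<^sub>R (LINT \<omega>|M. G t (multitime X t \<omega>))) \<in> borel_measurable borel"
    unfolding eq measurable_T by measurable
  show "(LINT t:orthant0|\<T>. LINT \<omega>|M. G t (multitime X t \<omega>)) = (LINT t|\<T>. LINT \<omega>|M. G t (rc_multitime X t \<omega>))"
    unfolding set_lebesgue_integral_def eq
  proof (rule integral_cong_AE)
    show "AE t in \<T>. indicator orthant0 t *\<^sub>R (LINT \<omega>|M. G t (rc_multitime X t \<omega>)) = (LINT \<omega>|M. G t (rc_multitime X t \<omega>))"
      using AE_orthant0 by eventually_elim simp
  qed (use m in measurable)
qed

lemma integrable_P_norm_time: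
  fixes f :: "(real ^ 'n) \<times> 'w \<Rightarrow> 'b::{banach, second_countable_topology}"
  assumes f: "f \<in> borel_measurable P" and bound: "\<And>p. norm (f p) \<le> min 1 (norm (fst p))"
  shows "integrable P f"
proof -
  have "(\<integral>\<^sup>+ p. ennreal (min 1 (norm (fst p))) \<partial>P) = (\<integral>\<^sup>+ t. (\<integral>\<^sup>+ \<omega>. ennreal (min 1 (norm (fst (t, \<omega>)))) \<partial>M) \<partial>\<T>)"
    by (rule nn_integral_fst[symmetric]) measurable
  also have "\<dots> = (\<integral>\<^sup>+ t. ennreal (min 1 (norm t)) \<partial>\<T>)"
    by (simp add: emeasure_space_1)
  finally have "(\<integral>\<^sup>+ p. ennreal (min 1 (norm (fst p))) \<partial>P) < \<infinity>"
    using fin by simp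
  then have "integrable P (\<lambda>p. min 1 (norm (fst p)))"
    by (intro integrableI_nonneg) auto
  then show ?thesis
    by (rule Bochner_Integration.integrable_bound) (use f bound in auto)
qed

text \<open>
  The Levy measure of the subordinated process dominates the image of the product measure, so the
  integrability condition on it controls the joint size of t and X(t) on the product space.
\<close>
lemma integrable_P_W:
  fixes f :: "(real ^ 'n) \<times> 'w \<Rightarrow> 'b::{banach, second_countable_topology}"
  assumes W: "levy_measure W" and f: "f \<in> borel_measurable P"
    and bound: "\<And>p. norm (f p) \<le> C * min 1 ((norm (\<phi> p))\<^sup>2)"
  shows "integrable P f"
proof -
  have "integrable W (\<lambda>z. C * min 1 ((norm z)\<^sup>2))"
    by (intro integrable_mult_right integrable_levy_measure[OF W, where C = 1]) auto
  then have "integrable P (\<lambda>p. C * min 1 ((norm (\<phi> p))\<^sup>2))"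
    by (subst (asm) integrable_W) auto
  then show ?thesis
  proof (rule Bochner_Integration.integrable_bound[OF _ f])
    show "AE p in P. norm (f p) \<le> norm (C * min 1 ((norm (\<phi> p))\<^sup>2))"
      by (rule AE_I2, rule order_trans[OF bound]) simp
  qed
qed

text \<open>
  The integrand of \<open>weak_location2\<close>. It is kept as a function of t: the function of t and \<omega> under the
  inner integral need not be integrable on the product space.
\<close>
definition truncated_mean :: "real ^ 'n \<Rightarrow> real ^ 'n" where
  "truncated_mean t = (LINT \<omega>|M. indicator (cball 0 1) (vjoin t (rc_multitime X t \<omega>)) *\<^sub>R rc_multitime X t \<omega>)"

text \<open>
  Coordinatewise, the truncated variable is compared with its sine. The mean of the sine is the imaginary
  part of a characteristic function of X at time t_i, which gives the bound C min(1, \<bar>t\<bar>); the difference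
  is at most min(1, \<bar>(t, X(t))\<bar>^2) and hence integrable on the product space.
\<close>
lemma integrable_truncated_mean:
  assumes XL: "levy_law M X \<mu> \<Sigma> \<X>" and W: "levy_measure W"
  shows "integrable \<T> truncated_mean"
proof -
  let ?D = "cball 0 1 :: (real ^ ('n + 'n)) set"
  have sin_part: "integrable \<T> (\<lambda>t. LINT \<omega>|M. sin (rc_multitime X t \<omega> $ i))" for i
  proof -
    define \<Psi> where "\<Psi> = levy_exponent \<mu> \<Sigma> \<X> (axis i 1)"
    define C where "C = 1 + norm \<Psi> * exp (norm \<Psi>)"
    have bound: "\<bar>LINT \<omega>|M. sin (rc_multitime X t \<omega> $ i)\<bar> \<le> C * min 1 (norm t)" if "t \<in> orthant0" for t
    proof -
      have t: "t \<in> orthant" "0 \<le> t $ i"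
        using that by (auto simp: orthant0_def orthant_def)
      have Xm[measurable]: "X (t $ i) \<in> borel_measurable M"
        using X t by (simp add: levy_process_def)
      have "(LINT \<omega>|M. sin (rc_multitime X t \<omega> $ i)) = (LINT \<omega>|M. sin (multitime X t \<omega> $ i))"
        by (rule expectation_rc[symmetric, OF t(1)]) measurable
      also have "\<dots> = (LINT \<omega>|M. Im (iexp (axis i 1 \<bullet> X (t $ i) \<omega>)))"
        by (simp add: multitime_def inner_axis' Im_exp)
      also have "\<dots> = Im (CLINT \<omega>|M. iexp (axis i 1 \<bullet> X (t $ i) \<omega>))"
        by (intro integral_Im integrable_const_bound[of _ 1]) auto
      also have "\<dots> = Im (exp (of_real (t $ i) * \<Psi>))"
        using XL t(2) by (simp add: levy_law_def \<Psi>_def)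
      finally have E: "(LINT \<omega>|M. sin (rc_multitime X t \<omega> $ i)) = Im (exp (of_real (t $ i) * \<Psi>))" .
      show ?thesis
      proof (cases "norm t \<le> 1")
        case True
        have ti: "t $ i \<le> norm t" "t $ i \<le> 1"
          using component_le_norm_cart[of t i] True by linarith+
        have "\<bar>Im (exp (of_real (t $ i) * \<Psi>))\<bar> = \<bar>Im (exp (of_real (t $ i) * \<Psi>) - 1)\<bar>"
          by simp
        also have "\<dots> \<le> norm (of_real (t $ i) * \<Psi>) * exp (norm (of_real (t $ i) * \<Psi>))"
          by (rule order_trans[OF abs_Im_le_cmod norm_exp_minus_1_le])
        also have "\<dots> = t $ i * (norm \<Psi> * exp (t $ i * norm \<Psi>))"
          using t(2) by (simp add: norm_mult)
        also have "\<dots> \<le> norm t * (norm \<Psi> * exp (norm \<Psi>))"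
          using ti t(2) by (intro mult_mono) (auto intro: mult_left_le_one_le)
        also have "\<dots> \<le> C * norm t"
          by (simp add: C_def algebra_simps)
        finally show ?thesis
          using True by (simp add: E)
      next
        case False
        have "norm (LINT \<omega>|M. sin (rc_multitime X t \<omega> $ i)) \<le> (LINT \<omega>|M. 1)"
          by (rule order_trans[OF integral_norm_bound], rule integral_mono) (auto intro!: integrable_const_bound[of _ 1])
        also have "\<dots> \<le> C"
          by (simp add: C_def prob_space)
        finally show ?thesis
          using False by simp
      qed
    qed
    have "integrable \<T> (\<lambda>t. C * min 1 (norm t))"
      using fin by (intro integrable_mult_right integrableI_nonneg) auto
    then show ?thesis
    proof (rule Bochner_Integration.integrable_bound)
      have "(\<lambda>(t, \<omega>). sin (rc_multitime X t \<omega> $ i)) \<in> borel_measurable P"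
        unfolding case_prod_beta' by measurable
      then show "(\<lambda>t. LINT \<omega>|M. sin (rc_multitime X t \<omega> $ i)) \<in> borel_measurable \<T>"
        by (rule borel_measurable_lebesgue_integral)
      show "AE t in \<T>. norm (LINT \<omega>|M. sin (rc_multitime X t \<omega> $ i)) \<le> norm (C * min 1 (norm t))"
        using AE_orthant0 by eventually_elim (use bound in \<open>auto intro: order_trans[OF _ abs_ge_self]\<close>)
    qed
  qed
  define r where "r i p = indicator ?D (\<phi> p) * \<xi> p $ i - sin (\<xi> p $ i)" for i p
  have r: "integrable P (r i)" for i
  proof (rule integrable_P_W[OF W, where C = 1])
    show "r i \<in> borel_measurable P"
      unfolding r_def by measurable
    fix p
    have "\<bar>\<xi> p $ i\<bar> \<le> norm (\<phi> p)"
      using component_le_norm_cart[of "\<xi> p" i] norm_le_norm_vjoin(2)[of "\<xi> p" "fst p"] by linarith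
    then have "(\<xi> p $ i)\<^sup>2 \<le> (norm (\<phi> p))\<^sup>2"
      by (metis abs_ge_zero power2_abs power_mono)
    then show "norm (r i p) \<le> 1 * min 1 ((norm (\<phi> p))\<^sup>2)"
      using abs_sin_diff_le[of "\<xi> p $ i"]
      by (cases "norm (\<phi> p) \<le> 1") (auto simp: r_def min_absorb2 power_le_one min_absorb1)
  qed
  have "truncated_mean t $ i = (LINT \<omega>|M. sin (rc_multitime X t \<omega> $ i)) + (LINT \<omega>|M. r i (t, \<omega>))" for t i
  proof -
    have m: "integrable M (\<lambda>\<omega>. indicator ?D (vjoin t (rc_multitime X t \<omega>)) *\<^sub>R rc_multitime X t \<omega>)"
      using norm_le_norm_vjoin(2)[of _ t]
      by (intro integrable_const_bound[of _ 1]) (auto simp: indicator_def intro: order_trans)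
    have s: "integrable M (\<lambda>\<omega>. sin (rc_multitime X t \<omega> $ i))"
      by (intro integrable_const_bound[of _ 1]) auto
    have "(LINT \<omega>|M. r i (t, \<omega>)) = (LINT \<omega>|M. (indicator ?D (vjoin t (rc_multitime X t \<omega>)) *\<^sub>R rc_multitime X t \<omega>) $ i)
        - (LINT \<omega>|M. sin (rc_multitime X t \<omega> $ i))"
      unfolding r_def using integrable_bounded_linear[OF bounded_linear_vec_nth[of i] m] s by simp
    then show ?thesis
      unfolding truncated_mean_def by (simp add: integral_vec_nth[OF m])
  qed
  then have "truncated_mean = (\<lambda>t. \<chi> i. (LINT \<omega>|M. sin (rc_multitime X t \<omega> $ i)) + (LINT \<omega>|M. r i (t, \<omega>)))"
    by (simp add: fun_eq_iff vec_eq_iff)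
  then show ?thesis
    using sin_part P.integrable_fst'[OF r] by (auto intro!: integrable_vec_lambda)
qed

end

section \<open>Characteristics of the two components\<close>

context subordination
begin

lemma probability_scaleR:
  assumes "t \<in> orthant"
  shows "\<P>(\<omega> in M. vjoin t (multitime X t \<omega>) \<in> cball 0 1) *\<^sub>R t =
    (LINT \<omega>|M. indicator (cball 0 1) (vjoin t (multitime X t \<omega>)) *\<^sub>R t)"
proof -
  note measurable_multitime[OF assms, measurable]
  let ?A = "{\<omega> \<in> space M. vjoin t (multitime X t \<omega>) \<in> cball 0 1}"
  have [measurable]: "?A \<in> sets M" by measurable
  have "(LINT \<omega>|M. indicator (cball 0 1) (vjoin t (multitime X t \<omega>)) *\<^sub>R t) = (LINT \<omega>|M. indicator ?A \<omega> *\<^sub>R t)"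
    by (intro Bochner_Integration.integral_cong) (auto simp: indicator_def)
  also have "\<dots> = measure M ?A *\<^sub>R t"
  proof -
    have "?A \<inter> space M = ?A" by auto
    then show ?thesis
      by (subst integral_scaleR_left) (auto intro!: integrable_real_indicator simp: less_top[symmetric])
  qed
  finally show ?thesis by simp
qed

lemma weak_location1_eq_set_integral:
  "weak_location1 d \<T> M X = d + (LINT t:orthant0|\<T>. LINT \<omega>|M.
     indicator (cball 0 1) (vjoin t (multitime X t \<omega>)) *\<^sub>R t)"
proof -
  have "indicator orthant0 t *\<^sub>R (\<P>(\<omega> in M. vjoin t (multitime X t \<omega>) \<in> cball 0 1) *\<^sub>R t) =
      indicator orthant0 t *\<^sub>R (LINT \<omega>|M. indicator (cball 0 1) (vjoin t (multitime X t \<omega>)) *\<^sub>R t)" for t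
  proof (cases "t \<in> orthant0")
    case True
    then show ?thesis by (simp only: probability_scaleR[OF orthant0D])
  qed simp
  then show ?thesis
    unfolding weak_location1_def set_lebesgue_integral_def by simp
qed

lemma weak_location1_eq:
  "weak_location1 d \<T> M X = d + (LINT p|P. indicator (cball 0 1) (\<phi> p) *\<^sub>R fst p)"
proof -
  have "integrable P (\<lambda>p. indicator (cball 0 1) (\<phi> p) *\<^sub>R fst p)"
    using norm_le_norm_vjoin(1) by (intro integrable_P_norm_time) (measurable, auto simp: indicator_def intro: order_trans)
  from P.integral_fst'[OF this] show ?thesis
    unfolding weak_location1_eq_set_integral
    by (subst set_integral_orthant0[of "\<lambda>t x. indicator (cball 0 1) (vjoin t x) *\<^sub>R t"]) simp_all
qed

lemma weak_location2_eq:
  "weak_location2 d \<T> M X \<mu> \<X> = compensation d \<X> + diamond_vec d \<mu> + (LINT t|\<T>. truncated_mean t)"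
  unfolding weak_location2_def truncated_mean_def
  by (subst set_integral_orthant0[of "\<lambda>t x. indicator (cball 0 1) (vjoin t x) *\<^sub>R x"]) simp_all

text \<open>
  Although neither truncated vector need be integrable on the product space, their difference is. Hence
  the truncation may be changed under the iterated integral at the cost of an absolutely convergent
  integral.
\<close>
lemma integral_retruncated:
  fixes K :: "real ^ 'n \<Rightarrow> real ^ 'k" and l :: "(real ^ 'n) \<times> 'w \<Rightarrow> real"
  assumes XL: "levy_law M X \<mu> \<Sigma> \<X>" and W: "levy_measure W" and K: "bounded_linear K"
    and l[measurable]: "l \<in> borel_measurable P" and bound: "\<And>p. norm (l p *\<^sub>R K (\<xi> p)) \<le> 1"
    and int: "integrable P (\<lambda>p. (l p - indicator (cball 0 1) (\<phi> p)) *\<^sub>R K (\<xi> p))"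
  shows "(LINT t|\<T>. LINT \<omega>|M. l (t, \<omega>) *\<^sub>R K (rc_multitime X t \<omega>)) =
    K (LINT t|\<T>. truncated_mean t) + (LINT p|P. (l p - indicator (cball 0 1) (\<phi> p)) *\<^sub>R K (\<xi> p))"
proof -
  let ?i = "\<lambda>z :: real ^ ('n + 'n). indicator (cball 0 1) z :: real"
  have Km[measurable]: "K \<in> borel_measurable borel"
    by (intro borel_measurable_continuous_onI linear_continuous_on K)
  have lsec[measurable]: "(\<lambda>\<omega>. l (t, \<omega>)) \<in> borel_measurable M" for t
    by (rule measurable_compose[OF measurable_Pair1' l]) (simp add: space_T)
  have "(LINT \<omega>|M. l (t, \<omega>) *\<^sub>R K (rc_multitime X t \<omega>)) = K (truncated_mean t)
      + (LINT \<omega>|M. (l (t, \<omega>) - ?i (vjoin t (rc_multitime X t \<omega>))) *\<^sub>R K (rc_multitime X t \<omega>))" for t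
  proof -
    have m: "integrable M (\<lambda>\<omega>. ?i (vjoin t (rc_multitime X t \<omega>)) *\<^sub>R rc_multitime X t \<omega>)"
      using norm_le_norm_vjoin(2)[of _ t]
      by (intro integrable_const_bound[of _ 1]) (auto simp: indicator_def intro: order_trans)
    have Kt: "K (truncated_mean t) = (LINT \<omega>|M. ?i (vjoin t (rc_multitime X t \<omega>)) *\<^sub>R K (rc_multitime X t \<omega>))"
      unfolding truncated_mean_def
      by (subst integral_bounded_linear[OF K m, symmetric]) (simp add: linear_cmul[OF bounded_linear.linear[OF K]])
    have m': "integrable M (\<lambda>\<omega>. ?i (vjoin t (rc_multitime X t \<omega>)) *\<^sub>R K (rc_multitime X t \<omega>))"
      using integrable_bounded_linear[OF K m] by (simp add: linear_cmul[OF bounded_linear.linear[OF K]])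
    have lm: "integrable M (\<lambda>\<omega>. l (t, \<omega>) *\<^sub>R K (rc_multitime X t \<omega>))"
      using bound[of "(t, _)"] by (intro integrable_const_bound[of _ 1]) auto
    show ?thesis
      unfolding Kt scaleR_diff_left using Bochner_Integration.integral_diff[OF lm m'] by simp
  qed
  moreover have "integrable \<T> (\<lambda>t. K (truncated_mean t))"
    by (rule integrable_bounded_linear[OF K integrable_truncated_mean[OF XL W]])
  moreover have "(LINT t|\<T>. K (truncated_mean t)) = K (LINT t|\<T>. truncated_mean t)"
    by (rule integral_bounded_linear[OF K integrable_truncated_mean[OF XL W]])
  ultimately show ?thesis
    using P.integrable_fst'[OF int] P.integral_fst'[OF int] by simp
qed

lemma recentering_W:
  fixes f :: "real ^ ('n + 'n) \<Rightarrow> real ^ 'k"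
  assumes W: "levy_measure W" and f: "f \<in> borel_measurable borel" and contr: "\<And>z. norm (f z) \<le> norm z"
  shows "recentering f W =
      (LINT x|DX. (indicator (cball 0 1) (f (vjoin 0 x)) - indicator (cball 0 1) (vjoin 0 x)) *\<^sub>R f (vjoin 0 x))
    + (LINT p|P. (indicator (cball 0 1) (f (\<phi> p)) - indicator (cball 0 1) (\<phi> p)) *\<^sub>R f (\<phi> p))"
  unfolding recentering_def
  by (rule integral_W[OF _ integrable_recentering[OF W f contr]]) (use f in measurable)

lemma integrable_retruncation:
  fixes y :: "(real ^ 'n) \<times> 'w \<Rightarrow> real ^ 'k" and u :: "(real ^ 'n) \<times> 'w \<Rightarrow> real ^ 'm"
  assumes W: "levy_measure W" and [measurable]: "y \<in> borel_measurable P" "u \<in> borel_measurable P"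
    and "\<And>p. norm (y p) \<le> norm (u p)" "\<And>p. norm (u p) \<le> norm (\<phi> p)"
  shows "integrable P (\<lambda>p. (indicator (cball 0 1) (u p) - indicator (cball 0 1) (\<phi> p)) *\<^sub>R y p)"
  by (rule integrable_P_W[OF W _ norm_truncation_difference_le]) (use assms in \<open>auto\<close>)

text \<open>
  Jumps of X during the drift have vanishing first half, so they do not contribute. What the definition of
  the location truncates too much, by the norm of the pair instead of the norm of t, is restored by the
  recentering.
\<close>
lemma first_component_characteristics:
  assumes W: "levy_measure W"
  shows "weak_location1 d \<T> M X + recentering vfst W = d + (LINT t:cball 0 1|\<T>. t)"
    and "punctured_distr W vfst = \<T>"
proof -
  note borel_measurable_vfst[measurable]
  let ?i = "\<lambda>z :: real ^ ('n + 'n). indicator (cball 0 1) z :: real" and ?j = "\<lambda>z :: real ^ 'n. indicator (cball 0 1) z :: real"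
  have i1: "integrable P (\<lambda>p. ?i (\<phi> p) *\<^sub>R fst p)"
    using norm_le_norm_vjoin(1) by (intro integrable_P_norm_time) (measurable, auto simp: indicator_def intro: order_trans)
  have i2: "integrable P (\<lambda>p. (?j (fst p) - ?i (\<phi> p)) *\<^sub>R fst p)"
    by (intro integrable_retruncation W norm_le_norm_vjoin(1) order_refl) measurable
  have i3: "integrable P (\<lambda>p. ?j (fst p) *\<^sub>R fst p)"
    by (intro integrable_P_norm_time) (measurable, auto simp: indicator_def)
  have "(LINT p|P. ?j (fst p) *\<^sub>R fst p) = (LINT t|\<T>. LINT \<omega>|M. ?j t *\<^sub>R t)"
    using P.integral_fst'[OF i3] by simp
  also have "\<dots> = (LINT t:cball 0 1|\<T>. t)"
    by (simp add: set_lebesgue_integral_def prob_space)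
  finally have e: "(LINT p|P. ?j (fst p) *\<^sub>R fst p) = (LINT t:cball 0 1|\<T>. t)" .
  have "recentering vfst W = (LINT p|P. (?j (fst p) - ?i (\<phi> p)) *\<^sub>R fst p)"
    by (simp add: recentering_W[OF W borel_measurable_vfst norm_vfst_le])
  then show "weak_location1 d \<T> M X + recentering vfst W = d + (LINT t:cball 0 1|\<T>. t)"
    using Bochner_Integration.integral_add[OF i1 i2] e by (simp add: weak_location1_eq algebra_simps)
  show "punctured_distr W vfst = \<T>"
  proof (rule measure_eqI)
    fix B assume "B \<in> sets (punctured_distr W vfst)"
    then have B[measurable]: "B \<in> sets borel" by simp
    have "{z. vfst z \<in> B - {0}} \<in> sets (borel :: (real ^ ('n + 'n)) measure)" by measurable
    then have "emeasure (punctured_distr W vfst) B = emeasure P {p \<in> space P. fst p \<in> B - {0}}"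
      by (simp add: emeasure_punctured_distr emeasure_W)
    also have "{p \<in> space P. fst p \<in> B - {0}} = (B - {0}) \<times> space M"
      by (auto simp: space_pair_measure space_T)
    also have "emeasure P \<dots> = emeasure \<T> (B - {0})"
      by (subst emeasure_pair_measure_Times) (simp_all add: sets_T emeasure_space_1)
    also have "\<dots> = emeasure \<T> B"
    proof (rule emeasure_eq_AE)
      show "AE t in \<T>. t \<in> B - {0} \<longleftrightarrow> t \<in> B"
        using AE_orthant0 by eventually_elim (auto simp: orthant0_def)
    qed (simp_all add: sets_T)
    finally show "emeasure (punctured_distr W vfst) B = emeasure \<T> B" .
  qed (simp add: sets_T)
qed

text \<open>
  For a pair whose first half is 0 the two truncations agree, so only the jumps of the subordinator
  contribute to the recentering, and their contribution replaces the truncation by the pair with the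
  truncation by X(t).
\<close>
lemma second_component_characteristics:
  assumes XL: "levy_law M X \<mu> \<Sigma> \<X>" and W: "levy_measure W"
  shows "weak_location2 d \<T> M X \<mu> \<X> + recentering vsnd W = marginal_location d \<T> M X \<mu> \<X>"
    and "punctured_distr W vsnd = marginal_levy_measure d \<T> M X \<X>"
proof -
  note borel_measurable_vsnd[measurable]
  let ?i = "\<lambda>z :: real ^ ('n + 'n). indicator (cball 0 1) z :: real" and ?j = "\<lambda>z :: real ^ 'n. indicator (cball 0 1) z :: real"
  have "(LINT t:orthant0|\<T>. LINT \<omega>|M. ?j (multitime X t \<omega>) *\<^sub>R multitime X t \<omega>) =
      (LINT t|\<T>. LINT \<omega>|M. ?j (rc_multitime X t \<omega>) *\<^sub>R rc_multitime X t \<omega>)"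
    by (rule set_integral_orthant0[of "\<lambda>t x. ?j x *\<^sub>R x"]) measurable
  also have "\<dots> = (LINT t|\<T>. truncated_mean t) + (LINT p|P. (?j (\<xi> p) - ?i (\<phi> p)) *\<^sub>R \<xi> p)"
  proof -
    have "integrable P (\<lambda>p. (?j (\<xi> p) - ?i (\<phi> p)) *\<^sub>R \<xi> p)"
      by (intro integrable_retruncation W norm_le_norm_vjoin(2) order_refl) measurable
    then show ?thesis
      using integral_retruncated[OF XL W bounded_linear_ident, of "\<lambda>p. ?j (\<xi> p)"] by (simp add: indicator_def)
  qed
  finally show "weak_location2 d \<T> M X \<mu> \<X> + recentering vsnd W = marginal_location d \<T> M X \<mu> \<X>"
    by (simp add: recentering_W[OF W borel_measurable_vsnd norm_vsnd_le] weak_location2_eq marginal_location_def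
        indicator_def)
  show "punctured_distr W vsnd = marginal_levy_measure d \<T> M X \<X>"
    unfolding marginal_levy_measure_def
  proof (rule measure_of_borel_eqI[symmetric])
    fix B :: "(real ^ 'n) set" assume B[measurable]: "B \<in> sets borel"
    have C: "{z. vsnd z \<in> B - {0}} \<in> sets (borel :: (real ^ ('n + 'n)) measure)" by measurable
    have D: "{x. vjoin 0 x \<in> {z. vsnd z \<in> B - {0}}} = B - {0}" by auto
    have "emeasure (punctured_distr W vsnd) B = emeasure W {z. vsnd z \<in> B - {0}}"
      by (simp add: emeasure_punctured_distr)
    then show "emeasure DX (B - {0}) + (\<integral>\<^sup>+ t\<in>orthant0. emeasure M {\<omega> \<in> space M. multitime X t \<omega> \<in> B - {0}} \<partial>\<T>) =
        emeasure (punctured_distr W vsnd) B"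
      unfolding emeasure_W[OF C] D emeasure_jumps(1)[OF C, symmetric] by simp
  qed simp
qed

end

section \<open>Coordinate maps and weak subordination\<close>

text \<open>
  The same data before and after a coordinate map. The map LL acts by L on both halves of a pair, and the
  last two assumptions make the image of \<open>\<T>\<close> the Levy measure of a subordinator.
\<close>
locale projected_subordination = subordination M X d \<T> \<X>
  for M :: "'w measure" and X :: "real \<Rightarrow> 'w \<Rightarrow> real ^ 'n" and d \<T> \<X> +
  fixes D :: "'m::finite set" and \<iota> :: "'m \<Rightarrow> 'n"
  assumes inj: "inj_on \<iota> D"
    and null': "emeasure (punctured_distr \<T> (coord_map D \<iota>)) (- orthant0) = 0"
    and fin': "(\<integral>\<^sup>+ t. ennreal (min 1 (norm t)) \<partial>punctured_distr \<T> (coord_map D \<iota>)) < \<infinity>"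
begin

abbreviation "L \<equiv> coord_map D \<iota>"
abbreviation "LX \<equiv> \<lambda>t \<omega>. L (X t \<omega>)"
abbreviation "\<T>' \<equiv> punctured_distr \<T> L"
abbreviation "LL \<equiv> coord_map (D <+> D) (map_sum \<iota> \<iota>)"

lemma norm_L_le: "norm (L x) \<le> norm x"
  by (rule norm_coord_map_le[OF inj])

lemma norm_LL_le: "norm (LL z) \<le> norm z"
  by (rule norm_coord_map_le[OF inj_on_map_sum_Plus[OF inj]])

lemma LX: "levy_process M LX"
  using levy_process_linear_image[OF X, of "coord_matrix D \<iota>"] by (simp add: coord_matrix_mult)

sublocale proj: subordination M LX "L d" \<T>' "punctured_distr \<X> L"
proof
  show "levy_process M LX" by (rule LX)
  show "levy_measure (punctured_distr \<X> L)" "levy_measure \<T>'"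
    by (intro levy_measure_punctured_distr \<X> \<T> norm_L_le borel_measurable_coord_map)+
  show "L d \<in> orthant" by (rule coord_map_orthant[OF d])
qed (rule null' fin')+

text \<open>
  The coordinate j of the image process, run up to coordinate j of the image time, is the coordinate
  \<open>\<iota> j\<close> of X run up to the same time.
\<close>
lemma multitime_LX: "multitime LX (L t) \<omega> = L (multitime X t \<omega>)"
  by (simp add: vec_eq_iff multitime_def coord_map_def)

text \<open>
  A jump of T that the map sends to 0 leaves the selected coordinates of X at time 0, where they vanish.
  Such jumps are removed from the image of \<open>\<T>\<close>, and this shows that nothing is lost.
\<close>
lemma AE_L_multitime_0:
  assumes "L t = 0"
  shows "AE \<omega> in M. L (multitime X t \<omega>) = 0"
proof -
  have "t $ \<iota> j = 0" if "j \<in> D" for j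
    using arg_cong[OF assms, of "\<lambda>v. v $ j"] that by (simp add: coord_map_nth)
  moreover have "AE \<omega> in M. X 0 \<omega> = 0"
    using X by (simp add: levy_process_def)
  ultimately show ?thesis
    by (auto simp: vec_eq_iff coord_map_nth multitime_def elim!: eventually_mono)
qed

lemma L_orthant0: "t \<in> orthant0 \<Longrightarrow> L t \<noteq> 0 \<Longrightarrow> L t \<in> orthant0"
  by (auto simp: orthant0_def coord_map_orthant)

text \<open>
  The jumps t with vanishing image account for the assumption on G at the origin: they are absent on the
  left, and on the right they contribute G 0 0.
\<close>
lemma projected_set_integral:
  fixes G :: "real ^ 'm \<Rightarrow> real ^ 'm \<Rightarrow> 'b::{banach, second_countable_topology}"
  assumes G[measurable]: "(\<lambda>p. G (fst p) (snd p)) \<in> borel_measurable (borel \<Otimes>\<^sub>M borel)" and G0: "G 0 0 = 0"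
  shows "(LINT t:orthant0|\<T>'. LINT \<omega>|M. G t (multitime LX t \<omega>)) =
    (LINT t|\<T>. LINT \<omega>|M. G (L t) (L (rc_multitime X t \<omega>)))"
proof -
  have sec[measurable]: "G t \<in> borel_measurable borel" for t
    using measurable_compose[OF measurable_Pair1'[of t borel borel] G] by simp
  have m: "(\<lambda>t. indicator orthant0 t *\<^sub>R (LINT \<omega>|M. G t (multitime LX t \<omega>))) \<in> borel_measurable borel"
    by (rule proj.measurable_orthant0[OF G])
  have "(LINT t:orthant0|\<T>'. LINT \<omega>|M. G t (multitime LX t \<omega>)) =
     (LINT t|\<T>. indicator orthant0 (L t) *\<^sub>R (LINT \<omega>|M. G (L t) (multitime LX (L t) \<omega>)))"
    unfolding set_lebesgue_integral_def using m
    by (intro integral_punctured_distr) (auto simp: orthant0_def)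
  also have "\<dots> = (LINT t|\<T>. LINT \<omega>|M. G (L t) (L (rc_multitime X t \<omega>)))"
  proof (rule integral_cong_AE)
    show "(\<lambda>t. indicator orthant0 (L t) *\<^sub>R (LINT \<omega>|M. G (L t) (multitime LX (L t) \<omega>))) \<in> borel_measurable \<T>"
      unfolding measurable_T by (rule measurable_compose[OF borel_measurable_coord_map[of D \<iota>] m])
    have "(\<lambda>p. (L (fst p), L (\<xi> p))) \<in> measurable P (borel \<Otimes>\<^sub>M borel)"
      by measurable
    from measurable_compose[OF this G] have "(\<lambda>p. G (L (fst p)) (L (\<xi> p))) \<in> borel_measurable P"
      by simp
    then show "(\<lambda>t. LINT \<omega>|M. G (L t) (L (rc_multitime X t \<omega>))) \<in> borel_measurable \<T>"
      by (intro borel_measurable_lebesgue_integral) (simp add: case_prod_beta')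
    show "AE t in \<T>. indicator orthant0 (L t) *\<^sub>R (LINT \<omega>|M. G (L t) (multitime LX (L t) \<omega>)) =
        (LINT \<omega>|M. G (L t) (L (rc_multitime X t \<omega>)))"
      using AE_orthant0
    proof eventually_elim
      case (elim t)
      have e: "(LINT \<omega>|M. G (L t) (L (multitime X t \<omega>))) = (LINT \<omega>|M. G (L t) (L (rc_multitime X t \<omega>)))"
        by (rule expectation_rc[OF orthant0D[OF elim]]) measurable
      show ?case
      proof (cases "L t = 0")
        case True
        have "AE \<omega> in M. G 0 (L (multitime X t \<omega>)) = 0"
          using AE_L_multitime_0[OF True] by eventually_elim (simp add: G0)
        then have "(LINT \<omega>|M. G 0 (L (multitime X t \<omega>))) = 0"
          by (rule integral_eq_zero_AE)
        then show ?thesis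
          using True e by (simp add: orthant0_def)
      next
        case False
        then show ?thesis
          using L_orthant0[OF elim] e by (simp add: multitime_LX)
      qed
    qed
  qed
  finally show ?thesis .
qed

lemma weak_levy_measure_projected:
  "weak_levy_measure (L d) \<T>' M LX (punctured_distr \<X> L) = punctured_distr W LL"
  unfolding weak_levy_measure_def[of "L d"]
proof (rule measure_of_borel_eqI)
  fix B :: "(real ^ ('m + 'm)) set" assume B[measurable]: "B \<in> sets borel"
  let ?C = "{z. LL z \<in> B - {0}}"
  have C[measurable]: "?C \<in> sets (borel :: (real ^ ('n + 'n)) measure)" by measurable
  have spX: "space DX = UNIV"
    using sets_eq_imp_space_eq[OF sets_diamond_measure] by simp
  have "emeasure (diamond_measure (L d) (punctured_distr \<X> L)) {x. vjoin 0 x \<in> B} =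
      emeasure (punctured_distr DX L) {x. vjoin 0 x \<in> B}"
    using \<X> by (simp add: diamond_measure_coord_map[OF d] levy_measure_def)
  also have "\<dots> = emeasure DX {x \<in> space DX. L x \<in> {x. vjoin 0 x \<in> B} - {0}}"
    by (intro emeasure_punctured_distr) measurable
  also have "{x \<in> space DX. L x \<in> {x. vjoin 0 x \<in> B} - {0}} = {x. vjoin 0 x \<in> ?C}"
    using spX by (auto simp: coord_map_vjoin)
  finally have a: "emeasure (diamond_measure (L d) (punctured_distr \<X> L)) {x. vjoin 0 x \<in> B} =
      emeasure DX {x. vjoin 0 x \<in> ?C}" .
  have "(\<integral>\<^sup>+ t\<in>orthant0. emeasure M {\<omega> \<in> space M. vjoin t (multitime LX t \<omega>) \<in> B} \<partial>\<T>') =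
     (\<integral>\<^sup>+ t. emeasure M {\<omega> \<in> space M. vjoin (L t) (multitime LX (L t) \<omega>) \<in> B} * indicator orthant0 (L t) \<partial>\<T>)"
    using proj.measurable_emeasure_jumps[OF B]
    by (intro nn_integral_punctured_distr) (auto simp: orthant0_def)
  also have "\<dots> = (\<integral>\<^sup>+ t\<in>orthant0. emeasure M {\<omega> \<in> space M. vjoin t (multitime X t \<omega>) \<in> ?C} \<partial>\<T>)"
  proof (rule nn_integral_cong_AE)
    show "AE t in \<T>. emeasure M {\<omega> \<in> space M. vjoin (L t) (multitime LX (L t) \<omega>) \<in> B} * indicator orthant0 (L t) =
        emeasure M {\<omega> \<in> space M. vjoin t (multitime X t \<omega>) \<in> ?C} * indicator orthant0 t"
      using AE_orthant0
    proof eventually_elim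
      case (elim t)
      show ?case
      proof (cases "L t = 0")
        case True
        note measurable_multitime[OF orthant0D[OF elim], measurable]
        have "{\<omega> \<in> space M. vjoin t (multitime X t \<omega>) \<in> ?C} \<in> sets M"
          by measurable
        moreover have "AE \<omega> in M. \<not> vjoin t (multitime X t \<omega>) \<in> ?C"
          using AE_L_multitime_0[OF True] by eventually_elim (simp add: coord_map_vjoin True)
        ultimately have "emeasure M {\<omega> \<in> space M. vjoin t (multitime X t \<omega>) \<in> ?C} = 0"
          by (subst emeasure_eq_0_AE) auto
        then show ?thesis
          using True by (simp add: orthant0_def)
      next
        case False
        then show ?thesis
          using L_orthant0[OF elim] elim by (simp add: multitime_LX coord_map_vjoin)
      qed
    qed
  qed
  finally have b: "(\<integral>\<^sup>+ t\<in>orthant0. emeasure M {\<omega> \<in> space M. vjoin t (multitime LX t \<omega>) \<in> B} \<partial>\<T>') =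
      emeasure P {p \<in> space P. \<phi> p \<in> ?C}"
    by (simp only: emeasure_jumps(1)[OF C])
  have "emeasure (punctured_distr W LL) B = emeasure W ?C"
    by (simp add: emeasure_punctured_distr)
  then show "emeasure (distr (return borel 0 \<Otimes>\<^sub>M diamond_measure (L d) (punctured_distr \<X> L)) borel (\<lambda>(t, x). vjoin t x)) B
      + (\<integral>\<^sup>+ t\<in>orthant0. emeasure M {\<omega> \<in> space M. vjoin t (multitime LX t \<omega>) \<in> B} \<partial>\<T>')
      = emeasure (punctured_distr W LL) B"
    unfolding proj.emeasure_return_pair[OF B] a b emeasure_W[OF C] by simp
qed simp

text \<open>
  The recentering vector of LL splits into the part from the drift, which combines with the compensation by
  \<open>compensation_coord_map\<close>, and the part from the jumps of the subordinator, which changes the truncation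
  in both integrals over t from the pair to its image.
\<close>
lemma weak_location_projected:
  assumes XL: "levy_law M X \<mu> \<Sigma> \<X>" and W: "levy_measure W"
  shows "LL (vjoin (weak_location1 d \<T> M X) (weak_location2 d \<T> M X \<mu> \<X>)) + recentering LL W =
    vjoin (weak_location1 (L d) \<T>' M LX)
      (weak_location2 (L d) \<T>' M LX (L \<mu> + recentering L \<X>) (punctured_distr \<X> L))"
proof -
  let ?i = "\<lambda>z :: real ^ ('n + 'n). indicator (cball 0 1) z :: real" and ?l = "\<lambda>z :: real ^ ('m + 'm). indicator (cball 0 1) z :: real"
  have bl: "bounded_linear L"
    using linear_coord_map by (simp add: linear_conv_bounded_linear)
  have bound: "norm (L (fst p)) \<le> norm (LL (\<phi> p))" "norm (L (\<xi> p)) \<le> norm (LL (\<phi> p))" for p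
    by (simp_all add: coord_map_vjoin norm_le_norm_vjoin)
  have int: "integrable P (\<lambda>p. (?l (LL (\<phi> p)) - ?i (\<phi> p)) *\<^sub>R L (fst p))"
    "integrable P (\<lambda>p. (?l (LL (\<phi> p)) - ?i (\<phi> p)) *\<^sub>R L (\<xi> p))"
    by (intro integrable_retruncation W bound norm_LL_le; measurable)+
  define a where "a = (LINT p|P. (?l (LL (\<phi> p)) - ?i (\<phi> p)) *\<^sub>R L (fst p))"
  define b where "b = (LINT p|P. (?l (LL (\<phi> p)) - ?i (\<phi> p)) *\<^sub>R L (\<xi> p))"
  have rec: "recentering LL W = vjoin a (recentering L DX + b)"
  proof -
    have "recentering LL W = (LINT x|DX. vjoin 0 ((indicator (cball 0 1) (L x) - indicator (cball 0 1) x) *\<^sub>R L x))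
        + (LINT p|P. vjoin ((?l (LL (\<phi> p)) - ?i (\<phi> p)) *\<^sub>R L (fst p)) ((?l (LL (\<phi> p)) - ?i (\<phi> p)) *\<^sub>R L (\<xi> p)))"
      unfolding recentering_W[OF W borel_measurable_coord_map norm_LL_le]
      by (simp add: coord_map_vjoin vjoin_scaleR indicator_def)
    also have "\<dots> = vjoin 0 (recentering L DX) + vjoin a b"
      using integral_vjoin[OF _ integrable_recentering[OF levy_measure_diamond_measure[OF d \<X>] borel_measurable_coord_map norm_L_le], of "\<lambda>_. 0"]
      by (simp add: integral_vjoin[OF int] a_def b_def recentering_def)
    finally show ?thesis by (simp add: vjoin_add)
  qed
  have "weak_location1 (L d) \<T>' M LX = L d + (LINT t|\<T>. LINT \<omega>|M. ?l (vjoin (L t) (L (rc_multitime X t \<omega>))) *\<^sub>R L t)"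
    unfolding proj.weak_location1_eq_set_integral
    by (subst projected_set_integral[of "\<lambda>t x. ?l (vjoin t x) *\<^sub>R t"]) simp_all
  also have "(LINT t|\<T>. LINT \<omega>|M. ?l (vjoin (L t) (L (rc_multitime X t \<omega>))) *\<^sub>R L t) = (LINT p|P. ?l (LL (\<phi> p)) *\<^sub>R L (fst p))"
  proof -
    have "integrable P (\<lambda>p. ?l (LL (\<phi> p)) *\<^sub>R L (fst p))"
    proof (rule integrable_P_norm_time)
      show "norm (?l (LL (\<phi> p)) *\<^sub>R L (fst p)) \<le> min 1 (norm (fst p))" for p
        using bound(1)[of p] norm_L_le[of "fst p"] by (auto simp: indicator_def)
    qed measurable
    from P.integral_fst'[OF this] show ?thesis by (simp add: coord_map_vjoin)
  qed
  also have "\<dots> = L (LINT p|P. ?i (\<phi> p) *\<^sub>R fst p) + a"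
  proof -
    have i: "integrable P (\<lambda>p. ?i (\<phi> p) *\<^sub>R fst p)"
      using norm_le_norm_vjoin(1) by (intro integrable_P_norm_time) (measurable, auto simp: indicator_def intro: order_trans)
    have "L (LINT p|P. ?i (\<phi> p) *\<^sub>R fst p) = (LINT p|P. ?i (\<phi> p) *\<^sub>R L (fst p))"
      by (subst integral_bounded_linear[OF bl i, symmetric]) (simp add: linear_cmul[OF linear_coord_map])
    moreover have i': "integrable P (\<lambda>p. ?i (\<phi> p) *\<^sub>R L (fst p))"
      using integrable_bounded_linear[OF bl i] by (simp add: linear_cmul[OF linear_coord_map])
    ultimately show ?thesis
      using Bochner_Integration.integral_add[OF i' int(1)] by (simp add: a_def scaleR_add_left[symmetric])
  qed
  finally have loc1: "weak_location1 (L d) \<T>' M LX = L (weak_location1 d \<T> M X) + a"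
    by (simp add: weak_location1_eq linear_add[OF linear_coord_map])
  have "(LINT t:orthant0|\<T>'. LINT \<omega>|M. ?l (vjoin t (multitime LX t \<omega>)) *\<^sub>R multitime LX t \<omega>) =
      (LINT t|\<T>. LINT \<omega>|M. ?l (vjoin (L t) (L (rc_multitime X t \<omega>))) *\<^sub>R L (rc_multitime X t \<omega>))"
    by (rule projected_set_integral[of "\<lambda>t x. ?l (vjoin t x) *\<^sub>R x"]) simp_all
  also have "\<dots> = L (LINT t|\<T>. truncated_mean t) + b"
  proof -
    have "norm (?l (LL (\<phi> p)) *\<^sub>R L (\<xi> p)) \<le> 1" for p
      using bound(2)[of p] by (auto simp: indicator_def)
    then show ?thesis
      unfolding b_def using integral_retruncated[OF XL W bl _ _ int(2)]
      by (simp add: coord_map_vjoin)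
  qed
  finally have "weak_location2 (L d) \<T>' M LX (L \<mu> + recentering L \<X>) (punctured_distr \<X> L) =
      L (weak_location2 d \<T> M X \<mu> \<X>) + recentering L DX + b"
    unfolding weak_location2_def[of "L d"] compensation_coord_map[OF d \<X> inj]
    by (simp add: weak_location2_eq linear_add[OF linear_coord_map])
  then show ?thesis
    by (simp add: coord_map_vjoin rec loc1 vjoin_add)
qed

end

lemma weak_subordination_coord_map:
  fixes \<iota> :: "'m::finite \<Rightarrow> 'n::finite"
  assumes WS: "weak_subordination MT T d \<T> MX X \<mu> \<Sigma> \<X> MZ Z" and inj: "inj_on \<iota> D"
  shows "weak_subordination MT (\<lambda>t \<omega>. coord_map D \<iota> (T t \<omega>)) (coord_map D \<iota> d) (punctured_distr \<T> (coord_map D \<iota>))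
    MX (\<lambda>t \<omega>. coord_map D \<iota> (X t \<omega>)) (coord_map D \<iota> \<mu> + recentering (coord_map D \<iota>) \<X>) (coord_submatrix D \<iota> \<Sigma>)
      (punctured_distr \<X> (coord_map D \<iota>))
    MZ (\<lambda>t \<omega>. vjoin (coord_map D \<iota> (vfst (Z t \<omega>))) (coord_map D \<iota> (vsnd (Z t \<omega>))))"
proof -
  have TL: "subordinator_law MT T d \<T>" and XL: "levy_law MX X \<mu> \<Sigma> \<X>"
    and ZL: "levy_law MZ Z (vjoin (weak_location1 d \<T> MX X) (weak_location2 d \<T> MX X \<mu> \<X>))
       (weak_covariance d \<Sigma>) (weak_levy_measure d \<T> MX X \<X>)"
    using WS by (auto simp: weak_subordination_def)
  have TL': "subordinator_law MT (\<lambda>t \<omega>. coord_map D \<iota> (T t \<omega>)) (coord_map D \<iota> d) (punctured_distr \<T> (coord_map D \<iota>))"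
    by (rule subordinator_law_coord_map[OF TL inj])
  interpret prob_space MX
    using XL by (simp add: levy_law_def levy_process_def)
  interpret projected_subordination MX X d \<T> \<X> D \<iota>
    by unfold_locales (use TL TL' XL inj in \<open>simp_all add: subordinator_law_def levy_law_def\<close>)
  have W: "levy_measure W"
    using ZL by (simp add: levy_law_def)
  have LLZ: "vjoin (L (vfst z)) (L (vsnd z)) = LL z" for z
    using coord_map_vjoin[of D \<iota> "vfst z" "vsnd z"] by simp
  show ?thesis
    unfolding weak_subordination_def LLZ
    using TL' levy_law_coord_map[OF XL inj] levy_law_coord_map[OF ZL inj_on_map_sum_Plus[OF inj]]
    by (simp add: weak_location_projected[OF XL W] weak_covariance_coord_map weak_levy_measure_projected)
qed

section \<open>Marginals of weakly subordinated processes\<close>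

theorem proposition3p2:
  fixes MT :: "'u measure" and T :: "real \<Rightarrow> 'u \<Rightarrow> real ^ 'n"
    and MX :: "'v measure" and X :: "real \<Rightarrow> 'v \<Rightarrow> real ^ 'n"
    and MZ :: "'w measure" and Z :: "real \<Rightarrow> 'w \<Rightarrow> real ^ ('n + 'n)"
    and d \<mu> :: "real ^ 'n" and \<Sigma> :: "real ^ 'n ^ 'n" and \<T> \<X> :: "(real ^ 'n) measure"
  assumes "subordinator_law MT T d \<T>"
    and "levy_law MX X \<mu> \<Sigma> \<X>"
    and "weak_subordination MT T d \<T> MX X \<mu> \<Sigma> \<X> MZ Z"
  shows "eq_in_law MZ (\<lambda>t \<omega>. vfst (Z t \<omega>)) MT T
    \<and> levy_law MZ (\<lambda>t \<omega>. vsnd (Z t \<omega>))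
        (marginal_location d \<T> MX X \<mu> \<X>) (diamond_mat d \<Sigma>) (marginal_levy_measure d \<T> MX X \<X>)
    \<and> (\<forall>J :: 'n set.
        weakly_subordinates MT (\<lambda>t \<omega>. coord_proj J (T t \<omega>)) MX (\<lambda>t \<omega>. coord_proj J (X t \<omega>))
          MZ (\<lambda>t \<omega>. vjoin (coord_proj J (vfst (Z t \<omega>))) (coord_proj J (vsnd (Z t \<omega>)))))
    \<and> (\<forall>k :: 'n.
        weakly_subordinates MT (\<lambda>t \<omega>. vec (T t \<omega> $ k) :: real ^ 1) MX (\<lambda>t \<omega>. vec (X t \<omega> $ k))
          MZ (\<lambda>t \<omega>. vjoin (vec (vfst (Z t \<omega>) $ k)) (vec (vsnd (Z t \<omega>) $ k))))"
proof (intro conjI allI)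
  have Z: "levy_law MZ Z (vjoin (weak_location1 d \<T> MX X) (weak_location2 d \<T> MX X \<mu> \<X>))
       (weak_covariance d \<Sigma>) (weak_levy_measure d \<T> MX X \<X>)"
    using assms(3) by (simp add: weak_subordination_def)
  interpret prob_space MX
    using assms(2) by (simp add: levy_law_def levy_process_def)
  interpret subordination MX X d \<T> \<X>
    by unfold_locales (use assms in \<open>simp_all add: subordinator_law_def levy_law_def\<close>)
  have W: "levy_measure W"
    using Z by (simp add: levy_law_def)
  have "levy_law MZ (\<lambda>t \<omega>. vfst (Z t \<omega>)) (d + (LINT t:cball 0 1|\<T>. t)) 0 \<T>"
  proof -
    have "coord_submatrix UNIV Inl (weak_covariance d \<Sigma>) = 0"
      by (simp add: coord_submatrix_def weak_covariance_def vec_eq_iff)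
    then show ?thesis
      using levy_law_coord_map[OF Z, of Inl UNIV] first_component_characteristics[OF W]
      by (simp flip: vfst_coord_map)
  qed
  then show "eq_in_law MZ (\<lambda>t \<omega>. vfst (Z t \<omega>)) MT T"
    using assms(1) by (intro levy_law_eq_in_law) (auto simp: subordinator_law_def)
  have "coord_submatrix UNIV Inr (weak_covariance d \<Sigma>) = diamond_mat d \<Sigma>"
    by (simp add: coord_submatrix_def weak_covariance_def vec_eq_iff)
  then show "levy_law MZ (\<lambda>t \<omega>. vsnd (Z t \<omega>))
      (marginal_location d \<T> MX X \<mu> \<X>) (diamond_mat d \<Sigma>) (marginal_levy_measure d \<T> MX X \<X>)"
    using levy_law_coord_map[OF Z, of Inr UNIV] second_component_characteristics[OF assms(2) W]
    by (simp flip: vsnd_coord_map)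
  show "weakly_subordinates MT (\<lambda>t \<omega>. coord_proj J (T t \<omega>)) MX (\<lambda>t \<omega>. coord_proj J (X t \<omega>))
      MZ (\<lambda>t \<omega>. vjoin (coord_proj J (vfst (Z t \<omega>))) (coord_proj J (vsnd (Z t \<omega>))))" for J
    unfolding weakly_subordinates_def coord_proj_coord_map
    by (intro exI, rule weak_subordination_coord_map[OF assms(3)]) simp
  have vec: "vec (x $ k) = (coord_map UNIV (\<lambda>_. k) x :: real ^ 1)" for k and x :: "real ^ 'n"
    by (simp add: vec_eq_iff coord_map_def)
  show "weakly_subordinates MT (\<lambda>t \<omega>. vec (T t \<omega> $ k) :: real ^ 1) MX (\<lambda>t \<omega>. vec (X t \<omega> $ k))
      MZ (\<lambda>t \<omega>. vjoin (vec (vfst (Z t \<omega>) $ k)) (vec (vsnd (Z t \<omega>) $ k)))" for k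
    unfolding weakly_subordinates_def vec
    by (intro exI, rule weak_subordination_coord_map[OF assms(3)]) (simp add: inj_on_def)
qed

end
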